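(* Let $k$ be an algebraically closed field and $G$ a finite group such that the characteristic $p>0$ of $k$ divides $|G|$; write $|G|=p^aq$ with $q$ prime to $p$. Suppose $G$ has exactly one Sylow $p$-subgroup and it is cyclic. The following are equivalent: (i) the Lie algebra $\operatorname{H}^1(kG,kG)$ is semisimple; (ii) $G$ is the direct product of a group $K$ of order $q$ and a cyclic group of order $p$, and $p\neq2$; (iii) $\operatorname{H}^1(kG,kG)$ is a product of Witt algebras $W(1,1):=\operatorname{Der}(k[X]/(X^p))$, and $p\neq2$.
   Context: $\operatorname{H}^1(kG,kG)$ is the first Hochschild cohomology of the group algebra $kG$, i.e. the Lie algebra of $k$-linear derivations of $kG$ modulo inner derivations, with the commutator bracket. A Lie algebra is semisimple if its solvable radical is zero. *)

theory Defs
  imports "HOL-Algebra.Algebra" "HOL-Computational_Algebra.Polynomial"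
begin

definition sylow_subgroup :: "('g, 'b) monoid_scheme \<Rightarrow> nat \<Rightarrow> 'g set \<Rightarrow> bool" where
  "sylow_subgroup G p P \<longleftrightarrow> subgroup P G \<and> card P = p ^ multiplicity p (Coset.order G)"

definition internal_direct_product :: "('g, 'b) monoid_scheme \<Rightarrow> 'g set \<Rightarrow> 'g set \<Rightarrow> bool" where
  "internal_direct_product G K C \<longleftrightarrow>
     K \<lhd> G \<and> C \<lhd> G \<and> K \<inter> C = {\<one>\<^bsub>G\<^esub>} \<and> K <#>\<^bsub>G\<^esub> C = carrier G"

definition fspace :: "'i set \<Rightarrow> ('i \<Rightarrow> 'k::field) set" where
  "fspace I = {f. \<forall>i. i \<notin> I \<longrightarrow> f i = 0}"

text \<open>k-linear derivations of the algebra (fspace I, mul); made extensional (zero off the space).\<close>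
definition derivations ::
  "'i set \<Rightarrow> (('i \<Rightarrow> 'k::field) \<Rightarrow> ('i \<Rightarrow> 'k) \<Rightarrow> ('i \<Rightarrow> 'k)) \<Rightarrow> (('i \<Rightarrow> 'k) \<Rightarrow> ('i \<Rightarrow> 'k)) set" where
  "derivations I mul = {D.
     (\<forall>f\<in>fspace I. D f \<in> fspace I) \<and>
     (\<forall>f\<in>fspace I. \<forall>g\<in>fspace I. D (\<lambda>i. f i + g i) = (\<lambda>i. D f i + D g i)) \<and>
     (\<forall>c. \<forall>f\<in>fspace I. D (\<lambda>i. c * f i) = (\<lambda>i. c * D f i)) \<and>
     (\<forall>f\<in>fspace I. \<forall>g\<in>fspace I. D (mul f g) = (\<lambda>i. mul (D f) g i + mul f (D g) i)) \<and>
     (\<forall>f. f \<notin> fspace I \<longrightarrow> D f = (\<lambda>i. 0))}"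

definition inner_derivations ::
  "'i set \<Rightarrow> (('i \<Rightarrow> 'k::field) \<Rightarrow> ('i \<Rightarrow> 'k) \<Rightarrow> ('i \<Rightarrow> 'k)) \<Rightarrow> (('i \<Rightarrow> 'k) \<Rightarrow> ('i \<Rightarrow> 'k)) set" where
  "inner_derivations I mul =
     (\<lambda>a. \<lambda>f. if f \<in> fspace I then (\<lambda>i. mul a f i - mul f a i) else (\<lambda>i. 0)) ` fspace I"

record ('v, 'k) lie_alg =
  lcarrier :: "'v set"
  lzero :: 'v
  lplus :: "'v \<Rightarrow> 'v \<Rightarrow> 'v"
  lscale :: "'k \<Rightarrow> 'v \<Rightarrow> 'v"
  lbracket :: "'v \<Rightarrow> 'v \<Rightarrow> 'v"

definition lie_subspace :: "('v, 'k) lie_alg \<Rightarrow> 'v set \<Rightarrow> bool" where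
  "lie_subspace L S \<longleftrightarrow> S \<subseteq> lcarrier L \<and> lzero L \<in> S \<and>
     (\<forall>x\<in>S. \<forall>y\<in>S. lplus L x y \<in> S) \<and> (\<forall>c. \<forall>x\<in>S. lscale L c x \<in> S)"

definition lie_ideal :: "('v, 'k) lie_alg \<Rightarrow> 'v set \<Rightarrow> bool" where
  "lie_ideal L I \<longleftrightarrow> lie_subspace L I \<and> (\<forall>x\<in>lcarrier L. \<forall>y\<in>I. lbracket L x y \<in> I)"

definition lie_derived :: "('v, 'k) lie_alg \<Rightarrow> 'v set \<Rightarrow> 'v set" where
  "lie_derived L S = \<Inter>{T. lie_subspace L T \<and> {lbracket L x y |x y. x \<in> S \<and> y \<in> S} \<subseteq> T}"

definition lie_solvable :: "('v, 'k) lie_alg \<Rightarrow> 'v set \<Rightarrow> bool" where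
  "lie_solvable L S \<longleftrightarrow> (\<exists>n. (lie_derived L ^^ n) S = {lzero L})"

text \<open>Semisimple: the solvable radical (the largest solvable ideal) is zero, i.e. every solvable
  ideal is zero.\<close>
definition lie_semisimple :: "('v, 'k) lie_alg \<Rightarrow> bool" where
  "lie_semisimple L \<longleftrightarrow> (\<forall>I. lie_ideal L I \<and> lie_solvable L I \<longrightarrow> I = {lzero L})"

definition lie_iso :: "('v, 'k) lie_alg \<Rightarrow> ('w, 'k) lie_alg \<Rightarrow> ('v \<Rightarrow> 'w) \<Rightarrow> bool" where
  "lie_iso L M \<phi> \<longleftrightarrow> bij_betw \<phi> (lcarrier L) (lcarrier M) \<and>
     (\<forall>x\<in>lcarrier L. \<forall>y\<in>lcarrier L. \<phi> (lplus L x y) = lplus M (\<phi> x) (\<phi> y)) \<and>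
     (\<forall>c. \<forall>x\<in>lcarrier L. \<phi> (lscale L c x) = lscale M c (\<phi> x)) \<and>
     (\<forall>x\<in>lcarrier L. \<forall>y\<in>lcarrier L. \<phi> (lbracket L x y) = lbracket M (\<phi> x) (\<phi> y))"

definition lcoset :: "('v, 'k) lie_alg \<Rightarrow> 'v set \<Rightarrow> 'v \<Rightarrow> 'v set" where
  "lcoset L J x = {lplus L x j |j. j \<in> J}"

definition lie_quotient :: "('v, 'k) lie_alg \<Rightarrow> 'v set \<Rightarrow> ('v set, 'k) lie_alg" where
  "lie_quotient L J =
    \<lparr> lcarrier = lcoset L J ` lcarrier L,
      lzero = lcoset L J (lzero L),
      lplus = (\<lambda>A B. lcoset L J (lplus L (SOME a. a \<in> A) (SOME b. b \<in> B))),
      lscale = (\<lambda>c A. lcoset L J (lscale L c (SOME a. a \<in> A))),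
      lbracket = (\<lambda>A B. lcoset L J (lbracket L (SOME a. a \<in> A) (SOME b. b \<in> B))) \<rparr>"

definition lie_power :: "('v, 'k) lie_alg \<Rightarrow> nat \<Rightarrow> (nat \<Rightarrow> 'v, 'k) lie_alg" where
  "lie_power L n =
    \<lparr> lcarrier = {f. (\<forall>i<n. f i \<in> lcarrier L) \<and> (\<forall>i\<ge>n. f i = lzero L)},
      lzero = (\<lambda>i. lzero L),
      lplus = (\<lambda>f g i. if i < n then lplus L (f i) (g i) else lzero L),
      lscale = (\<lambda>c f i. if i < n then lscale L c (f i) else lzero L),
      lbracket = (\<lambda>f g i. if i < n then lbracket L (f i) (g i) else lzero L) \<rparr>"

definition der_lie ::
  "'i set \<Rightarrow> (('i \<Rightarrow> 'k::field) \<Rightarrow> ('i \<Rightarrow> 'k) \<Rightarrow> ('i \<Rightarrow> 'k)) \<Rightarrow> (('i \<Rightarrow> 'k) \<Rightarrow> ('i \<Rightarrow> 'k), 'k) lie_alg" where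
  "der_lie I mul =
    \<lparr> lcarrier = derivations I mul,
      lzero = (\<lambda>f i. 0),
      lplus = (\<lambda>D E f i. D f i + E f i),
      lscale = (\<lambda>c D f i. c * D f i),
      lbracket = (\<lambda>D E f i. D (E f) i - E (D f) i) \<rparr>"

definition HH1 ::
  "'i set \<Rightarrow> (('i \<Rightarrow> 'k::field) \<Rightarrow> ('i \<Rightarrow> 'k) \<Rightarrow> ('i \<Rightarrow> 'k)) \<Rightarrow> ((('i \<Rightarrow> 'k) \<Rightarrow> ('i \<Rightarrow> 'k)) set, 'k) lie_alg" where
  "HH1 I mul = lie_quotient (der_lie I mul) (inner_derivations I mul)"

definition group_alg_mult :: "('g, 'b) monoid_scheme \<Rightarrow> ('g \<Rightarrow> 'k::field) \<Rightarrow> ('g \<Rightarrow> 'k) \<Rightarrow> ('g \<Rightarrow> 'k)" where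
  "group_alg_mult G f h = (\<lambda>x. if x \<in> carrier G
       then (\<Sum>y\<in>carrier G. f y * h (inv\<^bsub>G\<^esub> y \<otimes>\<^bsub>G\<^esub> x)) else 0)"

definition trunc_poly_mult :: "nat \<Rightarrow> (nat \<Rightarrow> 'k::field) \<Rightarrow> (nat \<Rightarrow> 'k) \<Rightarrow> (nat \<Rightarrow> 'k)" where
  "trunc_poly_mult p f g = (\<lambda>n. if n < p then (\<Sum>i\<le>n. f i * g (n - i)) else 0)"

definition witt_W11 :: "nat \<Rightarrow> ((nat \<Rightarrow> 'k::field) \<Rightarrow> (nat \<Rightarrow> 'k), 'k) lie_alg" where
  "witt_W11 p = der_lie {..<p} (trunc_poly_mult p)"

end

theory Submission
  imports Defs "HOL-Library.Function_Algebras" "HOL-Computational_Algebra.Formal_Power_Series"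
begin

text \<open>
  Let \<open>x\<close> generate the Sylow subgroup \<open>P\<close>. The action of \<open>G\<close> on \<open>P\<close>, read in \<open>k\<close>, is a character \<open>chi\<close>
  with kernel \<open>C = C\<^sub>G(P)\<close>, and averaging over \<open>G/P\<close> gives \<open>lam : G \<rightarrow> k\<close> with
  \<open>lam (g h) = lam g + chi g * lam h\<close> and \<open>lam x = 1\<close>. A derivation \<open>D\<close> of \<open>kG\<close> is a 1-cocycle
  \<open>g \<mapsto> D(g) g\<^sup>-\<^sup>1\<close> for the conjugation action. \<open>P\<close> acts freely on \<open>G - C\<close>, so the part of the cocycle
  outside \<open>kC\<close> is inner on \<open>P\<close>; as \<open>|G/P|\<close> is invertible, the class of \<open>D\<close> is determined by
  \<open>f = D(x) x\<^sup>-\<^sup>1 \<in> kC\<close>, and the possible \<open>f\<close> are those with \<open>g f g\<^sup>-\<^sup>1 = chi(g) f\<close>. This makes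
  \<open>HH\<^sup>1\<close> the Lie algebra of such \<open>f\<close> with bracket \<open>f (lam h) - h (lam f)\<close>.

  The \<open>f\<close> that depend on \<open>lam\<close> only form a nonzero ideal. It is abelian if \<open>p\<close> divides the order of
  \<open>ker lam\<close> in \<open>C\<close>, solvable of length two if \<open>p = 2\<close>, and solvable if \<open>chi\<close> is nontrivial, as then
  the filtration by the vanishing of the moments \<open>\<Sum> lam(c)\<^sup>j f(c)\<close> is strictly decreasing on brackets.
  If \<open>HH\<^sup>1\<close> is semisimple, all this is excluded, and \<open>ker lam\<close> is the direct complement of \<open>P\<close>.
  Conversely, for \<open>G = K \<times> P\<close> with \<open>|P| = p\<close> the centre of \<open>kK\<close> is a product of \<open>n\<close> copies of \<open>k\<close> by
  Maschke's theorem, so that \<open>HH\<^sup>1\<close> is the \<open>n\<close>-th power of \<open>W(1,1)\<close>. For \<open>p > 2\<close> every nonzero ideal of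
  this power contains a copy of \<open>sl\<^sub>2\<close> in one component, hence is not solvable.
\<close>

section \<open>Lie algebras\<close>

text \<open>On kP, pointwise multiplication by \<open>lam\<close> is the derivation x d/dx, and an
  element \<open>f\<close> stands for the operator "apply \<open>lam\<close>, then multiply by
  \<open>f\<close>"; the bracket is the commutator of two such operators. Put y = x - 1. Where
  \<open>chi\<close> is trivial and y^p = 0, the derivations to be matched with W(1,1) are F(y)
  d/dy, whereas \<open>lam\<close> acts as x d/dy. Hence F d/dy is represented by F(y) x^(-1), and
  this is where the inverse of x in the final isomorphism comes from. The number n of factors is the
  number of orthogonal idempotents that span the centre of kK.

  The exclusion of the solvable cases yields the splitting as follows: on C, \<open>lam\<close> is a
  homomorphism to the prime field, and its kernel meets P in the subgroup generated by x^p. If p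
  does not divide the order of the kernel, this subgroup is trivial, so |P| = p.

  Lie algebras are bare records without axioms, and the quotient chooses representatives by
  \<open>SOME\<close>. The quotient is therefore handled once, in one isomorphism with an explicit
  function space; closure, semisimplicity and the comparison with W(1,1) are then carried along
  isomorphisms.\<close>

definition lie_closed :: "('v, 'k::field) lie_alg \<Rightarrow> bool" where
  "lie_closed L \<longleftrightarrow> lie_ideal L (lcarrier L) \<and> (\<forall>x\<in>lcarrier L. lscale L 0 x = lzero L)"

lemma lie_closedD:
  assumes "lie_closed L"
  shows "lzero L \<in> lcarrier L"
    and "\<And>x y. x \<in> lcarrier L \<Longrightarrow> y \<in> lcarrier L \<Longrightarrow> lplus L x y \<in> lcarrier L"
    and "\<And>c x. x \<in> lcarrier L \<Longrightarrow> lscale L c x \<in> lcarrier L"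
    and "\<And>x y. x \<in> lcarrier L \<Longrightarrow> y \<in> lcarrier L \<Longrightarrow> lbracket L x y \<in> lcarrier L"
    and "\<And>x. x \<in> lcarrier L \<Longrightarrow> lscale L 0 x = lzero L"
  using assms by (auto simp: lie_closed_def lie_ideal_def lie_subspace_def)

lemma lie_isoD:
  assumes "lie_iso L M \<phi>"
  shows "inj_on \<phi> (lcarrier L)" and "\<phi> ` lcarrier L = lcarrier M"
    and "\<And>x. x \<in> lcarrier L \<Longrightarrow> \<phi> x \<in> lcarrier M"
    and "\<And>x y. x \<in> lcarrier L \<Longrightarrow> y \<in> lcarrier L \<Longrightarrow> \<phi> (lplus L x y) = lplus M (\<phi> x) (\<phi> y)"
    and "\<And>c x. x \<in> lcarrier L \<Longrightarrow> \<phi> (lscale L c x) = lscale M c (\<phi> x)"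
    and "\<And>x y. x \<in> lcarrier L \<Longrightarrow> y \<in> lcarrier L \<Longrightarrow> \<phi> (lbracket L x y) = lbracket M (\<phi> x) (\<phi> y)"
  using assms by (auto simp: lie_iso_def bij_betw_def)

text \<open>Isomorphisms are only required to respect sum, scaling and bracket. Zero is nevertheless
  preserved because in both algebras it is 0 times an element; this is the reason for the last
  clause of \<open>lie_closed\<close>.\<close>

lemma lie_iso_zero:
  assumes "lie_iso L M \<phi>" "lie_closed L" "lie_closed M"
  shows "\<phi> (lzero L) = lzero M"
  using lie_isoD[OF assms(1)] lie_closedD[OF assms(2)] lie_closedD[OF assms(3)] by metis

text \<open>Every element of \<open>M\<close> is an image, so closure is inherited. The equation for
  zero has to be assumed here: deriving it from scaling would already use that \<open>M\<close> is
  closed.\<close>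

lemma lie_closed_iso:
  assumes iso: "lie_iso L M \<phi>" and L: "lie_closed L" and z: "\<phi> (lzero L) = lzero M"
  shows "lie_closed M"
proof -
  note i = lie_isoD[OF iso] and l = lie_closedD[OF L]
  have ex: "\<exists>x'\<in>lcarrier L. x = \<phi> x'" if "x \<in> lcarrier M" for x
    using that i(2) by blast
  have "lzero M \<in> lcarrier M" using z i(3) l(1) by metis
  moreover have "lplus M x y \<in> lcarrier M" if "x \<in> lcarrier M" "y \<in> lcarrier M" for x y
    using ex[OF that(1)] ex[OF that(2)] i(3,4) l(2) by metis
  moreover have "lbracket M x y \<in> lcarrier M" if "x \<in> lcarrier M" "y \<in> lcarrier M" for x y
    using ex[OF that(1)] ex[OF that(2)] i(3,6) l(4) by metis
  moreover have "lscale M c x \<in> lcarrier M" if "x \<in> lcarrier M" for c x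
    using ex[OF that] i(3,5) l(3) by metis
  moreover have "lscale M 0 x = lzero M" if "x \<in> lcarrier M" for x
    using ex[OF that] i(5) l(5) z by metis
  ultimately show ?thesis
    by (simp add: lie_closed_def lie_ideal_def lie_subspace_def)
qed

lemma lie_iso_sym:
  assumes iso: "lie_iso L M \<phi>" and L: "lie_closed L"
  shows "lie_iso M L (inv_into (lcarrier L) \<phi>)"
proof -
  note i = lie_isoD[OF iso] and l = lie_closedD[OF L]
  let ?g = "inv_into (lcarrier L) \<phi>"
  have g: "?g (\<phi> x) = x" if "x \<in> lcarrier L" for x using i(1) that by simp
  have ex: "\<exists>x'\<in>lcarrier L. x = \<phi> x'" if "x \<in> lcarrier M" for x
    using that i(2) by blast
  have "bij_betw ?g (lcarrier M) (lcarrier L)"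
    using iso bij_betw_inv_into unfolding lie_iso_def by blast
  moreover have "?g (lplus M x y) = lplus L (?g x) (?g y)" if "x \<in> lcarrier M" "y \<in> lcarrier M" for x y
    using ex[OF that(1)] ex[OF that(2)] g i(4) l(2) by metis
  moreover have "?g (lbracket M x y) = lbracket L (?g x) (?g y)" if "x \<in> lcarrier M" "y \<in> lcarrier M" for x y
    using ex[OF that(1)] ex[OF that(2)] g i(6) l(4) by metis
  moreover have "?g (lscale M c x) = lscale L c (?g x)" if "x \<in> lcarrier M" for c x
    using ex[OF that(1)] g i(5) l(3) by metis
  ultimately show ?thesis unfolding lie_iso_def by blast
qed

lemma lie_iso_trans:
  assumes "lie_iso L M \<phi>" "lie_iso M N \<psi>"
  shows "lie_iso L N (\<psi> \<circ> \<phi>)"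
  using lie_isoD(3-)[OF assms(1)] lie_isoD(3-)[OF assms(2)] assms
  unfolding lie_iso_def by (auto intro: bij_betw_trans)

lemma lie_derived_mono: "S \<subseteq> S' \<Longrightarrow> lie_derived L S \<subseteq> lie_derived L S'"
  unfolding lie_derived_def by (intro Inter_anti_mono) blast

lemma lie_derived_least:
  "lie_subspace L T \<Longrightarrow> (\<And>x y. x \<in> S \<Longrightarrow> y \<in> S \<Longrightarrow> lbracket L x y \<in> T) \<Longrightarrow> lie_derived L S \<subseteq> T"
  unfolding lie_derived_def by blast

lemma zero_in_lie_derived: "lzero L \<in> lie_derived L S"
  unfolding lie_derived_def lie_subspace_def by auto

lemma lbracket_in_lie_derived: "x \<in> S \<Longrightarrow> y \<in> S \<Longrightarrow> lbracket L x y \<in> lie_derived L S"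
  unfolding lie_derived_def by blast

lemma lscale_in_lie_derived: "x \<in> lie_derived L S \<Longrightarrow> lscale L c x \<in> lie_derived L S"
  unfolding lie_derived_def lie_subspace_def by blast

text \<open>A descending induction bounds the derived series by \<open>F\<close>; the terms need not
  be ideals. Solvability demands equality with the zero space, and zero belongs to each term of the
  series.\<close>

lemma lie_solvable_chain:
  assumes S: "S = F 0" and sub: "\<And>i. lie_subspace L (F i)" and N: "F N \<subseteq> {lzero L}"
    and step: "\<And>i x y. x \<in> F i \<Longrightarrow> y \<in> F i \<Longrightarrow> lbracket L x y \<in> F (Suc i)"
  shows "lie_solvable L S"
proof -
  have *: "(lie_derived L ^^ i) S \<subseteq> F i" for i
  proof (induction i)
    case 0 then show ?case using S by simp
  next
    case (Suc i)
    have "lie_derived L ((lie_derived L ^^ i) S) \<subseteq> F (Suc i)"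
      by (rule order_trans[OF lie_derived_mono[OF Suc] lie_derived_least]) (use sub step in auto)
    then show ?case by simp
  qed
  have "lzero L \<in> (lie_derived L ^^ N) S"
  proof (cases N)
    case 0 then show ?thesis using S sub[of 0] by (simp add: lie_subspace_def)
  qed (simp add: zero_in_lie_derived)
  then show ?thesis using *[of N] N unfolding lie_solvable_def by blast
qed

lemma lie_subspace_image:
  assumes iso: "lie_iso L M \<phi>" and L: "lie_closed L" and M: "lie_closed M" and T: "lie_subspace L T"
  shows "lie_subspace M (\<phi> ` T)"
proof -
  note i = lie_isoD[OF iso]
  have TL: "T \<subseteq> lcarrier L" using T by (simp add: lie_subspace_def)
  have z: "lzero M \<in> \<phi> ` T"
    using lie_iso_zero[OF assms(1-3)] T by (metis image_eqI lie_subspace_def)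
  have p: "lplus M (\<phi> x) (\<phi> y) \<in> \<phi> ` T" if "x \<in> T" "y \<in> T" for x y
    using that T TL i(4)[of x y] by (metis (mono_tags) image_eqI lie_subspace_def subset_iff)
  have s: "lscale M c (\<phi> x) \<in> \<phi> ` T" if "x \<in> T" for c x
    using that T TL i(5)[of x] by (metis (mono_tags) image_eqI lie_subspace_def subset_iff)
  show ?thesis unfolding lie_subspace_def using z p s i(3) TL by blast
qed

lemma lie_derived_image:
  assumes iso: "lie_iso L M \<phi>" and L: "lie_closed L" and M: "lie_closed M" and S: "S \<subseteq> lcarrier L"
  shows "lie_derived M (\<phi> ` S) \<subseteq> \<phi> ` lie_derived L S" and "lie_derived L S \<subseteq> lcarrier L"
proof -
  note i = lie_isoD[OF iso] and l = lie_closedD[OF L]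
  show sub: "lie_derived L S \<subseteq> lcarrier L"
  proof (rule lie_derived_least)
    show "lie_subspace L (lcarrier L)" using L by (simp add: lie_closed_def lie_ideal_def)
    show "lbracket L x y \<in> lcarrier L" if "x \<in> S" "y \<in> S" for x y
      using that S l(4) by blast
  qed
  \<comment> \<open>Stability under the operations passes to intersections, but containment in the
    carrier does not hold for an empty family, which is why \<open>sub\<close> is shown
    beforehand.\<close>
  have "lie_subspace L (lie_derived L S)"
    using sub unfolding lie_subspace_def lie_derived_def by blast
  then have "lie_subspace M (\<phi> ` lie_derived L S)"
    by (rule lie_subspace_image[OF iso L M])
  then show "lie_derived M (\<phi> ` S) \<subseteq> \<phi> ` lie_derived L S"
  proof (rule lie_derived_least)
    fix x y assume "x \<in> \<phi> ` S" "y \<in> \<phi> ` S"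
    then obtain a b where "a \<in> S" "b \<in> S" "x = \<phi> a" "y = \<phi> b" by blast
    then show "lbracket M x y \<in> \<phi> ` lie_derived L S"
      using i(6)[of a b] S lbracket_in_lie_derived[of a S b L]
      by (metis (no_types, opaque_lifting) image_eqI subset_iff)
  qed
qed

lemma lie_semisimple_iso:
  assumes iso: "lie_iso L M \<phi>" and L: "lie_closed L" and M: "lie_closed M" and ss: "lie_semisimple M"
  shows "lie_semisimple L"
  unfolding lie_semisimple_def
proof (intro allI impI)
  fix I assume I: "lie_ideal L I \<and> lie_solvable L I"
  note i = lie_isoD[OF iso]
  have IL: "I \<subseteq> lcarrier L" using I by (simp add: lie_ideal_def lie_subspace_def)
  have "lie_subspace M (\<phi> ` I)"
    using lie_subspace_image[OF iso L M] I by (simp add: lie_ideal_def)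
  moreover have "lbracket M x y \<in> \<phi> ` I" if xy: "x \<in> lcarrier M" "y \<in> \<phi> ` I" for x y
  proof -
    obtain a b where "a \<in> lcarrier L" "b \<in> I" "x = \<phi> a" "y = \<phi> b" using xy i(2) by blast
    then show ?thesis using i(6)[of a b] I IL
      by (metis (no_types, lifting) image_eqI lie_ideal_def subset_iff)
  qed
  ultimately have id: "lie_ideal M (\<phi> ` I)" unfolding lie_ideal_def by blast
  obtain n where n: "(lie_derived L ^^ n) I = {lzero L}" using I unfolding lie_solvable_def by blast
  have *: "(lie_derived M ^^ m) (\<phi> ` I) \<subseteq> \<phi> ` (lie_derived L ^^ m) I \<and> (lie_derived L ^^ m) I \<subseteq> lcarrier L" for m
  proof (induction m)
    case (Suc m)
    then show ?case
      using lie_derived_mono[of "(lie_derived M ^^ m) (\<phi> ` I)" "\<phi> ` (lie_derived L ^^ m) I" M]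
        lie_derived_image[OF iso L M, of "(lie_derived L ^^ m) I"] by auto
  qed (use IL in auto)
  have "lzero M \<in> (lie_derived M ^^ n) (\<phi> ` I)"
  proof (cases n)
    case 0 then show ?thesis using id by (simp add: lie_ideal_def lie_subspace_def)
  qed (simp add: zero_in_lie_derived)
  then have "(lie_derived M ^^ n) (\<phi> ` I) = {lzero M}"
    using *[of n] n lie_iso_zero[OF iso L M] by auto
  then have "\<phi> ` I = {lzero M}"
    using ss id unfolding lie_semisimple_def lie_solvable_def by blast
  then have "\<phi> ` I = \<phi> ` {lzero L}" using lie_iso_zero[OF iso L M] by simp
  then show "I = {lzero L}"
    using inj_on_image_eq_iff[OF i(1) IL, of "{lzero L}"] lie_closedD(1)[OF L] by simp
qed

section \<open>Group algebras and their derivations\<close>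

lemma sum_fun_apply: "(\<Sum>i\<in>A. F i) x = (\<Sum>i\<in>A. F i x)"
  by (induction A rule: infinite_finite_induct) auto

definition single :: "'i \<Rightarrow> 'i \<Rightarrow> 'k::zero_neq_one" where
  "single g = (\<lambda>u. if u = g then 1 else 0)"

definition smul :: "'k::times \<Rightarrow> ('i \<Rightarrow> 'k) \<Rightarrow> 'i \<Rightarrow> 'k" where
  "smul c f = (\<lambda>i. c * f i)"

lemma smul_apply [simp]: "smul c f i = c * f i"
  by (simp add: smul_def)

lemma fspace_mono: "I \<subseteq> J \<Longrightarrow> fspace I \<subseteq> fspace J"
  by (auto simp: fspace_def)

lemma fspaceI: "(\<And>i. i \<notin> I \<Longrightarrow> f i = 0) \<Longrightarrow> f \<in> fspace I"
  by (simp add: fspace_def)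

lemma fspaceD: "f \<in> fspace I \<Longrightarrow> i \<notin> I \<Longrightarrow> f i = 0"
  by (simp add: fspace_def)

lemma fspace_closed [simp]:
  "0 \<in> fspace I"
  "f \<in> fspace I \<Longrightarrow> h \<in> fspace I \<Longrightarrow> f + h \<in> fspace I"
  "f \<in> fspace I \<Longrightarrow> h \<in> fspace I \<Longrightarrow> f - h \<in> fspace I"
  "f \<in> fspace I \<Longrightarrow> smul c f \<in> fspace I"
  "f \<in> fspace I \<Longrightarrow> h * f \<in> fspace I"
  "g \<in> I \<Longrightarrow> single g \<in> fspace I"
  by (auto simp: fspace_def single_def)

lemma fspace_sum [simp]: "(\<And>i. i \<in> A \<Longrightarrow> F i \<in> fspace I) \<Longrightarrow> (\<Sum>i\<in>A. F i) \<in> fspace I"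
  by (induction A rule: infinite_finite_induct) auto

lemma fspace_expand:
  fixes f :: "'i \<Rightarrow> 'k::field"
  assumes "finite I" "f \<in> fspace I"
  shows "f = (\<Sum>g\<in>I. smul (f g) (single g))"
proof
  fix u
  have "(\<Sum>g\<in>I. smul (f g) (single g)) u = (\<Sum>g\<in>I. if g = u then f g else 0)"
    unfolding sum_fun_apply by (rule sum.cong) (auto simp: single_def)
  also have "\<dots> = f u"
    using assms by (auto simp: fspace_def)
  finally show "f u = (\<Sum>g\<in>I. smul (f g) (single g)) u" ..
qed

lemma derivationsD:
  assumes "D \<in> derivations I mul"
  shows "f \<in> fspace I \<Longrightarrow> D f \<in> fspace I"
    and "f \<in> fspace I \<Longrightarrow> h \<in> fspace I \<Longrightarrow> D (f + h) = D f + D h"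
    and "f \<in> fspace I \<Longrightarrow> D (smul c f) = smul c (D f)"
    and "f \<in> fspace I \<Longrightarrow> h \<in> fspace I \<Longrightarrow> D (mul f h) = mul (D f) h + mul f (D h)"
    and "f \<notin> fspace I \<Longrightarrow> D f = 0"
  using assms unfolding derivations_def plus_fun_def zero_fun_def smul_def by auto

lemma derivationsI:
  assumes "\<And>f. f \<in> fspace I \<Longrightarrow> D f \<in> fspace I"
    and "\<And>f h. f \<in> fspace I \<Longrightarrow> h \<in> fspace I \<Longrightarrow> D (f + h) = D f + D h"
    and "\<And>c f. f \<in> fspace I \<Longrightarrow> D (smul c f) = smul c (D f)"
    and "\<And>f h. f \<in> fspace I \<Longrightarrow> h \<in> fspace I \<Longrightarrow> D (mul f h) = mul (D f) h + mul f (D h)"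
    and "\<And>f. f \<notin> fspace I \<Longrightarrow> D f = 0"
  shows "D \<in> derivations I mul"
  using assms unfolding derivations_def plus_fun_def zero_fun_def smul_def by auto

lemma derivations_zero: "D \<in> derivations I mul \<Longrightarrow> D 0 = 0"
  using derivationsD(3)[of D I mul 0 0] fspace_closed(1)[of I] unfolding smul_def zero_fun_def by simp

lemma derivations_minus: 
  assumes "D \<in> derivations I mul" "f \<in> fspace I" "h \<in> fspace I"
  shows "D (f - h) = D f - D h"
proof -
  have "D (f + smul (-1) h) = D f + smul (-1) (D h)"
    using derivationsD(2,3)[OF assms(1)] assms(2,3) by simp
  moreover have "f + smul (-1) h = f - h" "D f + smul (-1) (D h) = D f - D h"
    by (auto simp: fun_eq_iff)
  ultimately show ?thesis by simp
qed

lemma derivations_sum: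
  assumes D: "D \<in> derivations I mul" and "\<And>i. i \<in> A \<Longrightarrow> F i \<in> fspace I"
  shows "D (\<Sum>i\<in>A. F i) = (\<Sum>i\<in>A. D (F i))"
  using assms(2)
proof (induction A rule: infinite_finite_induct)
  case (insert a A)
  then show ?case using derivationsD(2)[OF D, of "F a" "\<Sum>i\<in>A. F i"] by (simp add: plus_fun_def)
qed (use derivations_zero[OF D] in auto)

lemma derivation_eqI:
  fixes D E :: "('i \<Rightarrow> 'k::field) \<Rightarrow> 'i \<Rightarrow> 'k"
  assumes I: "finite I" and D: "D \<in> derivations I mul" and E: "E \<in> derivations I mul"
    and eq: "\<And>i. i \<in> I \<Longrightarrow> D (single i) = E (single i)"
  shows "D = E"
proof
  fix f
  show "D f = E f"
  proof (cases "f \<in> fspace I")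
    case True
    have "F f = (\<Sum>i\<in>I. smul (f i) (F (single i)))" if F: "F \<in> derivations I mul" for F
    proof -
      have "F f = F (\<Sum>i\<in>I. smul (f i) (single i))" using fspace_expand[OF I True] by simp
      also have "\<dots> = (\<Sum>i\<in>I. F (smul (f i) (single i)))" by (rule derivations_sum[OF F]) simp
      also have "\<dots> = (\<Sum>i\<in>I. smul (f i) (F (single i)))"
        by (rule sum.cong[OF refl], rule derivationsD(3)[OF F]) simp
      finally show ?thesis .
    qed
    then show ?thesis using D E eq by (metis (no_types, lifting) sum.cong)
  next
    case False then show ?thesis using derivationsD(5)[OF D] derivationsD(5)[OF E] by simp
  qed
qed

locale finite_group = group G for G (structure) +
  assumes fin [simp]: "finite (carrier G)"
begin

abbreviation conv (infixl "\<star>" 70) where "f \<star> h \<equiv> group_alg_mult G f h"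

lemma conv_apply: "z \<in> carrier G \<Longrightarrow> (f \<star> h) z = (\<Sum>y\<in>carrier G. f y * h (inv y \<otimes> z))"
  by (simp add: group_alg_mult_def)

lemma sum_shift_left:
  "g \<in> carrier G \<Longrightarrow> (\<Sum>y\<in>carrier G. F (g \<otimes> y)) = (\<Sum>y\<in>carrier G. F y)"
  by (rule sum.reindex_bij_witness[of _ "\<lambda>y. inv g \<otimes> y" "\<lambda>y. g \<otimes> y"]) (auto simp flip: m_assoc)

lemma inv_cancel [simp]:
  "y \<in> carrier G \<Longrightarrow> z \<in> carrier G \<Longrightarrow> inv y \<otimes> (y \<otimes> z) = z"
  "y \<in> carrier G \<Longrightarrow> z \<in> carrier G \<Longrightarrow> y \<otimes> (inv y \<otimes> z) = z"
  by (simp_all flip: m_assoc)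

lemma conv_apply': 
  assumes "z \<in> carrier G" 
  shows "(f \<star> h) z = (\<Sum>v\<in>carrier G. f (z \<otimes> inv v) * h v)"
  unfolding conv_apply[OF assms]
  by (rule sum.reindex_bij_witness[of _ "\<lambda>v. z \<otimes> inv v" "\<lambda>y. inv y \<otimes> z"])
    (use assms in \<open>auto simp: inv_mult_group m_assoc\<close>)

lemma conv_out: "z \<notin> carrier G \<Longrightarrow> (f \<star> h) z = 0"
  by (simp add: group_alg_mult_def)

lemma conv_in [simp]: "f \<star> h \<in> fspace (carrier G)"
  by (simp add: fspace_def conv_out)

lemma conv_eqI: "(\<And>z. z \<in> carrier G \<Longrightarrow> (f \<star> h) z = r z) \<Longrightarrow> r \<in> fspace (carrier G) \<Longrightarrow> f \<star> h = r"
  by (rule ext) (metis conv_out fspaceD)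

text \<open>If y and y^(-1) z both lie in \<open>H\<close>, so does their product z; closure under
  multiplication is therefore enough.\<close>

lemma conv_fspace:
  assumes H: "\<And>g h. g \<in> H \<Longrightarrow> h \<in> H \<Longrightarrow> g \<otimes> h \<in> H"
    and f: "f \<in> fspace H" and h: "h \<in> fspace H"
  shows "f \<star> h \<in> fspace H"
proof (rule fspaceI)
  fix z assume z: "z \<notin> H"
  show "(f \<star> h) z = 0"
  proof (cases "z \<in> carrier G")
    case True
    have "f y * h (inv y \<otimes> z) = 0" if y: "y \<in> carrier G" for y
    proof (cases "y \<in> H")
      case yH: True
      have "inv y \<otimes> z \<notin> H" using H[OF yH, of "inv y \<otimes> z"] z True y by auto
      then show ?thesis using fspaceD[OF h] by simp
    qed (use fspaceD[OF f] in simp)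
    then show ?thesis unfolding conv_apply[OF True] by (intro sum.neutral) blast
  qed (simp add: conv_out)
qed

lemma conv_assoc: "(f \<star> g) \<star> h = f \<star> (g \<star> h)"
proof (rule conv_eqI)
  fix z assume z: "z \<in> carrier G"
  have "((f \<star> g) \<star> h) z = (\<Sum>y\<in>carrier G. \<Sum>u\<in>carrier G. f u * (g (inv u \<otimes> y) * h (inv y \<otimes> z)))"
    using z by (simp add: conv_apply sum_distrib_right mult.assoc)
  also have "\<dots> = (\<Sum>u\<in>carrier G. f u * (\<Sum>y\<in>carrier G. g (inv u \<otimes> y) * h (inv y \<otimes> z)))"
    by (subst sum.swap) (simp add: sum_distrib_left)
  also have "\<dots> = (\<Sum>u\<in>carrier G. f u * (\<Sum>v\<in>carrier G. g v * h (inv v \<otimes> (inv u \<otimes> z))))"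
  proof (rule sum.cong[OF refl], rule arg_cong[where f = "(*) _"])
    fix u assume u: "u \<in> carrier G"
    show "(\<Sum>y\<in>carrier G. g (inv u \<otimes> y) * h (inv y \<otimes> z)) =
        (\<Sum>v\<in>carrier G. g v * h (inv v \<otimes> (inv u \<otimes> z)))"
      using sum_shift_left[OF u, of "\<lambda>y. g (inv u \<otimes> y) * h (inv y \<otimes> z)", symmetric] u z
      by (simp add: inv_mult_group m_assoc flip: m_assoc[of "inv u" u] cong: sum.cong)
  qed
  also have "\<dots> = (f \<star> (g \<star> h)) z" using z by (simp add: conv_apply)
  finally show "((f \<star> g) \<star> h) z = (f \<star> (g \<star> h)) z" .
qed simp

lemma conv_add_left: "(f + g) \<star> h = f \<star> h + g \<star> h"
  by (auto simp: fun_eq_iff group_alg_mult_def distrib_right sum.distrib)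

lemma conv_add_right: "h \<star> (f + g) = h \<star> f + h \<star> g"
  by (auto simp: fun_eq_iff group_alg_mult_def distrib_left sum.distrib)

lemma conv_diff_left: "(f - g) \<star> h = f \<star> h - g \<star> h"
  by (auto simp: fun_eq_iff group_alg_mult_def left_diff_distrib sum_subtractf)

lemma conv_diff_right: "h \<star> (f - g) = h \<star> f - h \<star> g"
  by (auto simp: fun_eq_iff group_alg_mult_def right_diff_distrib sum_subtractf)

lemma conv_zero [simp]: "0 \<star> h = 0" "h \<star> 0 = 0"
  by (auto simp: fun_eq_iff group_alg_mult_def)

lemma conv_smul_left: "smul c f \<star> h = smul c (f \<star> h)"
  by (auto simp: fun_eq_iff group_alg_mult_def sum_distrib_left mult.assoc)

lemma conv_smul_right: "h \<star> smul c f = smul c (h \<star> f)"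
  by (auto simp: fun_eq_iff group_alg_mult_def sum_distrib_left mult.left_commute)

lemma conv_sum_left: "(\<Sum>i\<in>A. F i) \<star> h = (\<Sum>i\<in>A. F i \<star> h)"
proof
  fix z
  show "((\<Sum>i\<in>A. F i) \<star> h) z = (\<Sum>i\<in>A. F i \<star> h) z"
    by (cases "z \<in> carrier G")
      (simp_all add: sum_fun_apply conv_apply conv_out sum_distrib_right sum.swap[of _ A])
qed

lemma conv_sum_right: "h \<star> (\<Sum>i\<in>A. F i) = (\<Sum>i\<in>A. h \<star> F i)"
proof
  fix z
  show "(h \<star> (\<Sum>i\<in>A. F i)) z = (\<Sum>i\<in>A. h \<star> F i) z"
    by (cases "z \<in> carrier G")
      (simp_all add: sum_fun_apply conv_apply conv_out sum_distrib_left sum.swap[of _ A])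
qed

lemma single_conv: "g \<in> carrier G \<Longrightarrow> z \<in> carrier G \<Longrightarrow> (single g \<star> h) z = h (inv g \<otimes> z)"
  by (simp add: conv_apply single_def if_distrib[of "\<lambda>x. x * _"] cong: if_cong)

lemma conv_single: "g \<in> carrier G \<Longrightarrow> z \<in> carrier G \<Longrightarrow> (h \<star> single g) z = h (z \<otimes> inv g)"
  by (simp add: conv_apply' single_def if_distrib[of "\<lambda>x. _ * x"] cong: if_cong)

lemma single_conv_single:
  assumes "g \<in> carrier G" "h \<in> carrier G"
  shows "single g \<star> single h = single (g \<otimes> h)"
proof (rule conv_eqI)
  fix z assume "z \<in> carrier G"
  then show "(single g \<star> single h) z = single (g \<otimes> h) z"
    using assms single_conv[of g z "single h"] by (auto simp: single_def inv_solve_left)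
qed (use assms in simp)

lemma conv_one [simp]:
  assumes "f \<in> fspace (carrier G)"
  shows "single \<one> \<star> f = f" "f \<star> single \<one> = f"
  using assms by (auto intro!: conv_eqI simp: single_conv conv_single)

definition inn :: "('a \<Rightarrow> 'k::field) \<Rightarrow> ('a \<Rightarrow> 'k) \<Rightarrow> 'a \<Rightarrow> 'k" where
  "inn a = (\<lambda>f. if f \<in> fspace (carrier G) then a \<star> f - f \<star> a else 0)"

lemma inner_derivations_eq: "inner_derivations (carrier G) conv = inn ` fspace (carrier G)"
  unfolding inner_derivations_def inn_def zero_fun_def fun_diff_def by simp

lemma inn_derivation:
  fixes a :: "'a \<Rightarrow> 'k::field"
  assumes "a \<in> fspace (carrier G)" shows "inn a \<in> derivations (carrier G) conv"
proof (rule derivationsI)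
  fix f h :: "'a \<Rightarrow> 'k" assume "f \<in> fspace (carrier G)" "h \<in> fspace (carrier G)"
  then show "inn a (f \<star> h) = inn a f \<star> h + f \<star> inn a h"
    by (simp add: inn_def conv_diff_left conv_diff_right conv_assoc)
qed (auto simp: inn_def conv_add_left conv_add_right conv_smul_left conv_smul_right fun_eq_iff algebra_simps)

lemma derivations_add:
  fixes D E :: "('a \<Rightarrow> 'k::field) \<Rightarrow> 'a \<Rightarrow> 'k"
  assumes D: "D \<in> derivations (carrier G) conv" and E: "E \<in> derivations (carrier G) conv"
  shows "D + E \<in> derivations (carrier G) conv"
proof (rule derivationsI)
  fix f h :: "'a \<Rightarrow> 'k" assume f: "f \<in> fspace (carrier G)" and h: "h \<in> fspace (carrier G)"
  note d = derivationsD[OF D] and e = derivationsD[OF E]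
  show "(D + E) (f \<star> h) = (D + E) f \<star> h + f \<star> (D + E) h"
    using d(4)[OF f h] e(4)[OF f h] by (simp add: conv_add_left conv_add_right)
  show "(D + E) (f + h) = (D + E) f + (D + E) h" using d(2)[OF f h] e(2)[OF f h] by simp
  show "(D + E) (smul c f) = smul c ((D + E) f)" for c
    using d(3)[OF f, of c] e(3)[OF f, of c] by (auto simp: fun_eq_iff algebra_simps)
qed (use derivationsD[OF D] derivationsD[OF E] in auto)

end

text \<open>The data attached to a normal cyclic Sylow subgroup \<open>P\<close> generated by \<open>x\<close>: \<open>chi\<close> is the
  action of \<open>G\<close> on \<open>P\<close> read modulo the characteristic, \<open>lam\<close> a 1-cocycle with values in the
  character \<open>chi\<close>, and \<open>T\<close> a transversal of \<open>P\<close>, of which only the averaging property is used.\<close>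
locale twisted_group = finite_group G for G (structure) +
  fixes chi lam :: "'a \<Rightarrow> 'k::field" and x :: 'a and P T :: "'a set"
  assumes x_in [simp]: "x \<in> carrier G"
    and P_eq: "P = {x [^] (i::nat) |i. True}" and P_inv: "\<And>y. y \<in> P \<Longrightarrow> inv y \<in> P"
    and chi_mult: "\<And>g h. g \<in> carrier G \<Longrightarrow> h \<in> carrier G \<Longrightarrow> chi (g \<otimes> h) = chi g * chi h"
    and chi_one [simp]: "chi \<one> = 1"
    and lam_mult: "\<And>g h. g \<in> carrier G \<Longrightarrow> h \<in> carrier G \<Longrightarrow> lam (g \<otimes> h) = lam g + chi g * lam h"
    and lam_x [simp]: "lam x = 1"
    and chi_comm: "\<And>c. c \<in> carrier G \<Longrightarrow> chi c = 1 \<Longrightarrow> c \<otimes> x = x \<otimes> c"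
    and chi_free: "\<And>u y. u \<in> carrier G \<Longrightarrow> chi u \<noteq> 1 \<Longrightarrow> y \<in> P \<Longrightarrow> y \<otimes> u = u \<otimes> y \<Longrightarrow> y = \<one>"
    and act: "\<And>g. g \<in> carrier G \<Longrightarrow> \<exists>m::nat. g \<otimes> x \<otimes> inv g = x [^] m \<and> chi g = of_nat m"
    and T_sub: "T \<subseteq> carrier G" and T_card: "of_nat (card T) \<noteq> (0::'k)"
    and T_shift: "\<And>F h. h \<in> carrier G \<Longrightarrow> (\<And>g y. g \<in> carrier G \<Longrightarrow> y \<in> P \<Longrightarrow> F (g \<otimes> y) = (F g :: 'k))
        \<Longrightarrow> (\<Sum>t\<in>T. F (h \<otimes> t)) = (\<Sum>t\<in>T. F t)"
begin

text \<open>This is the centralizer of x, hence of \<open>P\<close>: one inclusion is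
  \<open>chi_comm\<close>, the other is \<open>chi_free\<close> applied to x, which is not the
  identity because \<open>lam x = 1\<close>.\<close>

definition C :: "'a set" where "C = {c \<in> carrier G. chi c = 1}"

text \<open>The values \<open>D(x) x\<^sup>-\<^sup>1\<close> of the derivations \<open>D\<close>, normalised modulo inner ones.\<close>
definition tw :: "('a \<Rightarrow> 'k) set" where
  "tw = {f \<in> fspace C. \<forall>g\<in>carrier G. \<forall>u\<in>carrier G. f (inv g \<otimes> u \<otimes> g) = chi g * f u}"

definition tbr :: "('a \<Rightarrow> 'k) \<Rightarrow> ('a \<Rightarrow> 'k) \<Rightarrow> ('a \<Rightarrow> 'k)" where
  "tbr f h = f \<star> (lam * h) - h \<star> (lam * f)"

definition tw_lie :: "('a \<Rightarrow> 'k, 'k) lie_alg" where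
  "tw_lie = \<lparr> lcarrier = tw, lzero = 0, lplus = (+), lscale = smul, lbracket = tbr \<rparr>"

text \<open>A group element g is sent to \<open>lam g\<close> times f g. Since
  \<open>lam x = 1\<close>, the value D(x) x^(-1) of this derivation is f itself.\<close>

definition twD :: "('a \<Rightarrow> 'k) \<Rightarrow> ('a \<Rightarrow> 'k) \<Rightarrow> 'a \<Rightarrow> 'k" where
  "twD f = (\<lambda>h. if h \<in> fspace (carrier G) then f \<star> (lam * h) else 0)"

lemma C_sub: "C \<subseteq> carrier G" by (auto simp: C_def)

lemma tw_iff: "f \<in> tw \<longleftrightarrow> f \<in> fspace C \<and> (\<forall>g\<in>carrier G. \<forall>u\<in>carrier G. f (inv g \<otimes> u \<otimes> g) = chi g * f u)"
  by (simp add: tw_def)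

lemma tw_fspace: "f \<in> tw \<Longrightarrow> f \<in> fspace (carrier G)"
  using fspace_mono[OF C_sub] by (auto simp: tw_def)

lemma lam_one [simp]: "lam \<one> = 0"
proof -
  have "lam \<one> = lam \<one> + lam \<one>" using lam_mult[of \<one> \<one>] by (simp only: one_closed r_one chi_one mult_1)
  then show ?thesis by (simp only: add_cancel_right_right)
qed

lemma chi_inv: "g \<in> carrier G \<Longrightarrow> chi (inv g) * chi g = 1"
  using chi_mult[of "inv g" g] by simp

lemma chi_conj: "g \<in> carrier G \<Longrightarrow> u \<in> carrier G \<Longrightarrow> chi (inv g \<otimes> u \<otimes> g) = chi u"
  using chi_inv[of g] by (simp add: chi_mult mult.commute mult.left_commute)

lemma conj_in_C: "g \<in> carrier G \<Longrightarrow> u \<in> carrier G \<Longrightarrow> inv g \<otimes> u \<otimes> g \<in> C \<longleftrightarrow> u \<in> C"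
  by (simp add: C_def chi_conj)

text \<open>Elements of \<open>tw\<close> are semi-invariants of weight \<open>chi\<close> under
  conjugation, so moving v past f costs the factor \<open>chi v\<close>. This factor is what turns
  the twisted Leibniz rule of \<open>lam\<close> into an honest one for
  \<open>twD f\<close>.\<close>

lemma tw_swap:
  assumes "f \<in> tw" shows "h \<star> f = f \<star> (chi * h)"
proof (rule conv_eqI)
  fix z assume z: "z \<in> carrier G"
  have "h v * f (inv v \<otimes> z) = f (z \<otimes> inv v) * (chi v * h v)" if v: "v \<in> carrier G" for v
  proof -
    have "f (inv v \<otimes> (z \<otimes> inv v) \<otimes> v) = chi v * f (z \<otimes> inv v)"
      using assms v z by (simp add: tw_iff)
    then show ?thesis using v z by (simp add: m_assoc)
  qed
  then show "(h \<star> f) z = (f \<star> (chi * h)) z"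
    unfolding conv_apply'[OF z, of f] conv_apply[OF z, of h] by (auto intro: sum.cong)
qed simp

lemma tw_comm:
  assumes "f \<in> tw" "h \<in> fspace C" shows "h \<star> f = f \<star> h"
proof -
  have "chi * h = h" using assms(2) by (auto simp: fun_eq_iff C_def fspace_def)
  then show ?thesis using tw_swap[OF assms(1)] by simp
qed

text \<open>The cocycle identity of \<open>lam\<close>, read at z = y (y^(-1) z), is a Leibniz rule
  twisted by \<open>chi\<close> in the first factor.\<close>

lemma lam_conv: "lam * (h \<star> h') = (lam * h) \<star> h' + (chi * h) \<star> (lam * h')"
proof
  fix z
  have *: "lam z = lam y + chi y * lam (inv y \<otimes> z)" if "z \<in> carrier G" "y \<in> carrier G" for y
    using lam_mult[of y "inv y \<otimes> z"] that by (simp flip: m_assoc)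
  show "(lam * (h \<star> h')) z = ((lam * h) \<star> h' + (chi * h) \<star> (lam * h')) z"
  proof (cases "z \<in> carrier G")
    case True
    have "(lam * (h \<star> h')) z = (\<Sum>y\<in>carrier G. lam z * (h y * h' (inv y \<otimes> z)))"
      using True by (simp add: conv_apply sum_distrib_left)
    also have "\<dots> = (\<Sum>y\<in>carrier G. lam y * h y * h' (inv y \<otimes> z) + chi y * h y * (lam (inv y \<otimes> z) * h' (inv y \<otimes> z)))"
      by (rule sum.cong) (auto simp: *[OF True] algebra_simps)
    finally show ?thesis using True by (simp add: conv_apply sum.distrib)
  qed (simp add: conv_out)
qed

lemma twD_derivation:
  assumes f: "f \<in> tw" shows "twD f \<in> derivations (carrier G) conv"
proof (rule derivationsI)
  fix h h' :: "'a \<Rightarrow> 'k" assume "h \<in> fspace (carrier G)" "h' \<in> fspace (carrier G)"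
  then show "twD f (h \<star> h') = twD f h \<star> h' + h \<star> twD f h'"
    by (simp add: twD_def lam_conv conv_add_right tw_swap[OF f] flip: conv_assoc)
next
  fix h h' :: "'a \<Rightarrow> 'k" assume "h \<in> fspace (carrier G)" "h' \<in> fspace (carrier G)"
  then show "twD f (h + h') = twD f h + twD f h'"
    by (simp add: twD_def distrib_left conv_add_right)
next
  fix c and h :: "'a \<Rightarrow> 'k" assume "h \<in> fspace (carrier G)"
  moreover have "lam * smul c h = smul c (lam * h)" by (auto simp: fun_eq_iff)
  ultimately show "twD f (smul c h) = smul c (twD f h)"
    by (simp add: twD_def conv_smul_right)
qed (auto simp: twD_def)

lemma C_mult: "c \<in> C \<Longrightarrow> d \<in> C \<Longrightarrow> c \<otimes> d \<in> C"
  by (simp add: C_def chi_mult)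

lemma C_inv: "c \<in> C \<Longrightarrow> inv c \<in> C"
  using chi_inv[of c] by (simp add: C_def)

lemma conv_fspace_C: "f \<in> fspace C \<Longrightarrow> h \<in> fspace C \<Longrightarrow> f \<star> h \<in> fspace C"
  by (rule conv_fspace[OF C_mult])

lemma tw_closed:
  "0 \<in> tw" "f \<in> tw \<Longrightarrow> h \<in> tw \<Longrightarrow> f + h \<in> tw" "f \<in> tw \<Longrightarrow> h \<in> tw \<Longrightarrow> f - h \<in> tw"
  "f \<in> tw \<Longrightarrow> smul c f \<in> tw"
  by (auto simp: tw_def algebra_simps)

lemma sum_conj:
  "g \<in> carrier G \<Longrightarrow> (\<Sum>y\<in>carrier G. F (inv g \<otimes> y \<otimes> g)) = (\<Sum>y\<in>carrier G. F y)"
  by (rule sum.reindex_bij_witness[of _ "\<lambda>y. g \<otimes> y \<otimes> inv g" "\<lambda>y. inv g \<otimes> y \<otimes> g"])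
    (auto simp: m_assoc simp flip: m_assoc[of "inv g" g] m_assoc[of g "inv g"])

lemma lam_conj:
  assumes "g \<in> carrier G" "c \<in> C" shows "lam (inv g \<otimes> c \<otimes> g) = chi (inv g) * lam c"
proof -
  have "lam (inv g) + chi (inv g) * lam g = 0" using lam_mult[of "inv g" g] assms by simp
  then show ?thesis using assms by (simp add: C_def lam_mult chi_mult algebra_simps)
qed

text \<open>On C, conjugation scales \<open>lam\<close> and h by inverse factors, so the pointwise
  product \<open>lam * h\<close> is conjugation invariant. The weight \<open>chi\<close> of the
  convolution then comes from f alone.\<close>

lemma conv_lam_tw:
  assumes f: "f \<in> tw" and h: "h \<in> tw" shows "f \<star> (lam * h) \<in> tw"
proof -
  have fC: "f \<in> fspace C" and hC: "h \<in> fspace C" using f h by (simp_all add: tw_def)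
  have "(f \<star> (lam * h)) (inv g \<otimes> u \<otimes> g) = chi g * (f \<star> (lam * h)) u"
    if g: "g \<in> carrier G" and u: "u \<in> carrier G" for g u
  proof -
    have 1: "(lam * h) (inv g \<otimes> c \<otimes> g) = (lam * h) c" if c: "c \<in> carrier G" for c
    proof (cases "c \<in> C")
      case True
      then show ?thesis using lam_conj[OF g True] h g c chi_inv[OF g]
        by (simp add: tw_iff mult.assoc mult.left_commute mult.commute[of "chi g"])
    next
      case False
      then show ?thesis using conj_in_C[OF g c] fspaceD[OF hC] by simp
    qed
    have "(f \<star> (lam * h)) (inv g \<otimes> u \<otimes> g)
        = (\<Sum>y\<in>carrier G. f (inv g \<otimes> y \<otimes> g) * (lam * h) (inv (inv g \<otimes> y \<otimes> g) \<otimes> (inv g \<otimes> u \<otimes> g)))"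
      using g u by (simp only: conv_apply sum_conj[of g "\<lambda>y. f y * (lam * h) (inv y \<otimes> (inv g \<otimes> u \<otimes> g))"] m_closed inv_closed)
    also have "\<dots> = (\<Sum>y\<in>carrier G. chi g * (f y * (lam * h) (inv y \<otimes> u)))"
    proof (rule sum.cong[OF refl])
      fix y assume y: "y \<in> carrier G"
      have "inv (inv g \<otimes> y \<otimes> g) \<otimes> (inv g \<otimes> u \<otimes> g) = inv g \<otimes> (inv y \<otimes> u) \<otimes> g"
        using g u y by (simp add: inv_mult_group m_assoc)
      then show "f (inv g \<otimes> y \<otimes> g) * (lam * h) (inv (inv g \<otimes> y \<otimes> g) \<otimes> (inv g \<otimes> u \<otimes> g))
          = chi g * (f y * (lam * h) (inv y \<otimes> u))"
        using 1[of "inv y \<otimes> u"] f g u y by (simp add: tw_iff mult.assoc)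
    qed
    finally show ?thesis using u by (simp add: conv_apply sum_distrib_left)
  qed
  moreover have "f \<star> (lam * h) \<in> fspace C" using fC hC by (simp add: conv_fspace_C)
  ultimately show ?thesis by (simp add: tw_iff)
qed

lemma tbr_closed: "f \<in> tw \<Longrightarrow> h \<in> tw \<Longrightarrow> tbr f h \<in> tw"
  unfolding tbr_def by (intro tw_closed conv_lam_tw)

lemma tw_lie_closed: "lie_closed tw_lie"
  unfolding lie_closed_def lie_ideal_def lie_subspace_def tw_lie_def
  by (auto simp: tw_closed tbr_closed fun_eq_iff)

text \<open>Composing two such operators gives a first order term and a term with \<open>lam\<close>
  applied twice to h. The coefficients of the latter are f g and g f, which agree because elements
  of \<open>tw\<close> commute.\<close>

lemma twD_bracket:
  assumes f: "f \<in> tw" and g: "g \<in> tw" and h: "h \<in> fspace (carrier G)"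
  shows "twD f (twD g h) - twD g (twD f h) = twD (tbr f g) h"
proof -
  have *: "twD f (twD g h) = (f \<star> (lam * g)) \<star> (lam * h) + (f \<star> g) \<star> (lam * (lam * h))"
    if "f \<in> tw" "g \<in> tw" for f g
  proof -
    have "chi * g = g" using that by (auto simp: fun_eq_iff C_def tw_iff fspace_def)
    then show ?thesis using h that
      by (simp add: twD_def lam_conv conv_add_right conv_assoc)
  qed
  have "f \<star> g = g \<star> f" using tw_comm[OF f, of g] g by (simp add: tw_iff)
  then show ?thesis using *[OF f g] *[OF g f] h
    by (simp add: tbr_def twD_def conv_diff_left)
qed

end

section \<open>Derivations as 1-cocycles, and cosets of inner derivations\<close>

context finite_group
begin

definition cocycle :: "('a \<Rightarrow> 'a \<Rightarrow> 'k::field) \<Rightarrow> bool" where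
  "cocycle \<alpha> \<longleftrightarrow> (\<forall>g\<in>carrier G. \<forall>h\<in>carrier G. \<forall>u\<in>carrier G.
      \<alpha> (g \<otimes> h) u = \<alpha> g u + \<alpha> h (inv g \<otimes> u \<otimes> g))"

text \<open>The coefficient of u in D(g) g^(-1). In this normalisation the Leibniz rule becomes the
  cocycle identity for conjugation, and inner derivations become coboundaries.\<close>

definition der_coc :: "(('a \<Rightarrow> 'k::field) \<Rightarrow> 'a \<Rightarrow> 'k) \<Rightarrow> 'a \<Rightarrow> 'a \<Rightarrow> 'k" where
  "der_coc D = (\<lambda>g u. D (single g) (u \<otimes> g))"

lemma cocycleD:
  "cocycle \<alpha> \<Longrightarrow> g \<in> carrier G \<Longrightarrow> h \<in> carrier G \<Longrightarrow> u \<in> carrier G \<Longrightarrow>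
    \<alpha> (g \<otimes> h) u = \<alpha> g u + \<alpha> h (inv g \<otimes> u \<otimes> g)"
  by (simp add: cocycle_def)

lemma cocycle_one:
  assumes "cocycle \<alpha>" "u \<in> carrier G" shows "\<alpha> \<one> u = 0"
proof -
  have "\<alpha> \<one> u = \<alpha> \<one> u + \<alpha> \<one> u" using cocycleD[OF assms(1), of \<one> \<one> u] assms(2) by (simp del: add_cancel_right_right)
  then show ?thesis by (simp only: add_cancel_right_right)
qed

lemma conj_mult: "g \<in> carrier G \<Longrightarrow> h \<in> carrier G \<Longrightarrow> u \<in> carrier G \<Longrightarrow>
    inv (g \<otimes> h) \<otimes> u \<otimes> (g \<otimes> h) = inv h \<otimes> (inv g \<otimes> u \<otimes> g) \<otimes> h"
  by (simp add: inv_mult_group m_assoc)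

lemma cocycle_der_coc:
  assumes D: "D \<in> derivations (carrier G) conv" shows "cocycle (der_coc D)"
  unfolding cocycle_def
proof (intro ballI)
  fix g h u assume [simp]: "g \<in> carrier G" "h \<in> carrier G" "u \<in> carrier G"
  have "D (single (g \<otimes> h)) = D (single g) \<star> single h + single g \<star> D (single h)"
    using derivationsD(4)[OF D, of "single g" "single h"] by (simp add: single_conv_single)
  then show "der_coc D (g \<otimes> h) u = der_coc D g u + der_coc D h (inv g \<otimes> u \<otimes> g)"
    by (simp add: der_coc_def conv_single single_conv m_assoc)
qed

lemma der_coc_inject:
  assumes D: "D \<in> derivations (carrier G) conv" and E: "E \<in> derivations (carrier G) conv"
    and eq: "\<And>g u. g \<in> carrier G \<Longrightarrow> u \<in> carrier G \<Longrightarrow> der_coc D g u = der_coc E g u"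
  shows "D = E"
proof (rule derivation_eqI[OF fin D E])
  fix g assume g: "g \<in> carrier G"
  show "D (single g) = E (single g)"
  proof
    fix z
    show "D (single g) z = E (single g) z"
    proof (cases "z \<in> carrier G")
      case True
      then show ?thesis using eq[OF g, of "z \<otimes> inv g"] g by (simp add: der_coc_def m_assoc)
    next
      case False
      then show ?thesis
        using derivationsD(1)[OF D, of "single g"] derivationsD(1)[OF E, of "single g"] g
        by (simp add: fspaceD)
    qed
  qed
qed

lemma der_coc_inn:
  assumes "a \<in> fspace (carrier G)" "g \<in> carrier G" "u \<in> carrier G"
  shows "der_coc (inn a) g u = a u - a (inv g \<otimes> u \<otimes> g)"
  using assms by (simp add: der_coc_def inn_def single_conv conv_single m_assoc)

lemma inn_add: "a \<in> fspace (carrier G) \<Longrightarrow> b \<in> fspace (carrier G) \<Longrightarrow> inn a + inn b = inn (a + b)"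
  by (auto simp: fun_eq_iff inn_def conv_add_left conv_add_right)

lemma inn_smul: "smul c (inn a h) = inn (smul c a) h"
  by (auto simp: fun_eq_iff inn_def conv_smul_left conv_smul_right algebra_simps)

lemma inn_zero: "inn 0 = 0"
  by (auto simp: fun_eq_iff inn_def)

text \<open>This is [D, ad b] = ad (D b): inner derivations form an ideal, so the bracket of two
  cosets does not depend on the representatives.\<close>

lemma derivation_inn_bracket:
  assumes D: "D \<in> derivations (carrier G) conv" and b: "b \<in> fspace (carrier G)"
    and h: "h \<in> fspace (carrier G)"
  shows "D (inn b h) - inn b (D h) = inn (D b) h"
  using derivationsD[OF D] b h
  by (simp add: inn_def derivations_minus[OF D] algebra_simps)

abbreviation "DL \<equiv> der_lie (carrier G) conv"
abbreviation "inner \<equiv> inner_derivations (carrier G) conv"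

lemma lcoset_eq: "lcoset DL inner D = {D + inn a |a. a \<in> fspace (carrier G)}"
  unfolding lcoset_def inner_derivations_eq by (auto simp: der_lie_def plus_fun_def)

lemma lcoset_eqI:
  assumes "a \<in> fspace (carrier G)" shows "lcoset DL inner (D + inn a) = lcoset DL inner D"
proof -
  have "D + inn a + inn b = D + inn (a + b)" if "b \<in> fspace (carrier G)" for b
    using that inn_add[OF assms that] by (simp add: add.assoc)
  moreover have "D + inn b = D + inn a + inn (b - a)" if "b \<in> fspace (carrier G)" for b
  proof -
    have "inn b = inn a + inn (b - a)" using inn_add[OF assms, of "b - a"] that assms by simp
    then show ?thesis by (simp add: add.assoc)
  qed
  ultimately show ?thesis unfolding lcoset_eq
    by (safe; (metis assms fspace_closed(2) fspace_closed(3)))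
qed

text \<open>The operations of the quotient act on representatives picked by \<open>SOME\<close>,
  about which nothing is known except that they differ from the given one by an inner
  derivation.\<close>

lemma lcoset_some:
  obtains a where "a \<in> fspace (carrier G)" "(SOME E. E \<in> lcoset DL inner D) = D + inn a"
proof -
  have "D + inn 0 \<in> lcoset DL inner D" unfolding lcoset_eq using fspace_closed(1) by blast
  then have "(SOME E. E \<in> lcoset DL inner D) \<in> lcoset DL inner D"
    by (rule someI[where P = "\<lambda>E. E \<in> lcoset DL inner D"])
  then show ?thesis using that unfolding lcoset_eq by blast
qed

end

section \<open>Decomposition of cocycles and computation of HH1\<close>

context twisted_group
begin

lemma P_sub: "P \<subseteq> carrier G" using P_eq by auto
lemma P_fin: "finite P" using P_sub fin by (rule finite_subset)
lemma P_mult: "y \<in> P \<Longrightarrow> z \<in> P \<Longrightarrow> y \<otimes> z \<in> P" 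
  unfolding P_eq by (auto simp: nat_pow_mult)
lemma P_one: "\<one> \<in> P" unfolding P_eq by (auto intro: exI[of _ "0::nat"])
lemma x_in_P: "x \<in> P" unfolding P_eq by (auto intro: exI[of _ "1::nat"])

lemma pow_comm_C: "c \<in> C \<Longrightarrow> inv (x [^] (i::nat)) \<otimes> c \<otimes> x [^] i = c"
proof -
  assume c: "c \<in> C"
  have "c \<otimes> x [^] i = x [^] i \<otimes> c" using chi_comm[of c] c
    by (induction i) (auto simp: C_def m_assoc, metis m_assoc nat_pow_closed x_in)
  then show ?thesis using c by (simp add: C_def m_assoc)
qed

lemma sum_P_shift: "z \<in> P \<Longrightarrow> (\<Sum>y\<in>P. F (z \<otimes> y)) = (\<Sum>y\<in>P. F y)"
  by (rule sum.reindex_bij_witness[of _ "\<lambda>y. inv z \<otimes> y" "\<lambda>y. z \<otimes> y"])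
    (use P_sub P_mult P_inv in \<open>auto simp: subset_iff\<close>)

text \<open>\<open>P\<close> acts freely by conjugation outside \<open>C\<close>; the weight picks one element of each orbit.\<close>
lemma orbit_weight:
  obtains w :: "'a \<Rightarrow> 'k" where
    "\<And>v. v \<in> carrier G - C \<Longrightarrow> (\<Sum>y\<in>P. w (inv y \<otimes> v \<otimes> y)) = 1"
proof -
  define orb where "orb v = {inv y \<otimes> v \<otimes> y |y. y \<in> P}" for v
  define w :: "'a \<Rightarrow> 'k" where "w v = (if v = (SOME u. u \<in> orb v) then 1 else 0)" for v
  have "(\<Sum>y\<in>P. w (inv y \<otimes> v \<otimes> y)) = 1" if v: "v \<in> carrier G - C" for v
  proof -
    have orb: "orb (inv y \<otimes> v \<otimes> y) = orb v" if y: "y \<in> P" for y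
    proof -
      have yG: "y \<in> carrier G" using y P_sub by auto
      have 1: "\<exists>z'\<in>P. inv z \<otimes> (inv y \<otimes> v \<otimes> y) \<otimes> z = inv z' \<otimes> v \<otimes> z'" if z: "z \<in> P" for z
        using P_mult[OF y z] conj_mult[of y z v] z P_sub yG v by (metis Diff_iff subset_iff)
      have 2: "\<exists>z'\<in>P. inv z \<otimes> v \<otimes> z = inv z' \<otimes> (inv y \<otimes> v \<otimes> y) \<otimes> z'" if z: "z \<in> P" for z
      proof 
        have zG: "z \<in> carrier G" using z P_sub by auto
        show "inv y \<otimes> z \<in> P" using P_mult P_inv y z by blast
        show "inv z \<otimes> v \<otimes> z = inv (inv y \<otimes> z) \<otimes> (inv y \<otimes> v \<otimes> y) \<otimes> (inv y \<otimes> z)"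
          using yG zG v conj_mult[of y "inv y \<otimes> z" v] by simp
      qed
      show ?thesis
      proof (intro equalityI subsetI)
        fix t assume "t \<in> orb (inv y \<otimes> v \<otimes> y)"
        then obtain z where "z \<in> P" "t = inv z \<otimes> (inv y \<otimes> v \<otimes> y) \<otimes> z" unfolding orb_def by blast
        then show "t \<in> orb v" using 1[of z] unfolding orb_def by auto
      next
        fix t assume "t \<in> orb v"
        then obtain z where "z \<in> P" "t = inv z \<otimes> v \<otimes> z" unfolding orb_def by blast
        then show "t \<in> orb (inv y \<otimes> v \<otimes> y)" using 2[of z] unfolding orb_def by auto
      qed
    qed
    define r where "r = (SOME u. u \<in> orb v)"
    have "\<one> \<in> P" by (rule P_one)
    then have "r \<in> orb v" unfolding r_def by (intro someI[where P = "\<lambda>u. u \<in> orb v"]) (auto simp: orb_def)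
    then obtain y0 where y0: "y0 \<in> P" "r = inv y0 \<otimes> v \<otimes> y0" unfolding orb_def by blast
    have "w (inv y \<otimes> v \<otimes> y) = (if y = y0 then 1 else 0)" if y: "y \<in> P" for y
    proof -
      have G: "y \<in> carrier G" "y0 \<in> carrier G" "v \<in> carrier G" using y y0 P_sub v by auto
      \<comment> \<open>Equal conjugates of v mean that y y0^(-1) is an element of \<open>P\<close>
        commuting with v. As v lies outside C, \<open>chi_free\<close> makes it trivial.\<close>
      have "y = y0" if e: "inv y \<otimes> v \<otimes> y = inv y0 \<otimes> v \<otimes> y0"
      proof -
        have "y \<otimes> (inv y \<otimes> v \<otimes> y) \<otimes> inv y0 = y \<otimes> (inv y0 \<otimes> v \<otimes> y0) \<otimes> inv y0" using e by simp
        then have "v \<otimes> (y \<otimes> inv y0) = (y \<otimes> inv y0) \<otimes> v" using G by (simp add: m_assoc)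
        then have "y \<otimes> inv y0 = \<one>"
          using chi_free[of v "y \<otimes> inv y0"] v P_mult[OF y P_inv[OF y0(1)]] by (auto simp: C_def)
        then show ?thesis using G by (metis inv_equality inv_inv inv_closed)
      qed
      then show ?thesis using y0 unfolding w_def orb[OF y] r_def[symmetric] by auto
    qed
    then show ?thesis using y0(1) P_fin by (simp cong: sum.cong)
  qed
  then show ?thesis using that by blast
qed

lemma cocycle_coboundary: "cocycle (\<lambda>g u. a u - a (inv g \<otimes> u \<otimes> g))"
  unfolding cocycle_def by (auto simp: conj_mult)

lemma cocycle_diff: "cocycle \<alpha> \<Longrightarrow> cocycle \<beta> \<Longrightarrow> cocycle (\<lambda>g u. \<alpha> g u - \<beta> g u)"
  unfolding cocycle_def by (auto simp: algebra_simps)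

lemma cocycle_tw: "f \<in> tw \<Longrightarrow> cocycle (\<lambda>g u. lam g * f u)"
  unfolding cocycle_def by (auto simp: tw_iff lam_mult algebra_simps)

text \<open>Vanishing at x spreads to all of \<open>P\<close>, so \<alpha> is constant on the cosets
  g P. The average of \<alpha> over the transversal \<open>T\<close> is then a primitive; it exists
  because \<open>card T\<close> is invertible in the field.\<close>

lemma cocycle_vanishing:
  fixes \<alpha> :: "'a \<Rightarrow> 'a \<Rightarrow> 'k"
  assumes c: "cocycle \<alpha>" and x0: "\<And>u. u \<in> carrier G \<Longrightarrow> \<alpha> x u = 0"
  obtains b where "b \<in> fspace (carrier G)"
    "\<And>g u. g \<in> carrier G \<Longrightarrow> u \<in> carrier G \<Longrightarrow> \<alpha> g u = b u - b (inv g \<otimes> u \<otimes> g)"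
proof -
  note one = cocycle_one[OF c]
  have "\<alpha> (x [^] i) u = 0" if "u \<in> carrier G" for u and i :: nat
    using that by (induction i) (simp_all add: one cocycleD[OF c] x0)
  then have P0: "\<alpha> y u = 0" if "y \<in> P" "u \<in> carrier G" for y u using that P_eq by auto
  have inv: "\<alpha> (g \<otimes> y) u = \<alpha> g u" if "g \<in> carrier G" "y \<in> P" "u \<in> carrier G" for g y u
    using that P_sub by (auto simp: cocycleD[OF c] P0)
  have finT: "finite T" using T_sub fin finite_subset by blast
  define b where "b u = (if u \<in> carrier G then (\<Sum>t\<in>T. \<alpha> t u) / of_nat (card T) else 0)" for u
  have "\<alpha> g u = b u - b (inv g \<otimes> u \<otimes> g)" if g: "g \<in> carrier G" and u: "u \<in> carrier G" for g u
  proof -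
    have "(\<Sum>t\<in>T. \<alpha> t u) = (\<Sum>t\<in>T. \<alpha> (g \<otimes> t) u)"
      using T_shift[OF g, of "\<lambda>g. \<alpha> g u"] inv u by simp
    also have "\<dots> = (\<Sum>t\<in>T. \<alpha> g u + \<alpha> t (inv g \<otimes> u \<otimes> g))"
      using T_sub g u by (intro sum.cong) (auto simp: cocycleD[OF c])
    also have "\<dots> = of_nat (card T) * \<alpha> g u + (\<Sum>t\<in>T. \<alpha> t (inv g \<otimes> u \<otimes> g))"
      by (simp add: sum.distrib)
    finally show ?thesis using g u T_card by (simp add: b_def field_simps)
  qed
  moreover have "b \<in> fspace (carrier G)" by (simp add: fspace_def b_def)
  ultimately show ?thesis using that by blast
qed

text \<open>Off C, a weighted average over \<open>P\<close> makes \<alpha> vanish at x up to a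
  coboundary. On C conjugation by x is trivial, so no coboundary can change the value at x; this
  value f is removed by subtracting the cocycle \<open>lam g * f u\<close>. What remains vanishes at
  x.\<close>

lemma cocycle_decomposition:
  fixes \<alpha> :: "'a \<Rightarrow> 'a \<Rightarrow> 'k"
  assumes c: "cocycle \<alpha>"
  obtains f a where "f \<in> tw" "a \<in> fspace (carrier G)"
    "\<And>g u. g \<in> carrier G \<Longrightarrow> u \<in> carrier G \<Longrightarrow>
       \<alpha> g u = lam g * f u + (a u - a (inv g \<otimes> u \<otimes> g))"
proof -
  obtain w :: "'a \<Rightarrow> 'k" where w: "\<And>v. v \<in> carrier G - C \<Longrightarrow> (\<Sum>y\<in>P. w (inv y \<otimes> v \<otimes> y)) = 1"
    using orbit_weight by blast
  define a where "a v = (if v \<in> carrier G - C then \<Sum>y\<in>P. w (inv y \<otimes> v \<otimes> y) * \<alpha> y v else 0)" for v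
  define \<beta> where "\<beta> g u = \<alpha> g u - (a u - a (inv g \<otimes> u \<otimes> g))" for g u
  have cb: "cocycle \<beta>" unfolding \<beta>_def by (rule cocycle_diff[OF c cocycle_coboundary])
  have off: "\<beta> x v = 0" if v: "v \<in> carrier G" "v \<notin> C" for v
  proof -
    have v': "inv x \<otimes> v \<otimes> x \<notin> C" using v conj_in_C by simp
    \<comment> \<open>The weight is evaluated at the conjugate of v by x y, and the cocycle identity
      expresses \<alpha> at y and the conjugate point through \<alpha> (x y) and \<alpha> x.
      Replacing x y by y then leaves a v minus \<alpha> x v, since the weights add up to 1.\<close>
    have "a (inv x \<otimes> v \<otimes> x) = (\<Sum>y\<in>P. w (inv (x \<otimes> y) \<otimes> v \<otimes> (x \<otimes> y)) * (\<alpha> (x \<otimes> y) v - \<alpha> x v))"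
      using v v' P_sub by (auto simp: a_def conj_mult cocycleD[OF c] intro!: sum.cong)
    also have "\<dots> = (\<Sum>y\<in>P. w (inv y \<otimes> v \<otimes> y) * (\<alpha> y v - \<alpha> x v))"
      by (rule sum_P_shift[OF x_in_P, of "\<lambda>y. w (inv y \<otimes> v \<otimes> y) * (\<alpha> y v - \<alpha> x v)"])
    also have "\<dots> = a v - (\<Sum>y\<in>P. w (inv y \<otimes> v \<otimes> y)) * \<alpha> x v"
      using v by (simp add: a_def right_diff_distrib sum_subtractf sum_distrib_right)
    finally show ?thesis using w[of v] v by (simp add: \<beta>_def)
  qed
  define f where "f u = (if u \<in> C then \<beta> x u else 0)" for u
  have f: "\<beta> x u = f u" if "u \<in> carrier G" for u using off that by (simp add: f_def)
  note one = cocycle_one[OF cb]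
  \<comment> \<open>Powers of x fix u under conjugation, so on C the cocycle is additive along
    \<open>P\<close>.\<close>
  have pow: "\<beta> (x [^] i) u = of_nat i * f u" if "u \<in> C" for u and i :: nat
    using that C_sub by (induction i)
      (auto simp: one cocycleD[OF cb] pow_comm_C f algebra_simps subset_iff)
  have "f \<in> tw"
    unfolding tw_iff
  proof (intro conjI ballI)
    show "f \<in> fspace C" by (simp add: fspace_def f_def)
    fix g u assume g: "g \<in> carrier G" and u: "u \<in> carrier G"
    show "f (inv g \<otimes> u \<otimes> g) = chi g * f u"
    proof (cases "u \<in> C")
      case True
      obtain m :: nat where m: "g \<otimes> x \<otimes> inv g = x [^] m" "chi g = of_nat m" using act[OF g] by blast
      \<comment> \<open>The cocycle identity for both sides of x^m g = g x gives m f(u) + \<beta> g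
        u on the left and \<beta> g u + f(g^(-1) u g) on the right. With
        \<open>chi g = of_nat m\<close> this is the required weight.\<close>
      have "x [^] m \<otimes> g = g \<otimes> x" using g by (simp flip: m(1) add: m_assoc)
      then have "\<beta> (x [^] m \<otimes> g) u = \<beta> (g \<otimes> x) u" by simp
      then show ?thesis
        using g u True m(2) by (simp add: cocycleD[OF cb] pow pow_comm_C f)
    qed (use conj_in_C[OF g u] in \<open>simp add: f_def\<close>)
  qed
  obtain b where b: "b \<in> fspace (carrier G)" "\<And>g u. g \<in> carrier G \<Longrightarrow> u \<in> carrier G \<Longrightarrow> 
      \<beta> g u - lam g * f u = b u - b (inv g \<otimes> u \<otimes> g)"
    using cocycle_vanishing[OF cocycle_diff[OF cb cocycle_tw[OF \<open>f \<in> tw\<close>]]] f by auto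
  show ?thesis
  proof (rule that[OF \<open>f \<in> tw\<close>, of "a + b"])
    show "a + b \<in> fspace (carrier G)" using b(1) by (simp add: fspace_def a_def)
    fix g u assume "g \<in> carrier G" "u \<in> carrier G"
    then show "\<alpha> g u = lam g * f u + ((a + b) u - (a + b) (inv g \<otimes> u \<otimes> g))"
      using b(2)[of g u] by (simp add: \<beta>_def algebra_simps)
  qed
qed

lemma der_coc_twD:
  assumes "f \<in> tw" "g \<in> carrier G" "u \<in> carrier G"
  shows "der_coc (twD f) g u = lam g * f u"
proof -
  have "lam * single g = smul (lam g) (single g)" by (auto simp: fun_eq_iff single_def)
  then show ?thesis using assms by (simp add: der_coc_def twD_def conv_smul_right conv_single m_assoc)
qed

lemma derivation_decomposition:
  fixes D :: "('a \<Rightarrow> 'k) \<Rightarrow> 'a \<Rightarrow> 'k"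
  assumes D: "D \<in> derivations (carrier G) conv"
  obtains f a where "f \<in> tw" "a \<in> fspace (carrier G)" "D = twD f + inn a"
proof -
  obtain f a where fa: "f \<in> tw" "a \<in> fspace (carrier G)"
    "\<And>g u. g \<in> carrier G \<Longrightarrow> u \<in> carrier G \<Longrightarrow>
       der_coc D g u = lam g * f u + (a u - a (inv g \<otimes> u \<otimes> g))"
    using cocycle_decomposition[OF cocycle_der_coc[OF D]] by blast
  have "D = twD f + inn a"
  proof (rule der_coc_inject[OF D derivations_add[OF twD_derivation[OF fa(1)] inn_derivation[OF fa(2)]]])
    fix g u assume "g \<in> carrier G" "u \<in> carrier G"
    then show "der_coc D g u = der_coc (twD f + inn a) g u"
      using fa der_coc_twD[of f g u] der_coc_inn[of a g u] by (simp add: der_coc_def)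
  qed
  then show ?thesis using that fa by blast
qed

lemma twD_add: "f \<in> tw \<Longrightarrow> g \<in> tw \<Longrightarrow> twD (f + g) = twD f + twD g"
  by (auto simp: fun_eq_iff twD_def conv_add_left)

lemma lie_iso_tw_HH1:
  "lie_iso tw_lie (HH1 (carrier G) conv) (\<lambda>f. lcoset DL inner (twD f))"
proof -
  let ?\<phi> = "\<lambda>f. lcoset DL inner (twD f)"
  have inj: "inj_on ?\<phi> tw"
  proof (rule inj_onI)
    fix f g assume fg: "f \<in> tw" "g \<in> tw" "?\<phi> f = ?\<phi> g"
    have "twD f + inn 0 \<in> ?\<phi> f" unfolding lcoset_eq using fspace_closed(1) by blast
    then have "twD f \<in> ?\<phi> g" using fg(3) by (simp add: inn_zero)
    then obtain a where a: "a \<in> fspace (carrier G)" "twD f = twD g + inn a" unfolding lcoset_eq by blast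
    show "f = g"
    proof
      fix c
      show "f c = g c"
      proof (cases "c \<in> C")
        case True
        then have cG: "c \<in> carrier G" by (simp add: C_def)
        \<comment> \<open>Evaluation at x separates the classes: \<open>twD f\<close> gives f there,
          while a coboundary vanishes on C because x centralizes C.\<close>
        have "der_coc (twD f) x c = der_coc (twD g) x c + der_coc (inn a) x c"
          using a(2) by (simp add: der_coc_def)
        then show ?thesis
          using der_coc_twD[OF fg(1) x_in cG] der_coc_twD[OF fg(2) x_in cG]
            der_coc_inn[OF a(1) x_in cG] pow_comm_C[OF True, of 1] by simp
      next
        case False
        then show ?thesis using fg(1,2) fspaceD[of f C c] fspaceD[of g C c] by (simp add: tw_iff)
      qed
    qed
  qed
  have surj: "?\<phi> ` tw = lcoset DL inner ` derivations (carrier G) conv"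
  proof (intro equalityI subsetI)
    fix A assume "A \<in> ?\<phi> ` tw"
    then show "A \<in> lcoset DL inner ` derivations (carrier G) conv" using twD_derivation by blast
  next
    fix A :: "(('a \<Rightarrow> 'k) \<Rightarrow> 'a \<Rightarrow> 'k) set" assume "A \<in> lcoset DL inner ` derivations (carrier G) conv"
    then obtain D where D: "D \<in> derivations (carrier G) conv" "A = lcoset DL inner D" by blast
    obtain f a where "f \<in> tw" "a \<in> fspace (carrier G)" "D = twD f + inn a"
      using derivation_decomposition[OF D(1)] by blast
    then show "A \<in> ?\<phi> ` tw" using D(2) lcoset_eqI by blast
  qed
  have plus: "?\<phi> (f + g) = lcoset DL inner (lplus DL (SOME D. D \<in> ?\<phi> f) (SOME D. D \<in> ?\<phi> g))"
    if fg: "f \<in> tw" "g \<in> tw" for f g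
  proof -
    obtain a where a: "a \<in> fspace (carrier G)" "(SOME D. D \<in> ?\<phi> f) = twD f + inn a" by (rule lcoset_some)
    obtain b where b: "b \<in> fspace (carrier G)" "(SOME D. D \<in> ?\<phi> g) = twD g + inn b" by (rule lcoset_some)
    have "lplus DL (twD f + inn a) (twD g + inn b) = twD (f + g) + inn (a + b)"
      using twD_add[OF fg] inn_add[OF a(1) b(1), symmetric] by (auto simp: der_lie_def fun_eq_iff)
    then show ?thesis using a b lcoset_eqI[of "a + b" "twD (f + g)"] by simp
  qed
  have scale: "?\<phi> (smul c f) = lcoset DL inner (lscale DL c (SOME D. D \<in> ?\<phi> f))"
    if f: "f \<in> tw" for c f
  proof -
    obtain a where a: "a \<in> fspace (carrier G)" "(SOME D. D \<in> ?\<phi> f) = twD f + inn a" by (rule lcoset_some)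
    have "lscale DL c (twD f + inn a) = twD (smul c f) + inn (smul c a)"
      using inn_smul[of c a, symmetric]
      by (auto simp: der_lie_def fun_eq_iff twD_def conv_smul_left distrib_left)
    then show ?thesis using a lcoset_eqI[of "smul c a" "twD (smul c f)"] by simp
  qed
  have bracket: "?\<phi> (tbr f g) = lcoset DL inner (lbracket DL (SOME D. D \<in> ?\<phi> f) (SOME D. D \<in> ?\<phi> g))"
    if fg: "f \<in> tw" "g \<in> tw" for f g
  proof -
    obtain a where a: "a \<in> fspace (carrier G)" "(SOME D. D \<in> ?\<phi> f) = twD f + inn a" by (rule lcoset_some)
    obtain b where b: "b \<in> fspace (carrier G)" "(SOME D. D \<in> ?\<phi> g) = twD g + inn b" by (rule lcoset_some)
    let ?D = "twD f + inn a" and ?E = "twD g + inn b"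
    note df = twD_derivation[OF fg(1)] and dg = twD_derivation[OF fg(2)]
    have dD: "?D \<in> derivations (carrier G) conv"
      by (rule derivations_add[OF df inn_derivation[OF a(1)]])
    have dE: "?E \<in> derivations (carrier G) conv"
      by (rule derivations_add[OF dg inn_derivation[OF b(1)]])
    \<comment> \<open>The inner part of the bracket: [D, ad b] = ad (D b) for the full derivation D
      = \<open>twD f + inn a\<close>, while [ad a, \<open>twD g\<close>] = - ad
      (\<open>twD g a\<close>).\<close>
    define s where "s = ?D b - twD g a"
    have s: "s \<in> fspace (carrier G)" unfolding s_def
      by (intro fspace_closed derivationsD(1)[OF dD] derivationsD(1)[OF dg] a b)
    have "?D (?E h) - ?E (?D h) = twD (tbr f g) h + inn s h" for h
    proof (cases "h \<in> fspace (carrier G)")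
      case h: True
      have in_E: "twD g h \<in> fspace (carrier G)" "inn b h \<in> fspace (carrier G)"
        "twD f h \<in> fspace (carrier G)" "inn a h \<in> fspace (carrier G)"
        using derivationsD(1)[OF dg h] derivationsD(1)[OF inn_derivation[OF b(1)] h] 
          derivationsD(1)[OF df h] derivationsD(1)[OF inn_derivation[OF a(1)] h] by auto
      have 1: "?D (?E h) = twD f (twD g h) + inn a (twD g h) + ?D (inn b h)"
        using derivationsD(2)[OF dD in_E(1,2)] by simp
      have 2: "?E (?D h) = twD g (twD f h) + twD g (inn a h) + inn b (?D h)"
        using derivationsD(2)[OF dg in_E(3,4)] by simp
      have 3: "?D (inn b h) - inn b (?D h) = inn (?D b) h"
        by (rule derivation_inn_bracket[OF dD b(1) h])
      have 4: "twD g (inn a h) - inn a (twD g h) = inn (twD g a) h"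
        by (rule derivation_inn_bracket[OF dg a(1) h])
      have 5: "inn s h = inn (?D b) h - inn (twD g a) h"
        using h by (simp add: inn_def s_def conv_diff_left conv_diff_right)
      show ?thesis
        unfolding twD_bracket[OF fg h, symmetric] 1 2 5 3[symmetric] 4[symmetric] by (simp add: algebra_simps)
    next
      case False
      then show ?thesis
        using derivationsD(5)[OF dD False] derivationsD(5)[OF dE False]
          derivations_zero[OF dD] derivations_zero[OF dE] by (simp add: twD_def inn_def)
    qed
    then have "lbracket DL ?D ?E = twD (tbr f g) + inn s"
      unfolding der_lie_def by (auto simp: fun_eq_iff)
    then show ?thesis using a b lcoset_eqI[OF s, of "twD (tbr f g)"] by simp
  qed
  show ?thesis
    unfolding lie_iso_def bij_betw_def
    using inj surj plus scale bracket by (simp add: tw_lie_def HH1_def lie_quotient_def der_lie_def[of "carrier G" conv])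
qed

lemma HH1_closed: "lie_closed (HH1 (carrier G) (conv :: ('a \<Rightarrow> 'k) \<Rightarrow> _))"
proof (rule lie_closed_iso[OF lie_iso_tw_HH1 tw_lie_closed])
  have "twD 0 = 0" by (auto simp: fun_eq_iff twD_def)
  then show "lcoset DL inner (twD (lzero tw_lie)) = lzero (HH1 (carrier G) (conv :: ('a \<Rightarrow> 'k) \<Rightarrow> _))"
    by (simp add: tw_lie_def HH1_def lie_quotient_def der_lie_def zero_fun_def)
qed

lemma HH1_semisimple_iff: "lie_semisimple (HH1 (carrier G) (conv :: ('a \<Rightarrow> 'k) \<Rightarrow> _)) \<longleftrightarrow> lie_semisimple tw_lie"
  using lie_semisimple_iso[OF lie_iso_tw_HH1 tw_lie_closed HH1_closed]
    lie_semisimple_iso[OF lie_iso_sym[OF lie_iso_tw_HH1 tw_lie_closed] HH1_closed tw_lie_closed] by blast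

end

section \<open>A solvable ideal\<close>

context twisted_group
begin

definition kerlam :: "'a set" where "kerlam = {c \<in> C. lam c = 0}"

text \<open>On C, \<open>lam\<close> is a homomorphism to the additive group of the field, so these
  are the functions constant on the cosets of \<open>kerlam\<close>, that is, pulled back from C /
  \<open>kerlam\<close>.\<close>

definition lam_inv :: "('a \<Rightarrow> 'k) \<Rightarrow> bool" where
  "lam_inv f \<longleftrightarrow> (\<forall>c\<in>C. \<forall>d\<in>C. lam c = lam d \<longrightarrow> f c = f d)"

definition lam_ideal :: "('a \<Rightarrow> 'k) set" where "lam_ideal = {f \<in> tw. lam_inv f}"

lemma lam_invD: "lam_inv f \<Longrightarrow> c \<in> C \<Longrightarrow> d \<in> C \<Longrightarrow> lam c = lam d \<Longrightarrow> f c = f d"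
  unfolding lam_inv_def by blast

lemma lam_invI: "(\<And>c d. c \<in> C \<Longrightarrow> d \<in> C \<Longrightarrow> lam c = lam d \<Longrightarrow> f c = f d) \<Longrightarrow> lam_inv f"
  unfolding lam_inv_def by blast

lemma lam_inv_closed:
  "lam_inv 0" "lam_inv f \<Longrightarrow> lam_inv h \<Longrightarrow> lam_inv (f + h)" "lam_inv f \<Longrightarrow> lam_inv h \<Longrightarrow> lam_inv (f - h)"
  "lam_inv f \<Longrightarrow> lam_inv (smul a f)" "lam_inv f \<Longrightarrow> lam_inv (lam * f)"
proof -
  show "lam_inv 0" by (rule lam_invI) simp
  show "lam_inv (f + h)" if "lam_inv f" "lam_inv h"
    by (rule lam_invI) (metis that lam_invD plus_fun_apply)
  show "lam_inv (f - h)" if "lam_inv f" "lam_inv h"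
    by (rule lam_invI) (metis that lam_invD minus_apply)
  show "lam_inv (smul a f)" if "lam_inv f" by (rule lam_invI) (metis that lam_invD smul_apply)
  show "lam_inv (lam * f)" if "lam_inv f" by (rule lam_invI) (metis that lam_invD times_fun_apply)
qed

lemma C_fin: "finite C" using C_sub fin finite_subset by blast

lemma C_one: "\<one> \<in> C" by (simp add: C_def)

lemma chi_x: "chi x = 1"
  using chi_free[of x x] x_in_P chi_one by fastforce

lemma lam_C_mult: "c \<in> C \<Longrightarrow> d \<in> C \<Longrightarrow> lam (c \<otimes> d) = lam c + lam d"
  by (simp add: C_def lam_mult)

lemma lam_C_inv: "c \<in> C \<Longrightarrow> lam (inv c) = - lam c"
  using lam_C_mult[of c "inv c"] C_inv[of c] by (simp add: C_def eq_neg_iff_add_eq_0 add.commute)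

lemma conv_apply_C:
  assumes "f \<in> fspace C" "z \<in> carrier G" shows "(f \<star> h) z = (\<Sum>y\<in>C. f y * h (inv y \<otimes> z))"
  unfolding conv_apply[OF assms(2)] 
  by (rule sum.mono_neutral_right) (use C_sub fspaceD[OF assms(1)] in auto)

lemma lam_inv_conv:
  assumes "f \<in> fspace C" "lam_inv h" shows "lam_inv (f \<star> h)"
  unfolding lam_inv_def
proof (intro ballI impI)
  fix c d assume cd: "c \<in> C" "d \<in> C" "lam c = lam d"
  have "h (inv y \<otimes> c) = h (inv y \<otimes> d)" if "y \<in> C" for y
    by (rule lam_invD[OF assms(2)]) (use cd that in \<open>auto simp: C_mult C_inv lam_C_mult\<close>)
  moreover have "c \<in> carrier G" "d \<in> carrier G" using cd C_sub by auto
  ultimately show "(f \<star> h) c = (f \<star> h) d"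
    using conv_apply_C[OF assms(1)] by (simp cong: sum.cong)
qed

text \<open>Moving h to the right in both terms allows \<open>lam_inv_conv\<close> to be applied
  with invariance of h only, so that \<open>lam_ideal\<close> is an ideal and not merely a
  subalgebra.\<close>

lemma tbr_alt: "f \<in> fspace C \<Longrightarrow> h \<in> tw \<Longrightarrow> tbr f h = f \<star> (lam * h) - (lam * f) \<star> h"
  using tw_comm[of h "lam * f"] by (simp add: tbr_def)

lemma lam_ideal_ideal: "lie_ideal tw_lie lam_ideal"
proof -
  have "tbr f h \<in> lam_ideal" if "f \<in> tw" "h \<in> lam_ideal" for f h
  proof -
    have f: "f \<in> fspace C" and h: "h \<in> tw" "lam_inv h" using that by (simp_all add: tw_iff lam_ideal_def)
    have "lam_inv (lam * h)" using h(2) by (rule lam_inv_closed)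
    then have "lam_inv (f \<star> (lam * h))" "lam_inv ((lam * f) \<star> h)" using f h by (auto intro: lam_inv_conv)
    then have "lam_inv (tbr f h)" unfolding tbr_alt[OF f h(1)] by (rule lam_inv_closed)
    then show ?thesis using that tbr_closed by (simp add: lam_ideal_def)
  qed
  then show ?thesis
    unfolding lie_ideal_def lie_subspace_def tw_lie_def
    by (auto simp: lam_ideal_def tw_closed lam_inv_closed)
qed

lemma lam_ideal_subspace: "lie_subspace tw_lie lam_ideal"
  using lam_ideal_ideal by (simp add: lie_ideal_def)

lemma lam_ideal_nonzero: "lam_ideal \<noteq> {0}"
proof -
  \<comment> \<open>On C conjugation scales \<open>lam\<close> by \<open>chi\<close> of the inverse,
    so its reciprocal has the weight required by \<open>tw\<close>. The convention
    \<open>inverse 0 = 0\<close> makes the function vanish on \<open>kerlam\<close>; at x its value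
    is 1.\<close>
  define f where "f c = (if c \<in> C then inverse (lam c) else 0)" for c
  have "f (inv g \<otimes> u \<otimes> g) = chi g * f u" if g: "g \<in> carrier G" and u: "u \<in> carrier G" for g u
  proof (cases "u \<in> C")
    case True
    have "inverse (chi (inv g)) = chi g" using chi_inv[OF g] by (rule inverse_unique)
    then show ?thesis using True conj_in_C[OF g u] lam_conj[OF g True] by (simp add: f_def)
  qed (use conj_in_C[OF g u] in \<open>simp add: f_def\<close>)
  then have "f \<in> lam_ideal"
    by (auto simp: lam_ideal_def tw_iff fspace_def f_def intro: lam_invI)
  moreover have "f x \<noteq> 0" using chi_x by (simp add: f_def C_def)
  ultimately show ?thesis by auto
qed

lemma semisimple_not_solvable: "lie_semisimple tw_lie \<Longrightarrow> \<not> lie_solvable tw_lie lam_ideal"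
  using lam_ideal_ideal lam_ideal_nonzero unfolding lie_semisimple_def by (auto simp: tw_lie_def)

lemma fibre_card:
  assumes "d \<in> C" shows "card {c \<in> C. lam c = lam d} = card kerlam"
proof -
  have "bij_betw (\<lambda>c. d \<otimes> c) kerlam {c \<in> C. lam c = lam d}"
    by (rule bij_betw_byWitness[where f' = "\<lambda>c. inv d \<otimes> c"])
      (use assms C_sub in \<open>auto simp: kerlam_def C_mult C_inv lam_C_mult lam_C_inv subset_iff\<close>)
  then show ?thesis by (metis bij_betw_same_card)
qed

text \<open>Each fibre of \<open>lam\<close> on C is a coset of \<open>kerlam\<close> and
  contributes its cardinality, zero in the field, times a constant.\<close>

lemma sum_lam_inv:
  assumes "lam_inv \<Phi>" "of_nat (card kerlam) = (0::'k)" shows "(\<Sum>y\<in>C. \<Phi> y) = 0"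
proof -
  have "(\<Sum>y\<in>C. \<Phi> y) = (\<Sum>t\<in>lam ` C. \<Sum>y | y \<in> C \<and> lam y = t. \<Phi> y)"
    using sum.image_gen[OF C_fin] by blast
  also have "\<dots> = 0"
  proof (rule sum.neutral, rule ballI)
    fix t assume "t \<in> lam ` C"
    then obtain d where d: "d \<in> C" "t = lam d" by blast
    have "(\<Sum>y | y \<in> C \<and> lam y = t. \<Phi> y) = (\<Sum>y | y \<in> C \<and> lam y = t. \<Phi> d)"
      by (rule sum.cong[OF refl], rule lam_invD[OF assms(1)]) (use d in auto)
    then show "(\<Sum>y | y \<in> C \<and> lam y = t. \<Phi> y) = 0" using assms(2) fibre_card[OF d(1)] d by simp
  qed
  finally show ?thesis .
qed

text \<open>For two invariant functions the summand of the convolution is itself constant on cosets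
  of \<open>kerlam\<close>, so the sum vanishes. All products in the ideal are zero, and with them
  all brackets.\<close>

lemma solvable_if_card_kerlam:
  assumes "of_nat (card kerlam) = (0::'k)" shows "lie_solvable tw_lie lam_ideal"
proof (rule lie_solvable_chain[where F = "\<lambda>i. if i = 0 then lam_ideal else {0}" and N = 1])
  have *: "a \<star> b = 0" if a: "a \<in> fspace C" "lam_inv a" and b: "b \<in> fspace C" "lam_inv b" for a b
  proof
    fix z
    show "(a \<star> b) z = 0 z"
    proof (cases "z \<in> C")
      case True
      have "lam_inv (\<lambda>y. a y * b (inv y \<otimes> z))"
      proof (rule lam_invI)
        fix c d assume cd: "c \<in> C" "d \<in> C" "lam c = lam d"
        have "b (inv c \<otimes> z) = b (inv d \<otimes> z)"
          by (rule lam_invD[OF b(2)]) (use cd True in \<open>auto simp: C_mult C_inv lam_C_mult lam_C_inv\<close>)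
        then show "a c * b (inv c \<otimes> z) = a d * b (inv d \<otimes> z)" using lam_invD[OF a(2) cd] by simp
      qed
      moreover have "z \<in> carrier G" using True C_sub by blast
      ultimately show ?thesis
        using sum_lam_inv[OF _ assms] by (simp add: conv_apply_C[OF a(1)])
    qed (simp add: fspaceD[OF conv_fspace_C[OF a(1) b(1)]])
  qed
  have br: "tbr f h = 0" if "f \<in> lam_ideal" "h \<in> lam_ideal" for f h
  proof -
    have "f \<in> fspace C" "h \<in> fspace C" "lam_inv f" "lam_inv h" "lam_inv (lam * f)" "lam_inv (lam * h)"
      using that by (auto simp: lam_ideal_def tw_iff lam_inv_closed)
    then show ?thesis unfolding tbr_def by (simp add: *)
  qed
  show "lbracket tw_lie f h \<in> (if Suc i = 0 then lam_ideal else {0})"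
    if "f \<in> (if i = 0 then lam_ideal else {0})" "h \<in> (if i = 0 then lam_ideal else {0})" for i f h
    using br that lam_ideal_subspace by (auto simp: tw_lie_def lie_subspace_def split: if_splits)
  show "lie_subspace tw_lie (if i = 0 then lam_ideal else {0})" for i
    using lam_ideal_subspace by (auto simp: lie_subspace_def tw_lie_def tw_closed fun_eq_iff)
qed (auto simp: tw_lie_def)

text \<open>The bracket at c carries the weight \<open>lam\<close> (y^(-1) c) - \<open>lam\<close>
  y. If \<open>lam c = 0\<close> this is -2 \<open>lam\<close> y = 0, so brackets vanish on
  \<open>kerlam\<close>. If f and h vanish there, only y with both values of \<open>lam\<close>
  equal to 1 could contribute, and for these the weight is zero.\<close>

lemma solvable_if_char_2:
  assumes two: "(2::'k) = 0" and lam01: "lam ` C \<subseteq> {0, 1}"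
  shows "lie_solvable tw_lie lam_ideal"
proof -
  define F where "F = (\<lambda>i. if i = (0::nat) then lam_ideal
      else if i = 1 then {f \<in> lam_ideal. \<forall>c\<in>C. lam c = 0 \<longrightarrow> f c = 0} else {0})"
  have tb: "tbr f h z = (\<Sum>y\<in>C. (lam (inv y \<otimes> z) - lam y) * (f y * h (inv y \<otimes> z)))"
    if "f \<in> lam_ideal" "h \<in> lam_ideal" "z \<in> C" for f h z
  proof -
    have *: "f \<in> fspace C" "lam * f \<in> fspace C" "h \<in> tw" "z \<in> carrier G"
      using that C_sub by (auto simp: lam_ideal_def tw_iff)
    show ?thesis unfolding tbr_alt[OF *(1,3)] minus_apply conv_apply_C[OF *(1,4)] conv_apply_C[OF *(2,4)]
      by (simp add: algebra_simps flip: sum_subtractf)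
  qed
  have sub: "lie_subspace tw_lie (F i)" for i
    using lam_ideal_subspace by (auto simp: F_def lie_subspace_def tw_lie_def tw_closed fun_eq_iff)
  have neg: "- a = a" for a :: 'k
    using two by (metis add.inverse_unique mult_2 mult_zero_left)
  show ?thesis
  proof (rule lie_solvable_chain[where F = F and N = 2])
    fix i f h assume fh: "f \<in> F i" "h \<in> F i"
    consider "i = 0" | "i = 1" | "i > 1" by linarith
    then show "lbracket tw_lie f h \<in> F (Suc i)"
    proof cases
      case 1
      then have fh': "f \<in> lam_ideal" "h \<in> lam_ideal" using fh by (auto simp: F_def)
      have "tbr f h c = 0" if "c \<in> C" "lam c = 0" for c
        unfolding tb[OF fh' that(1)]
        by (rule sum.neutral) (use that in \<open>auto simp: lam_C_mult C_inv lam_C_inv neg\<close>)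
      moreover have "tbr f h \<in> lam_ideal"
        using lam_ideal_ideal fh' by (auto simp: lie_ideal_def tw_lie_def lam_ideal_def)
      ultimately show ?thesis using 1 by (simp add: F_def tw_lie_def)
    next
      case 2
      then have fh': "f \<in> lam_ideal" "h \<in> lam_ideal" 
        and z: "\<And>c. c \<in> C \<Longrightarrow> lam c = 0 \<Longrightarrow> f c = 0" "\<And>c. c \<in> C \<Longrightarrow> lam c = 0 \<Longrightarrow> h c = 0"
        using fh by (auto simp: F_def)
      have "tbr f h c = 0" if c: "c \<in> C" for c
        unfolding tb[OF fh' that(1)]
      proof (rule sum.neutral, rule ballI)
        fix y assume y: "y \<in> C"
        have yc: "inv y \<otimes> c \<in> C" using y c by (simp add: C_mult C_inv)
        have "lam y = 0 \<or> lam y = 1" "lam (inv y \<otimes> c) = 0 \<or> lam (inv y \<otimes> c) = 1"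
          using lam01 y yc by blast+
        then show "(lam (inv y \<otimes> c) - lam y) * (f y * h (inv y \<otimes> c)) = 0"
          using z(1)[OF y] z(2)[OF yc] by auto
      qed
      moreover have "tbr f h \<in> fspace C"
        using tbr_closed fh' by (auto simp: lam_ideal_def tw_iff)
      ultimately have "tbr f h = 0" by (metis (no_types, lifting) ext fspaceD zero_fun_apply)
      then show ?thesis using 2 by (simp add: F_def tw_lie_def)
    next
      case 3
      then show ?thesis using fh by (auto simp: F_def tw_lie_def tbr_def)
    qed
  qed (use sub in \<open>auto simp: F_def tw_lie_def\<close>)
qed

section \<open>Moments and the case of a nontrivial character\<close>

definition moment :: "nat \<Rightarrow> ('a \<Rightarrow> 'k) \<Rightarrow> 'k" where
  "moment j f = (\<Sum>c\<in>C. lam c ^ j * f c)"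

lemma moment_lam: "moment j (lam * f) = moment (Suc j) f"
  unfolding moment_def by (simp add: algebra_simps)

text \<open>As \<open>lam\<close> is additive on C, moments of a convolution follow the binomial
  theorem, as for sums of independent variables.\<close>

lemma moment_conv:
  assumes a: "a \<in> fspace C" and b: "b \<in> fspace C"
  shows "moment j (a \<star> b) = (\<Sum>l\<le>j. of_nat (j choose l) * (moment l a * moment (j - l) b))"
proof -
  have "moment j (a \<star> b) = (\<Sum>z\<in>C. \<Sum>y\<in>C. lam z ^ j * (a y * b (inv y \<otimes> z)))"
    unfolding moment_def using C_sub by (intro sum.cong) (auto simp: conv_apply_C[OF a] sum_distrib_left)
  also have "\<dots> = (\<Sum>y\<in>C. \<Sum>z\<in>C. lam z ^ j * (a y * b (inv y \<otimes> z)))" by (rule sum.swap)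
  also have "\<dots> = (\<Sum>y\<in>C. \<Sum>d\<in>C. (lam y + lam d) ^ j * (a y * b d))"
  proof (rule sum.cong[OF refl])
    fix y assume y: "y \<in> C"
    show "(\<Sum>z\<in>C. lam z ^ j * (a y * b (inv y \<otimes> z))) = (\<Sum>d\<in>C. (lam y + lam d) ^ j * (a y * b d))"
      by (rule sum.reindex_bij_witness[of _ "\<lambda>d. y \<otimes> d" "\<lambda>z. inv y \<otimes> z"])
        (use y C_sub in \<open>auto simp: C_mult C_inv lam_C_mult lam_C_inv subset_iff\<close>)
  qed
  also have "\<dots> = (\<Sum>y\<in>C. \<Sum>d\<in>C. \<Sum>l\<le>j. of_nat (j choose l) * ((lam y ^ l * a y) * (lam d ^ (j - l) * b d)))"
    by (simp add: binomial_ring sum_distrib_right sum_distrib_left mult_ac)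
  also have "\<dots> = (\<Sum>y\<in>C. \<Sum>l\<le>j. \<Sum>d\<in>C. of_nat (j choose l) * ((lam y ^ l * a y) * (lam d ^ (j - l) * b d)))"
    by (intro sum.cong refl) (rule sum.swap)
  also have "\<dots> = (\<Sum>l\<le>j. \<Sum>y\<in>C. \<Sum>d\<in>C. of_nat (j choose l) * ((lam y ^ l * a y) * (lam d ^ (j - l) * b d)))"
    by (rule sum.swap)
  also have "\<dots> = (\<Sum>l\<le>j. of_nat (j choose l) * (moment l a * moment (j - l) b))"
    unfolding moment_def sum_product by (simp add: sum_distrib_left)
  finally show ?thesis .
qed

lemma moment_linear:
  "moment j 0 = 0" "moment j (f + h) = moment j f + moment j h" "moment j (f - h) = moment j f - moment j h"
  "moment j (smul c f) = c * moment j f"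
  by (auto simp: moment_def algebra_simps sum.distrib sum_subtractf sum_distrib_left)

text \<open>Every product in the expansion pairs moments of f and h whose orders add up to j + 1, at
  most i + 2. For i > 0 one order is at most i. For i = 0 the only surviving product is that of the
  two first moments, which occurs in both sums and cancels.\<close>

lemma moment_tbr:
  assumes f: "f \<in> tw" and h: "h \<in> tw"
    and v: "\<And>j. j \<le> i \<Longrightarrow> moment j f = 0" "\<And>j. j \<le> i \<Longrightarrow> moment j h = 0" and j: "j \<le> Suc i"
  shows "moment j (tbr f h) = 0"
proof -
  have C: "f \<in> fspace C" "h \<in> fspace C" using f h by (auto simp: tw_iff)
  have eq: "moment j (tbr f h) = (\<Sum>l\<le>j. of_nat (j choose l) * (moment l f * moment (Suc (j - l)) h))
      - (\<Sum>l\<le>j. of_nat (j choose l) * (moment (Suc l) f * moment (j - l) h))"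
    unfolding tbr_alt[OF C(1) h] using C by (simp add: moment_linear moment_conv moment_lam)
  show ?thesis
  proof (cases "i = 0")
    case True
    then have "j = 0 \<or> j = 1" using j by linarith
    then show ?thesis using eq v[of 0] True by (auto simp: atMost_Suc)
  next
    case False
    have "moment l f * moment (Suc (j - l)) h = 0" "moment (Suc l) f * moment (j - l) h = 0" if "l \<le> j" for l
    proof -
      have "l \<le> i \<or> Suc (j - l) \<le> i" "Suc l \<le> i \<or> j - l \<le> i" using that j False by linarith+
      then show "moment l f * moment (Suc (j - l)) h = 0" "moment (Suc l) f * moment (j - l) h = 0"
        using v by auto
    qed
    then show ?thesis unfolding eq by (intro right_minus_eq[THEN iffD2] sum.cong) (simp_all del: mult_eq_0_iff)
  qed
qed

lemma lam_ideal_moments_zero: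
  assumes f: "f \<in> lam_ideal" and K: "of_nat (card kerlam) \<noteq> (0::'k)"
    and v: "\<And>j. j \<le> card (lam ` C) \<Longrightarrow> moment j f = 0"
  shows "f = 0"
proof -
  have "f d = 0" if d: "d \<in> C" for d
  proof -
    define V where "V = lam ` C - {lam d}"
    have V: "finite V" unfolding V_def using C_fin by simp
    \<comment> \<open>Lagrange interpolation: q vanishes at all values of \<open>lam\<close> on C
      except \<open>lam d\<close>. Expanding q turns the sum of q(\<open>lam\<close> c) f(c) into a
      combination of moments, while only the fibre of d contributes to it.\<close>
    define q where "q = (\<Prod>s\<in>V. [:- s, 1:])"
    have "degree q \<le> card V" unfolding q_def by (rule order_trans[OF degree_prod_sum_le[OF V]]) simp
    also have "\<dots> \<le> card (lam ` C)" unfolding V_def using C_fin by (intro card_mono) auto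
    finally have dq: "degree q \<le> card (lam ` C)" .
    have "0 = (\<Sum>j\<le>degree q. coeff q j * moment j f)" using v dq by simp
    also have "\<dots> = (\<Sum>c\<in>C. poly q (lam c) * f c)"
      unfolding moment_def poly_altdef sum_distrib_left sum_distrib_right
      by (subst sum.swap) (simp add: mult_ac)
    also have "\<dots> = (\<Sum>c | c \<in> C \<and> lam c = lam d. poly q (lam c) * f c)"
    proof (rule sum.mono_neutral_right[OF C_fin])
      show "\<forall>c\<in>C - {c \<in> C. lam c = lam d}. poly q (lam c) * f c = 0"
        using V by (auto simp: q_def poly_prod V_def)
    qed auto
    also have "\<dots> = (\<Sum>c | c \<in> C \<and> lam c = lam d. poly q (lam d) * f d)"
    proof (rule sum.cong[OF refl])
      fix c assume "c \<in> {c. c \<in> C \<and> lam c = lam d}"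
      then show "poly q (lam c) * f c = poly q (lam d) * f d"
        using f d lam_invD[of f c d] by (simp add: lam_ideal_def)
    qed
    also have "\<dots> = of_nat (card kerlam) * (poly q (lam d) * f d)" by (simp add: fibre_card[OF d])
    finally have "poly q (lam d) * f d = 0" using K by simp
    moreover have "poly q (lam d) \<noteq> 0" using V by (auto simp: q_def poly_prod V_def)
    ultimately show ?thesis by simp
  qed
  moreover have "f \<in> fspace C" using f by (simp add: lam_ideal_def tw_iff)
  ultimately show ?thesis by (metis (no_types, lifting) ext fspaceD zero_fun_apply)
qed

text \<open>The filtration needs a start. Conjugation by g permutes C and scales f by
  \<open>chi g\<close>, which differs from 1, so the sum of f over C is zero: the moment of order 0
  vanishes on the whole ideal.\<close>

lemma solvable_if_chi_nontrivial:
  assumes g: "g \<in> carrier G" "chi g \<noteq> 1" and K: "of_nat (card kerlam) \<noteq> (0::'k)"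
  shows "lie_solvable tw_lie lam_ideal"
proof -
  define F where "F i = {f \<in> lam_ideal. \<forall>j\<le>i. moment j f = 0}" for i
  have "moment 0 f = 0" if f: "f \<in> lam_ideal" for f
  proof -
    have "(\<Sum>c\<in>C. f (inv g \<otimes> c \<otimes> g)) = (\<Sum>c\<in>C. f c)"
      by (rule sum.reindex_bij_witness[of _ "\<lambda>y. g \<otimes> y \<otimes> inv g" "\<lambda>y. inv g \<otimes> y \<otimes> g"])
       (use g(1) C_sub conj_in_C[OF g(1)] conj_in_C[OF inv_closed[OF g(1)]] in \<open>auto simp: m_assoc subset_iff\<close>)
    moreover have "(\<Sum>c\<in>C. f (inv g \<otimes> c \<otimes> g)) = chi g * (\<Sum>c\<in>C. f c)"
      using f g(1) C_sub by (auto simp: lam_ideal_def tw_iff sum_distrib_left intro!: sum.cong)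
    ultimately show ?thesis using g(2) by (simp add: moment_def)
  qed
  then have F0: "lam_ideal = F 0" unfolding F_def by auto
  show ?thesis
  proof (rule lie_solvable_chain[where F = F and N = "card (lam ` C)"])
    show "lie_subspace tw_lie (F i)" for i
      using lam_ideal_subspace by (auto simp: F_def lie_subspace_def tw_lie_def moment_linear)
    show "F (card (lam ` C)) \<subseteq> {lzero tw_lie}"
      using lam_ideal_moments_zero[OF _ K] by (auto simp: F_def tw_lie_def)
    fix i f h assume fh: "f \<in> F i" "h \<in> F i"
    then have "f \<in> tw" "h \<in> tw" by (auto simp: F_def lam_ideal_def)
    moreover from this have "tbr f h \<in> lam_ideal"
      using lam_ideal_ideal fh by (auto simp: lie_ideal_def tw_lie_def F_def)
    ultimately show "lbracket tw_lie f h \<in> F (Suc i)"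
      using moment_tbr[of f h i] fh by (auto simp: F_def tw_lie_def)
  qed (rule F0)
qed

lemma semisimple_imp:
  assumes "lie_semisimple tw_lie"
  shows "of_nat (card kerlam) \<noteq> (0::'k)" "\<And>g. g \<in> carrier G \<Longrightarrow> chi g = 1"
    "(2::'k) = 0 \<Longrightarrow> \<not> lam ` C \<subseteq> {0, 1}"
  using semisimple_not_solvable[OF assms] solvable_if_card_kerlam solvable_if_chi_nontrivial
    solvable_if_char_2 by blast+

end

section \<open>Normal cyclic Sylow subgroups\<close>

locale cyclic_sylow = finite_group G for G (structure) +
  fixes P :: "'a set" and x :: 'a and p a q :: nat and kt :: "'k::field itself"
  assumes p_char: "p = CHAR('k)" and p_prime: "Factorial_Ring.prime p"
    and P_normal: "P \<lhd> G" and P_gen: "P = {x [^] (i::nat) |i. True}" and x_in: "x \<in> carrier G"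
    and P_card: "card P = p ^ a" and a_pos: "a > 0"
    and q_eq: "card (rcosets P) = q" and q_coprime: "\<not> p dvd q"
begin

lemma P_subgroup: "subgroup P G" using P_normal normal_imp_subgroup by blast

lemma P_sub: "P \<subseteq> carrier G" using P_subgroup by (rule subgroup.subset)

lemma P_closed:
  "y \<in> P \<Longrightarrow> y \<in> carrier G" "y \<in> P \<Longrightarrow> z \<in> P \<Longrightarrow> y \<otimes> z \<in> P" "y \<in> P \<Longrightarrow> inv y \<in> P" "\<one> \<in> P"
  using P_sub P_subgroup by (auto simp: subgroup.m_closed subgroup.m_inv_closed subgroup.one_closed)

lemma P_conj: "g \<in> carrier G \<Longrightarrow> y \<in> P \<Longrightarrow> g \<otimes> y \<otimes> inv g \<in> P"
  using P_normal by (simp add: normal.inv_op_closed2)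

lemma ord_x: "ord x = p ^ a"
  using generate_pow_card[OF x_in] generate_pow_on_finite_carrier[OF fin x_in] P_gen P_card by simp

lemma pow_x_eq_iff: "x [^] (i::nat) = x [^] j \<longleftrightarrow> int (p ^ a) dvd (int j - int i)"
  using int_pow_eq[OF x_in, of "int i" "int j"] ord_x by (simp add: int_pow_int)

lemma of_nat_eq_iff: "(of_nat i :: 'k) = of_nat j \<longleftrightarrow> int p dvd (int j - int i)"
proof (induction i j rule: linorder_wlog)
  case (le i j)
  have "(of_nat i :: 'k) = of_nat j \<longleftrightarrow> p dvd (j - i)"
    using of_nat_eq_iff_char_dvd[of i j] le p_char by (cases "i = j") auto
  also have "\<dots> \<longleftrightarrow> int p dvd (int j - int i)"
    using le by (metis of_nat_diff int_dvd_int_iff)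
  finally show ?case .
qed (metis dvd_minus_iff minus_diff_eq)

text \<open>Exponents of x are determined modulo p^a, and a > 0; their residues in the field are
  therefore well defined. Hence the choices in \<open>chi\<close> and \<open>l0\<close> do not
  matter.\<close>

lemma of_nat_cong: "x [^] (i::nat) = x [^] j \<Longrightarrow> (of_nat i :: 'k) = of_nat j"
  using a_pos dvd_trans[of "int p" "int (p ^ a)"] unfolding pow_x_eq_iff of_nat_eq_iff by (simp add: dvd_power)

lemma of_nat_q: "of_nat q \<noteq> (0::'k)"
  using q_coprime p_char by (simp add: of_nat_eq_0_iff_char_dvd)

definition chi :: "'a \<Rightarrow> 'k" where
  "chi g = of_nat (SOME m. g \<otimes> x \<otimes> inv g = x [^] (m::nat))"

lemma chi_eq: "g \<otimes> x \<otimes> inv g = x [^] (m::nat) \<Longrightarrow> chi g = of_nat m"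
  unfolding chi_def by (rule of_nat_cong) (metis (mono_tags, lifting) someI)

lemma chi_ex:
  assumes "g \<in> carrier G"
  obtains m :: nat where "g \<otimes> x \<otimes> inv g = x [^] m" "chi g = of_nat m"
proof -
  have "x \<in> P" unfolding P_gen using x_in by (auto intro: exI[of _ "1::nat"])
  then have "g \<otimes> x \<otimes> inv g \<in> P" using P_conj[OF assms] by blast
  then show ?thesis using that chi_eq unfolding P_gen by blast
qed

lemma conj_pow: "g \<in> carrier G \<Longrightarrow> y \<in> carrier G \<Longrightarrow> (g \<otimes> y \<otimes> inv g) [^] (n::nat) = g \<otimes> y [^] n \<otimes> inv g"
  by (induction n) (simp_all add: m_assoc)

lemma chi_mult:
  assumes g: "g \<in> carrier G" and h: "h \<in> carrier G" shows "chi (g \<otimes> h) = chi g * chi h"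
proof -
  obtain m where m: "g \<otimes> x \<otimes> inv g = x [^] (m::nat)" "chi g = of_nat m" using chi_ex[OF g] .
  obtain n where n: "h \<otimes> x \<otimes> inv h = x [^] (n::nat)" "chi h = of_nat n" using chi_ex[OF h] .
  have "(g \<otimes> h) \<otimes> x \<otimes> inv (g \<otimes> h) = g \<otimes> (h \<otimes> x \<otimes> inv h) \<otimes> inv g"
    using g h x_in by (simp add: m_assoc inv_mult_group)
  also have "\<dots> = x [^] (m * n)"
    using conj_pow[OF g x_in, of n] x_in by (simp add: n(1) m(1) nat_pow_pow)
  finally show ?thesis using chi_eq m n by simp
qed

lemma chi_one: "chi \<one> = 1" using chi_eq[of \<one> 1] x_in by simp

lemma P_comm: "y \<in> P \<Longrightarrow> y \<otimes> x = x \<otimes> y"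
  unfolding P_gen using nat_pow_Suc2[OF x_in] nat_pow_Suc[of x] by fastforce

lemma chi_P: "y \<in> P \<Longrightarrow> chi y = 1"
  using chi_eq[of y 1] x_in P_closed(1)[of y] P_comm[of y] by (simp add: m_assoc)

lemma pow_q: "g \<in> carrier G \<Longrightarrow> g [^] q \<in> P"
proof -
  assume g: "g \<in> carrier G"
  interpret N: normal P G by (rule P_normal)
  interpret Q: group "G Mod P" by (rule N.factorgroup_is_group)
  have "(P #> g) [^]\<^bsub>G Mod P\<^esub> Coset.order (G Mod P) = \<one>\<^bsub>G Mod P\<^esub>"
    using g by (intro Q.pow_order_eq_1) (auto simp: carrier_FactGroup)
  moreover have "Coset.order (G Mod P) = q" by (simp add: Coset.order_def FactGroup_def q_eq)
  ultimately have "P #> (g [^] q) = P" using N.FactGroup_pow[OF g, of q] by simp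
  then show ?thesis using rcos_self[of "g [^] q" P] g P_subgroup by auto
qed

lemma conj_pow_iter:
  assumes g: "g \<in> carrier G" and m: "g \<otimes> x \<otimes> inv g = x [^] (m::nat)"
  shows "g [^] (n::nat) \<otimes> x \<otimes> inv (g [^] n) = x [^] (m ^ n)"
proof (induction n)
  case (Suc n)
  have "g [^] Suc n \<otimes> x \<otimes> inv (g [^] Suc n) = g [^] n \<otimes> (g \<otimes> x \<otimes> inv g) \<otimes> inv (g [^] n)"
    using g x_in by (simp add: m_assoc inv_mult_group)
  also have "\<dots> = (g [^] n \<otimes> x \<otimes> inv (g [^] n)) [^] m" using conj_pow[of "g [^] n" x m] g x_in by (simp add: m)
  also have "\<dots> = x [^] (m ^ Suc n)" using Suc x_in by (simp add: nat_pow_pow mult.commute)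
  finally show ?case .
qed (use x_in in simp)

text \<open>The conjugation action has order prime to \<open>p\<close>, so it is trivial as soon as it is trivial
  modulo \<open>p\<close>: \<open>m ^ q - 1\<close> is \<open>m - 1\<close> times a factor congruent to \<open>q\<close>.\<close>
lemma chi_comm:
  assumes c: "c \<in> carrier G" and c1: "chi c = 1" shows "c \<otimes> x = x \<otimes> c"
proof -
  obtain m where m: "c \<otimes> x \<otimes> inv c = x [^] (m::nat)" "chi c = of_nat m" using chi_ex[OF c] .
  have m1: "int p dvd int m - 1" using of_nat_eq_iff[of 1 m] m(2) c1 by simp
  have "c [^] q \<otimes> x \<otimes> inv (c [^] q) = x" using P_comm[OF pow_q[OF c]] c x_in by (simp add: m_assoc)
  then have "x [^] (1::nat) = x [^] (m ^ q)" using conj_pow_iter[OF c m(1), of q] x_in by simp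
  then have "int (p ^ a) dvd int m ^ q - 1" unfolding pow_x_eq_iff by simp
  then have d: "int (p ^ a) dvd (int m - 1) * (\<Sum>i<q. int m ^ i)"
    by (simp add: power_diff_1_eq)
  have "(\<Sum>i<q. int m ^ i) - int q = (\<Sum>i<q. int m ^ i - 1)" by (simp add: sum_subtractf)
  moreover have "int p dvd int m ^ i - 1" for i using m1 power_diff_1_eq[of "int m" i] by simp
  ultimately have "int p dvd (\<Sum>i<q. int m ^ i) - int q" by (simp add: dvd_sum)
  then have "\<not> int p dvd (\<Sum>i<q. int m ^ i)"
    using q_coprime dvd_diff[of "int p" "\<Sum>i<q. int m ^ i" "(\<Sum>i<q. int m ^ i) - int q"] by auto
  then have "coprime (int (p ^ a)) (\<Sum>i<q. int m ^ i)"
    using p_prime by (simp add: prime_imp_coprime)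
  then have "int (p ^ a) dvd int m - 1" using d by (simp add: coprime_dvd_mult_left_iff)
  then have "x [^] m = x" using pow_x_eq_iff[of 1 m] x_in by simp
  then have "c \<otimes> x \<otimes> inv c \<otimes> c = x \<otimes> c" using m(1) by simp
  then show ?thesis using c x_in by (simp add: m_assoc)
qed

text \<open>If u acts by the exponent m and commutes with y = x^j, then p^a divides (m - 1) j. As m
  - 1 is prime to p, already p^a divides j.\<close>

lemma chi_free:
  assumes u: "u \<in> carrier G" "chi u \<noteq> 1" and y: "y \<in> P" "y \<otimes> u = u \<otimes> y" shows "y = \<one>"
proof -
  obtain m where m: "u \<otimes> x \<otimes> inv u = x [^] (m::nat)" "chi u = of_nat m" using chi_ex[OF u(1)] .
  have m1: "\<not> int p dvd int m - 1" using of_nat_eq_iff[of 1 m] m(2) u(2) by auto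
  obtain j where j: "y = x [^] (j::nat)" using y(1) P_gen by blast
  have "x [^] (m * j) = u \<otimes> y \<otimes> inv u"
    using conj_pow[OF u(1) x_in, of j] x_in by (simp add: m(1) j nat_pow_pow)
  also have "\<dots> = y" using y(2)[symmetric] u(1) P_closed(1)[OF y(1)] by (simp add: m_assoc)
  also have "\<dots> = x [^] j" by (rule j)
  finally have "int (p ^ a) dvd int j - int (m * j)" unfolding pow_x_eq_iff .
  then have "int (p ^ a) dvd (int m - 1) * int j"
    by (simp add: algebra_simps dvd_diff_commute)
  moreover have "coprime (int (p ^ a)) (int m - 1)" using m1 p_prime by (simp add: prime_imp_coprime)
  ultimately have "int (p ^ a) dvd int j" by (simp add: coprime_dvd_mult_right_iff)
  then have "p ^ a dvd j" by (simp only: int_dvd_int_iff)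
  then show ?thesis using pow_eq_id[OF x_in, of j] j ord_x by simp
qed

text \<open>The choice is made from a predicate that depends on the coset g P only, so equal cosets
  get the same representative.\<close>

definition rep :: "'a \<Rightarrow> 'a" where "rep g = (SOME h. \<exists>y\<in>P. h = g \<otimes> y)"
definition T :: "'a set" where "T = rep ` carrier G"

lemma rep_ex: obtains y where "y \<in> P" "rep g = g \<otimes> y"
proof -
  have "\<exists>h. \<exists>y\<in>P. h = g \<otimes> y" using P_closed(4) by blast
  from someI_ex[OF this] show ?thesis using that unfolding rep_def by blast
qed

lemma rep_in: "g \<in> carrier G \<Longrightarrow> rep g \<in> carrier G"
  by (rule rep_ex[of g]) (simp add: P_closed)

lemma rep_mult:
  assumes g: "g \<in> carrier G" and y: "y \<in> P" shows "rep (g \<otimes> y) = rep g"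
proof -
  have "(\<exists>z\<in>P. h = g \<otimes> y \<otimes> z) \<longleftrightarrow> (\<exists>z\<in>P. h = g \<otimes> z)" for h
  proof
    assume "\<exists>z\<in>P. h = g \<otimes> y \<otimes> z"
    then obtain z where "z \<in> P" "h = g \<otimes> y \<otimes> z" by blast
    then show "\<exists>z\<in>P. h = g \<otimes> z" using g y P_closed by (intro bexI[of _ "y \<otimes> z"]) (auto simp: m_assoc)
  next
    assume "\<exists>z\<in>P. h = g \<otimes> z"
    then obtain z where "z \<in> P" "h = g \<otimes> z" by blast
    then show "\<exists>z\<in>P. h = g \<otimes> y \<otimes> z" using g y P_closed by (intro bexI[of _ "inv y \<otimes> z"]) (auto simp: m_assoc)
  qed
  then show ?thesis by (simp add: rep_def)
qed

lemma rep_rep: "g \<in> carrier G \<Longrightarrow> rep (rep g) = rep g"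
  by (rule rep_ex[of g]) (simp add: rep_mult)

lemma T_sub: "T \<subseteq> carrier G" unfolding T_def using rep_in by blast

text \<open>Left multiplication by h permutes the cosets g P, so sending t to
  \<open>rep (h t)\<close> is a bijection of \<open>T\<close>; passing to \<open>rep\<close> does
  not change the invariant function F.\<close>

lemma T_shift:
  fixes F :: "'a \<Rightarrow> 'k"
  assumes h: "h \<in> carrier G" and F: "\<And>g y. g \<in> carrier G \<Longrightarrow> y \<in> P \<Longrightarrow> F (g \<otimes> y) = F g"
  shows "(\<Sum>t\<in>T. F (h \<otimes> t)) = (\<Sum>t\<in>T. F t)"
proof -
  have F_rep: "F (rep g) = F g" if "g \<in> carrier G" for g using that by (rule_tac rep_ex[of g]) (simp add: F)
  have aux: "rep (h' \<otimes> rep g) = rep (h' \<otimes> g)" if "g \<in> carrier G" "h' \<in> carrier G" for g h'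
    using that by (rule_tac rep_ex[of g]) (simp add: P_closed rep_mult flip: m_assoc)
  have fix_T: "rep t = t" if "t \<in> T" for t using that rep_rep unfolding T_def by auto
  have in_T: "rep g \<in> T" if "g \<in> carrier G" for g unfolding T_def using that by (rule imageI)
  show ?thesis
  proof (rule sum.reindex_bij_witness[of _ "\<lambda>t. rep (inv h \<otimes> t)" "\<lambda>t. rep (h \<otimes> t)"])
    fix t assume t: "t \<in> T"
    then have tG: "t \<in> carrier G" using T_sub by blast
    show "rep (inv h \<otimes> rep (h \<otimes> t)) = t" using aux[of "h \<otimes> t" "inv h"] h tG fix_T[OF t] by simp
    show "rep (h \<otimes> rep (inv h \<otimes> t)) = t" using aux[of "inv h \<otimes> t" h] h tG fix_T[OF t] by simp
    show "rep (h \<otimes> t) \<in> T" "rep (inv h \<otimes> t) \<in> T" using h tG in_T by simp_all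
    show "F (rep (h \<otimes> t)) = F (h \<otimes> t)" using h tG F_rep by simp
  qed
qed

lemma T_card: "of_nat (card T) \<noteq> (0::'k)"
proof -
  have fix_T: "rep t = t" if "t \<in> T" for t using that rep_rep unfolding T_def by auto
  have "inj_on (\<lambda>(t, y). t \<otimes> y) (T \<times> P)"
  proof (rule inj_onI, clarify)
    fix t y t' y' assume A: "t \<in> T" "y \<in> P" "t' \<in> T" "y' \<in> P" "t \<otimes> y = t' \<otimes> y'"
    then have G: "t \<in> carrier G" "t' \<in> carrier G" using T_sub by auto
    have "t = rep (t \<otimes> y)" "t' = rep (t' \<otimes> y')" using A(1-4) fix_T rep_mult G by simp_all
    then have "t = t'" using A by simp
    then show "t = t' \<and> y = y'" using A G P_closed(1) by simp
  qed
  moreover have "(\<lambda>(t, y). t \<otimes> y) ` (T \<times> P) = carrier G"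
  proof (intro equalityI subsetI)
    fix g assume g: "g \<in> carrier G"
    obtain y where "y \<in> P" "rep g = g \<otimes> y" by (rule rep_ex)
    then have "g = rep g \<otimes> inv y" using g P_closed by (simp add: m_assoc)
    then show "g \<in> (\<lambda>(t, y). t \<otimes> y) ` (T \<times> P)"
      using g \<open>y \<in> P\<close> P_closed(3) by (auto simp: T_def intro!: image_eqI[of _ _ "(rep g, inv y)"])
  qed (use T_sub P_sub in auto)
  ultimately have "card (T \<times> P) = Coset.order G" unfolding Coset.order_def by (metis card_image)
  then have "card T * card P = q * card P"
    using lagrange[OF P_subgroup] q_eq by (simp add: card_cartesian_product)
  then have "card T = q" using P_card p_prime by (simp add: prime_gt_0_nat)
  then show ?thesis using of_nat_q by simp
qed

text \<open>\<open>mu\<close> extends the logarithm \<open>l0\<close> of \<open>P\<close> to \<open>G\<close>; averaging its coboundary over \<open>T\<close> gives a cocycle.\<close>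
definition l0 :: "'a \<Rightarrow> 'k" where "l0 y = of_nat (SOME i. y = x [^] (i::nat))"
definition mu :: "'a \<Rightarrow> 'k" where "mu g = chi g * l0 (inv (rep g) \<otimes> g)"
definition lam :: "'a \<Rightarrow> 'k" where "lam g = (\<Sum>t\<in>T. mu (g \<otimes> t) - chi g * mu t) / of_nat (card T)"

lemma l0_pow: "l0 (x [^] (i::nat)) = of_nat i"
  unfolding l0_def by (rule of_nat_cong) (metis (mono_tags, lifting) someI)

lemma l0_mult: "y \<in> P \<Longrightarrow> z \<in> P \<Longrightarrow> l0 (y \<otimes> z) = l0 y + l0 z"
  unfolding P_gen using x_in by (auto simp: nat_pow_mult l0_pow)

lemma mu_mult:
  assumes "g \<in> carrier G" "y \<in> P" shows "mu (g \<otimes> y) = mu g + chi g * l0 y"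
proof -
  obtain z where z: "z \<in> P" "rep g = g \<otimes> z" by (rule rep_ex)
  have "inv (rep g) \<otimes> g = inv z" using assms z P_closed by (simp add: inv_mult_group m_assoc)
  moreover have "inv (rep (g \<otimes> y)) \<otimes> (g \<otimes> y) = inv z \<otimes> y"
    using assms z P_closed by (simp add: rep_mult inv_mult_group m_assoc)
  ultimately show ?thesis
    using assms z P_closed chi_mult[of g y] by (simp add: mu_def l0_mult chi_P distrib_left)
qed

text \<open>For fixed g the function s \<mapsto> \<open>mu (g s) - chi g * mu s\<close> is constant
  on cosets s P: both terms change by the same multiple of \<open>l0\<close>. So
  \<open>T_shift\<close> removes h from the average, and the remainder is the cocycle
  identity.\<close>

lemma lam_mult:
  assumes g: "g \<in> carrier G" and h: "h \<in> carrier G" shows "lam (g \<otimes> h) = lam g + chi g * lam h"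
proof -
  have "(\<Sum>t\<in>T. mu (g \<otimes> h \<otimes> t) - chi (g \<otimes> h) * mu t)
    = (\<Sum>t\<in>T. (mu (g \<otimes> (h \<otimes> t)) - chi g * mu (h \<otimes> t)) + chi g * (mu (h \<otimes> t) - chi h * mu t))"
    using g h T_sub by (intro sum.cong refl) (auto simp: m_assoc chi_mult algebra_simps subset_iff)
  also have "\<dots> = (\<Sum>t\<in>T. mu (g \<otimes> (h \<otimes> t)) - chi g * mu (h \<otimes> t)) + chi g * (\<Sum>t\<in>T. mu (h \<otimes> t) - chi h * mu t)"
    by (simp only: sum.distrib sum_distrib_left)
  also have "(\<Sum>t\<in>T. mu (g \<otimes> (h \<otimes> t)) - chi g * mu (h \<otimes> t)) = (\<Sum>t\<in>T. mu (g \<otimes> t) - chi g * mu t)"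
  proof (rule T_shift[OF h, of "\<lambda>s. mu (g \<otimes> s) - chi g * mu s"])
    fix s y assume "s \<in> carrier G" "y \<in> P"
    then show "mu (g \<otimes> (s \<otimes> y)) - chi g * mu (s \<otimes> y) = mu (g \<otimes> s) - chi g * mu s"
      using g mu_mult[of "g \<otimes> s" y] P_closed by (simp add: mu_mult m_assoc chi_mult algebra_simps)
  qed
  finally show ?thesis by (simp add: lam_def add_divide_distrib)
qed

text \<open>Each summand equals 1: x t = t x^m, where m represents \<open>chi\<close> of the inverse
  of t, and \<open>mu\<close> therefore grows by \<open>chi t\<close> times m.\<close>

lemma lam_x: "lam x = 1"
proof -
  have x1: "chi x = 1" using chi_eq[of x 1] x_in by (simp add: m_assoc)
  have "mu (x \<otimes> t) - chi x * mu t = 1" if "t \<in> T" for t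
  proof -
    have t: "t \<in> carrier G" using that T_sub by blast
    obtain m where m: "inv t \<otimes> x \<otimes> inv (inv t) = x [^] (m::nat)" "chi (inv t) = of_nat m"
      using chi_ex[of "inv t"] t by blast
    have "x \<otimes> t = t \<otimes> x [^] m" using t x_in by (simp flip: m(1) add: m_assoc)
    moreover have "x [^] m \<in> P" unfolding P_gen by blast
    ultimately have "mu (x \<otimes> t) = mu t + chi t * of_nat m" using mu_mult[OF t] l0_pow by simp
    moreover have "chi t * of_nat m = 1" using chi_mult[of t "inv t"] t chi_one m(2) by simp
    ultimately show ?thesis using x1 by simp
  qed
  then show ?thesis using T_card by (simp add: lam_def)
qed

lemma twisted: "twisted_group G chi lam x P T"
proof
  show "\<exists>m::nat. g \<otimes> x \<otimes> inv g = x [^] m \<and> chi g = of_nat m" if "g \<in> carrier G" for g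
    using chi_ex[OF that] by metis
qed (use x_in P_gen P_closed chi_mult chi_one lam_mult lam_x chi_comm chi_free T_sub T_card T_shift in auto)

sublocale tw: twisted_group G chi lam x P T by (rule twisted)

end

lemma (in group) pow_card_subgroup:
  assumes "subgroup H G" "h \<in> H" shows "h [^] card H = \<one>"
proof -
  interpret H: group "G\<lparr>carrier := H\<rparr>" using assms(1) by (rule subgroup_imp_group)
  show ?thesis using H.pow_order_eq_1[of h] assms(2) nat_pow_consistent[of h "card H" H]
    by (simp add: Coset.order_def)
qed

lemma (in finite_group) order_internal_direct_product:
  assumes "internal_direct_product G K D" shows "Coset.order G = card K * card D"
proof -
  have K: "subgroup K G" and D: "subgroup D G" and int: "K \<inter> D = {\<one>}" and prod: "K <#> D = carrier G"
    using assms normal_imp_subgroup unfolding internal_direct_product_def by auto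
  have KG: "k \<in> carrier G" if "k \<in> K" for k using that K subgroup.subset by blast
  have DG: "d \<in> carrier G" if "d \<in> D" for d using that D subgroup.subset by blast
  have "inj_on (\<lambda>(k, d). k \<otimes> d) (K \<times> D)"
  proof (rule inj_onI, clarify)
    fix k d k' d' assume A: "k \<in> K" "d \<in> D" "k' \<in> K" "d' \<in> D" "k \<otimes> d = k' \<otimes> d'"
    have "inv k' \<otimes> (k \<otimes> d) \<otimes> inv d = inv k' \<otimes> (k' \<otimes> d') \<otimes> inv d" using A by simp
    then have e: "inv k' \<otimes> k = d' \<otimes> inv d" using A(1-4) KG DG by (simp add: m_assoc)
    have "inv k' \<otimes> k \<in> K" using A K by (simp add: subgroup.m_closed subgroup.m_inv_closed)
    moreover have "d' \<otimes> inv d \<in> D" using A D by (simp add: subgroup.m_closed subgroup.m_inv_closed)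
    ultimately have "inv k' \<otimes> k = \<one>" "d' \<otimes> inv d = \<one>" using e int by auto
    then show "k = k' \<and> d = d'"
      using A KG DG by (metis inv_closed inv_equality inv_inv)
  qed
  moreover have "(\<lambda>(k, d). k \<otimes> d) ` (K \<times> D) = carrier G"
    unfolding prod[symmetric] set_mult_def by auto
  ultimately show ?thesis unfolding Coset.order_def by (metis card_image card_cartesian_product)
qed

section \<open>Splitting of the group\<close>

context cyclic_sylow
begin

lemma lam_pow: "c \<in> tw.C \<Longrightarrow> lam (c [^] (n::nat)) = of_nat n * lam c \<and> c [^] n \<in> tw.C"
proof (induction n)
  case (Suc n)
  then show ?case using tw.lam_C_mult[of "c [^] n" c] tw.C_mult by (simp add: algebra_simps)
qed (use tw.C_one in simp)

lemma lam_pow_x: "lam (x [^] (i::nat)) = of_nat i"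
  using lam_pow[of x i] tw.chi_x x_in lam_x by (simp add: tw.C_def)

lemma of_nat_p: "of_nat p = (0::'k)" by (simp add: p_char)

text \<open>The q-th power of c lies in P, so q times \<open>lam c\<close> is the residue of an
  integer; a Bezout relation for q and p inverts q within the prime field.\<close>

lemma lam_in_prime_field:
  assumes c: "c \<in> tw.C" shows "\<exists>i<p. lam c = of_nat i"
proof -
  have cG: "c \<in> carrier G" using c tw.C_sub by blast
  obtain j where j: "c [^] q = x [^] (j::nat)" using pow_q[OF cG] P_gen by blast
  have qj: "of_nat q * lam c = of_nat j" using lam_pow[OF c, of q] lam_pow_x[of j] j by simp
  have "coprime (int q) (int p)" using q_coprime p_prime by (simp add: prime_imp_coprime coprime_commute)
  then obtain u v where uv: "u * int q + v * int p = 1" using bezout_int[of "int q" "int p"] by auto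
  have "lam c = of_int (u * int q + v * int p) * lam c" by (simp add: uv)
  also have "\<dots> = of_int u * (of_nat q * lam c)" using of_nat_p by (simp only: of_int_add of_int_mult of_int_of_nat_eq mult_zero_right add_0_right mult.assoc)
  also have "\<dots> = of_int (u * int j)" unfolding qj by (simp only: of_int_mult of_int_of_nat_eq)
  also have "\<dots> = of_int ((u * int j) div int p * int p + (u * int j) mod int p)" by (simp only: div_mult_mod_eq)
  also have "\<dots> = of_int ((u * int j) mod int p)" using of_nat_p by (simp only: of_int_add of_int_mult of_int_of_nat_eq mult_zero_right add_0_left)
  also have "\<dots> = of_nat (nat ((u * int j) mod int p))"
    by (rule of_nat_nat[symmetric]) (use p_prime in \<open>simp add: prime_gt_0_nat\<close>)
  finally show ?thesis using p_prime
    by (intro exI[of _ "nat ((u * int j) mod int p)"]) (simp add: prime_gt_0_nat nat_less_iff)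
qed

lemma of_nat_eq_0: "of_nat n = (0::'k) \<longleftrightarrow> p dvd n"
  by (simp add: p_char of_nat_eq_0_iff_char_dvd)

lemma kerlam_normal:
  assumes chi1: "\<And>g. g \<in> carrier G \<Longrightarrow> chi g = 1" shows "tw.kerlam \<lhd> G"
proof -
  have C: "tw.C = carrier G" using chi1 by (auto simp: tw.C_def)
  have "subgroup tw.kerlam G"
    by (rule subgroupI) (use tw.C_one tw.lam_one C tw.C_mult tw.C_inv tw.lam_C_mult tw.lam_C_inv in
        \<open>auto simp: tw.kerlam_def\<close>)
  moreover have "g \<otimes> h \<otimes> inv g \<in> tw.kerlam" if "g \<in> carrier G" "h \<in> tw.kerlam" for g h
    using tw.lam_conj[of "inv g" h] that C by (simp add: tw.kerlam_def)
  ultimately show ?thesis by (simp add: normal_inv_iff)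
qed

lemma direct_product_of_semisimple:
  assumes ss: "lie_semisimple tw.tw_lie"
  shows "internal_direct_product G tw.kerlam P" "card tw.kerlam = q" "card P = p" "p \<noteq> 2"
proof -
  note imp = tw.semisimple_imp[OF ss]
  have C: "tw.C = carrier G" using imp(2) by (auto simp: tw.C_def)
  have K: "tw.kerlam \<lhd> G" by (rule kerlam_normal[OF imp(2)])
  have p0: "p > 0" using p_prime by (simp add: prime_gt_0_nat)
  \<comment> \<open>Otherwise the power of x with exponent p^(a-1), an element of order p, lies in
    \<open>kerlam\<close>, although p does not divide the order of \<open>kerlam\<close>.\<close>
  have "a = 1"
  proof (rule ccontr)
    assume "a \<noteq> 1"
    then obtain b where b: "a = Suc (Suc b)" using a_pos by (metis One_nat_def Suc_pred' not_gr_zero)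
    have y: "x [^] (p ^ Suc b) \<in> tw.kerlam"
      using lam_pow_x[of "p ^ Suc b"] of_nat_p C x_in by (simp add: tw.kerlam_def)
    have "x [^] (p ^ Suc b * card tw.kerlam) = \<one>"
      using pow_card_subgroup[OF normal_imp_subgroup[OF K] y] x_in by (simp add: nat_pow_pow)
    then have "p ^ Suc (Suc b) dvd p ^ Suc b * card tw.kerlam"
      using pow_eq_id[OF x_in] ord_x b by simp
    then have "p dvd card tw.kerlam" using p0 by simp
    then show False using imp(1) of_nat_eq_0 by blast
  qed
  then show P: "card P = p" using P_card by simp
  have "tw.kerlam \<inter> P = {\<one>}"
  proof -
    have "y = \<one>" if y: "y \<in> tw.kerlam" "y \<in> P" for y
    proof -
      obtain i where i: "y = x [^] (i::nat)" using y P_gen by blast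
      then have "p dvd i" using y lam_pow_x of_nat_eq_0 by (simp add: tw.kerlam_def)
      then show ?thesis using pow_eq_id[OF x_in] ord_x \<open>a = 1\<close> i by simp
    qed
    then show ?thesis using C P_closed(4) by (auto simp: tw.kerlam_def)
  qed
  moreover have "tw.kerlam <#> P = carrier G"
  proof (intro equalityI subsetI)
    fix g assume g: "g \<in> carrier G"
    then obtain i where i: "lam g = of_nat i" using lam_in_prime_field C by blast
    have xi: "x [^] i \<in> P" using P_gen by blast
    \<comment> \<open>Since \<open>lam g\<close> lies in the prime field, it is attained on P as
      well; dividing by that power of x lands in \<open>kerlam\<close>.\<close>
    have "lam (g \<otimes> inv (x [^] i)) = 0"
      using tw.lam_C_mult[of g "inv (x [^] i)"] tw.lam_C_inv[of "x [^] i"] C g x_in i lam_pow_x by simp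
    then have "g \<otimes> inv (x [^] i) \<in> tw.kerlam" using C g x_in by (simp add: tw.kerlam_def)
    then have "(g \<otimes> inv (x [^] i)) \<otimes> x [^] i \<in> tw.kerlam <#> P"
      using xi unfolding set_mult_def by blast
    then show "g \<in> tw.kerlam <#> P" using g x_in by (simp add: m_assoc)
  qed (use C P_sub in \<open>auto simp: set_mult_def tw.kerlam_def\<close>)
  ultimately show dp: "internal_direct_product G tw.kerlam P"
    using K P_normal by (simp add: internal_direct_product_def)
  show "card tw.kerlam = q"
    using order_internal_direct_product[OF dp] lagrange[OF P_subgroup] q_eq P p0 by simp
  show "p \<noteq> 2"
  proof
    assume 2: "p = 2"
    then have "(2::'k) = 0" using of_nat_p by simp
    moreover have "lam ` tw.C \<subseteq> {0, 1}"
    proof (rule image_subsetI)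
      fix c assume "c \<in> tw.C"
      then obtain i where "i < 2" "lam c = of_nat i" using lam_in_prime_field 2 by blast
      then show "lam c \<in> {0, 1}" by (auto simp: less_2_cases_iff)
    qed
    ultimately show False using imp(3) by blast
  qed
qed

text \<open>Normal subgroups with trivial intersection commute elementwise, so \<open>chi\<close> is
  trivial and \<open>lam\<close> is a homomorphism. It vanishes on K, whose order is prime to p, and
  is injective on P, whose order is p; hence its kernel is K.\<close>

lemma direct_product_data:
  assumes dp: "internal_direct_product G K P" and K: "\<not> p dvd card K" and Pp: "card P = p"
  shows "\<And>g. g \<in> carrier G \<Longrightarrow> chi g = 1" and "tw.kerlam = K"
proof -
  have nK: "K \<lhd> G" and int: "K \<inter> P = {\<one>}" and prod: "K <#> P = carrier G"
    using dp unfolding internal_direct_product_def by auto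
  have sK: "subgroup K G" using nK normal_imp_subgroup by blast
  have KG: "k \<in> carrier G" if "k \<in> K" for k using that sK subgroup.subset by blast
  have xP: "x \<in> P" unfolding P_gen using x_in by (auto intro: exI[of _ "1::nat"])
  have comm: "k \<otimes> x = x \<otimes> k" if k: "k \<in> K" for k
  proof -
    have "(k \<otimes> x \<otimes> inv k) \<otimes> inv x \<in> P"
      using P_conj[OF KG[OF k] xP] P_closed xP by blast
    moreover have "k \<otimes> (x \<otimes> inv k \<otimes> inv x) \<in> K"
      using k normal.inv_op_closed2[OF nK x_in, of "inv k"] sK
      by (simp add: subgroup.m_closed subgroup.m_inv_closed)
    ultimately have "k \<otimes> x \<otimes> inv k \<otimes> inv x = \<one>" using int KG[OF k] x_in by (auto simp: m_assoc)
    then have "k \<otimes> x \<otimes> inv k \<otimes> inv x \<otimes> x \<otimes> k = x \<otimes> k" using KG[OF k] x_in by simp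
    then show ?thesis using KG[OF k] x_in by (simp add: m_assoc)
  qed
  have chiK: "chi k = 1" if "k \<in> K" for k
    using chi_eq[of k 1] comm[OF that] KG[OF that] x_in by (simp add: m_assoc)
  show chi1: "chi g = 1" if "g \<in> carrier G" for g
  proof -
    have "g \<in> K <#> P" using that prod by simp
    then obtain k y where "k \<in> K" "y \<in> P" "g = k \<otimes> y" unfolding set_mult_def by auto
    then show ?thesis using chi_mult[of k y] chiK chi_P KG P_closed by simp
  qed
  have C: "tw.C = carrier G" using chi1 by (auto simp: tw.C_def)
  have lamK: "lam k = 0" if k: "k \<in> K" for k
  proof -
    have "of_nat (card K) * lam k = 0"
      using lam_pow[of k "card K"] pow_card_subgroup[OF sK k] C KG[OF k] tw.lam_one by simp
    then show ?thesis using K of_nat_eq_0 by auto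
  qed
  show "tw.kerlam = K"
  proof (intro equalityI subsetI)
    fix g assume g: "g \<in> tw.kerlam"
    then have gG: "g \<in> carrier G" and g0: "lam g = 0" using C by (auto simp: tw.kerlam_def)
    have "g \<in> K <#> P" using gG prod by simp
    then obtain k y where ky: "k \<in> K" "y \<in> P" "g = k \<otimes> y" unfolding set_mult_def by auto
    have lamy: "lam y = 0" using g0 ky tw.lam_C_mult[of k y] lamK C KG P_closed(1) by simp
    obtain i where i: "y = x [^] (i::nat)" using ky P_gen by blast
    have "p dvd i" using lamy i lam_pow_x of_nat_eq_0 by simp
    then have "y = \<one>" using pow_eq_id[OF x_in, of i] ord_x P_card Pp i by simp
    then show "g \<in> K" using ky KG by simp
  qed (use lamK C KG in \<open>auto simp: tw.kerlam_def\<close>)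
qed

end

section \<open>The Witt algebra\<close>

text \<open>Elements of k[X]/(X^p) are handled as truncated power series, so that products and
  derivatives are those of \<open>fps\<close> and only compatibility with truncation has to be
  checked.\<close>

definition trunc :: "nat \<Rightarrow> 'k::zero fps \<Rightarrow> nat \<Rightarrow> 'k" where
  "trunc p F = (\<lambda>n. if n < p then fps_nth F n else 0)"

lemma trunc_in [simp]: "trunc p F \<in> fspace {..<p}"
  by (simp add: fspace_def trunc_def)

lemma trunc_Abs [simp]: "w \<in> fspace {..<p} \<Longrightarrow> trunc p (Abs_fps w) = w"
  by (auto simp: trunc_def fspace_def)

lemma Abs_fps_linear:
  "Abs_fps (f + g) = Abs_fps f + Abs_fps g" "Abs_fps (f - g) = Abs_fps f - Abs_fps g"
  "Abs_fps (smul c f) = fps_const c * Abs_fps f" "Abs_fps 0 = 0"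
  for f :: "nat \<Rightarrow> 'k::field"
  by (auto simp: fps_eq_iff)

lemma trunc_linear:
  "trunc p (F + H) = trunc p F + trunc p H" "trunc p (F - H) = trunc p F - trunc p H"
  "trunc p (fps_const c * F) = smul c (trunc p F)" "trunc p 0 = 0"
  for F :: "'k::field fps"
  by (auto simp: trunc_def fun_eq_iff)

lemma trunc_mult_left: "trunc p (Abs_fps (trunc p F) * H) = trunc p (F * H)" for F :: "'k::field fps"
  by (auto simp: trunc_def fun_eq_iff fps_mult_nth intro!: sum.cong)

lemma trunc_mult_right: "trunc p (F * Abs_fps (trunc p H)) = trunc p (F * H)" for F :: "'k::field fps"
  by (auto simp: trunc_def fun_eq_iff fps_mult_nth intro!: sum.cong)

lemma trunc_poly_mult_eq: "trunc_poly_mult p f g = trunc p (Abs_fps f * Abs_fps g)"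
  by (auto simp: trunc_poly_mult_def trunc_def fps_mult_nth atLeast0AtMost)

lemma Abs_fps_single: "Abs_fps (single i) = (fps_X ^ i :: 'k::field fps)"
  by (auto simp: fps_eq_iff single_def)

lemma trunc_X: "i < p \<Longrightarrow> trunc p (fps_X ^ i :: 'k::field fps) = single i"
  by (auto simp: trunc_def single_def)

text \<open>The derivation \<open>w d/dX\<close> of \<open>k[X]/(X^p)\<close> is represented by its coefficient \<open>w\<close>.\<close>
definition wbr :: "nat \<Rightarrow> (nat \<Rightarrow> 'k::field) \<Rightarrow> (nat \<Rightarrow> 'k) \<Rightarrow> nat \<Rightarrow> 'k" where
  "wbr p w v = trunc p (Abs_fps w * fps_deriv (Abs_fps v) - Abs_fps v * fps_deriv (Abs_fps w))"

definition witt_coeff :: "nat \<Rightarrow> (nat \<Rightarrow> 'k::field, 'k) lie_alg" where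
  "witt_coeff p = \<lparr> lcarrier = fspace {..<p}, lzero = 0, lplus = (+), lscale = smul, lbracket = wbr p \<rparr>"

definition wder :: "nat \<Rightarrow> (nat \<Rightarrow> 'k::field) \<Rightarrow> (nat \<Rightarrow> 'k) \<Rightarrow> nat \<Rightarrow> 'k" where
  "wder p w = (\<lambda>h. if h \<in> fspace {..<p} then trunc p (Abs_fps w * fps_deriv (Abs_fps h)) else 0)"

lemma wbr_in [simp]: "wbr p w v \<in> fspace {..<p}" by (simp add: wbr_def)

lemma witt_coeff_closed: "lie_closed (witt_coeff p)"
  unfolding lie_closed_def lie_ideal_def lie_subspace_def witt_coeff_def
  by (auto simp: fun_eq_iff)

context
  fixes p :: nat and kt :: "'k::field itself"
  assumes p: "p = CHAR('k)" and p1: "p > 1"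
begin

text \<open>d/dX descends to the quotient by X^p because the derivative of X^p is p X^(p-1) = 0.
  This is the coefficient of index p - 1, the only one where truncation could make a
  difference.\<close>

lemma trunc_deriv: "trunc p (H * fps_deriv (Abs_fps (trunc p F))) = trunc p (H * fps_deriv F)"
  for F H :: "'k fps"
proof -
  have "trunc p (fps_deriv (Abs_fps (trunc p F))) = trunc p (fps_deriv F)"
  proof
    fix n
    show "trunc p (fps_deriv (Abs_fps (trunc p F))) n = trunc p (fps_deriv F) n"
    proof (cases "Suc n = p")
      case True
      have "of_nat (Suc n) = (0::'k)" unfolding True p by simp
      then show ?thesis by (simp add: trunc_def del: of_nat_Suc)
    qed (auto simp: trunc_def)
  qed
  then show ?thesis using trunc_mult_right[of p H "fps_deriv (Abs_fps (trunc p F))"]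
      trunc_mult_right[of p H "fps_deriv F"] by simp
qed

lemma wder_derivation: "wder p w \<in> derivations {..<p} (trunc_poly_mult p)" for w :: "nat \<Rightarrow> 'k"
proof (rule derivationsI)
  fix f h :: "nat \<Rightarrow> 'k" assume f: "f \<in> fspace {..<p}" and h: "h \<in> fspace {..<p}"
  show "wder p w (trunc_poly_mult p f h) = trunc_poly_mult p (wder p w f) h + trunc_poly_mult p f (wder p w h)"
    using f h by (simp add: wder_def trunc_poly_mult_eq trunc_deriv trunc_mult_left trunc_mult_right
        algebra_simps flip: trunc_linear(1))
  show "wder p w (f + h) = wder p w f + wder p w h"
    using f h by (simp add: wder_def Abs_fps_linear distrib_left trunc_linear)
  show "wder p w (smul c f) = smul c (wder p w f)" for c
    using f by (simp add: wder_def Abs_fps_linear mult.left_commute[of _ "fps_const c"] trunc_linear)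
qed (auto simp: wder_def)

text \<open>The algebra is generated by X: a derivation kills 1, and its value on X^(i+1) follows
  from those on X and X^i.\<close>

lemma trunc_derivation_eqI:
  fixes D E :: "(nat \<Rightarrow> 'k) \<Rightarrow> nat \<Rightarrow> 'k"
  assumes D: "D \<in> derivations {..<p} (trunc_poly_mult p)" and E: "E \<in> derivations {..<p} (trunc_poly_mult p)"
    and eq: "D (single 1) = E (single 1)"
  shows "D = E"
proof (rule derivation_eqI[OF finite_lessThan D E])
  have zero: "F (single 0) = 0" if F: "F \<in> derivations {..<p} (trunc_poly_mult p)"
    for F :: "(nat \<Rightarrow> 'k) \<Rightarrow> nat \<Rightarrow> 'k"
  proof -
    have s0: "single 0 \<in> fspace {..<p}" using p1 by simp
    have F0: "F (single 0) \<in> fspace {..<p}" using derivationsD(1)[OF F s0] .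
    have u: "trunc_poly_mult p h (single 0) = h" "trunc_poly_mult p (single 0) h = h"
      if "h \<in> fspace {..<p}" for h :: "nat \<Rightarrow> 'k"
      using that by (simp_all add: trunc_poly_mult_eq Abs_fps_single)
    have "F (single 0) = F (single 0) + F (single 0)"
      using derivationsD(4)[OF F s0 s0] unfolding u[OF F0] u[OF s0] .
    then show ?thesis by (simp only: add_cancel_right_right)
  qed
  show "D (single i) = E (single i)" if "i \<in> {..<p}" for i
    using that
  proof (induction i)
    case 0 then show ?case using zero[OF D] zero[OF E] by simp
  next
    case (Suc i)
    have s1: "single 1 \<in> fspace {..<p}" and si: "single i \<in> fspace {..<p}" using p1 Suc by auto
    have e: "trunc_poly_mult p (single 1) (single i) = (single (Suc i) :: nat \<Rightarrow> 'k)"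
      using trunc_X[of "Suc i" p] Suc by (simp add: trunc_poly_mult_eq Abs_fps_single)
    show ?case
      using derivationsD(4)[OF D s1 si, unfolded e] derivationsD(4)[OF E s1 si, unfolded e] eq Suc by simp
  qed
qed

lemma lie_iso_witt: "lie_iso (witt_coeff p :: (nat \<Rightarrow> 'k, 'k) lie_alg) (witt_W11 p) (wder p)"
proof -
  have wX: "wder p w (single 1) = w" if "w \<in> fspace {..<p}" for w :: "nat \<Rightarrow> 'k"
    using that p1 by (simp add: wder_def Abs_fps_single)
  have "inj_on (wder p) (fspace {..<p} :: (nat \<Rightarrow> 'k) set)"
    by (rule inj_onI) (metis wX)
  moreover have "wder p ` (fspace {..<p} :: (nat \<Rightarrow> 'k) set) = derivations {..<p} (trunc_poly_mult p)"
  proof (intro equalityI subsetI)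
    fix D :: "(nat \<Rightarrow> 'k) \<Rightarrow> nat \<Rightarrow> 'k" assume D: "D \<in> derivations {..<p} (trunc_poly_mult p)"
    have in1: "D (single 1) \<in> fspace {..<p}" using derivationsD(1)[OF D] p1 by simp
    then have "D = wder p (D (single 1))"
      by (intro trunc_derivation_eqI[OF D wder_derivation]) (rule wX[symmetric])
    then show "D \<in> wder p ` fspace {..<p}" using in1 by blast
  qed (use wder_derivation in auto)
  moreover have "wder p (w + v) = wder p w + wder p v" for w v :: "nat \<Rightarrow> 'k"
    by (auto simp: wder_def fun_eq_iff Abs_fps_linear distrib_right trunc_linear)
  moreover have "wder p (smul c w) h = smul c (wder p w h)" for c h and w :: "nat \<Rightarrow> 'k"
    by (auto simp: wder_def Abs_fps_linear mult.assoc trunc_linear fun_eq_iff)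
  moreover have "wder p (wbr p w v) h = wder p w (wder p v h) - wder p v (wder p w h)" for h and w v :: "nat \<Rightarrow> 'k"
  proof (cases "h \<in> fspace {..<p}")
    case True
    then show ?thesis
      by (simp add: wder_def wbr_def trunc_deriv trunc_mult_left trunc_mult_right algebra_simps flip: trunc_linear(2))
  qed (simp add: wder_def Abs_fps_linear trunc_linear)
  ultimately show ?thesis
    unfolding lie_iso_def bij_betw_def witt_W11_def der_lie_def witt_coeff_def
    by (auto simp: fun_eq_iff)
qed

end

section \<open>Powers of the Witt algebra and their semisimplicity\<close>

lemma lie_power_closed:
  assumes "lie_closed L" shows "lie_closed (lie_power L n)"
  using lie_closedD[OF assms] unfolding lie_closed_def lie_ideal_def lie_subspace_def lie_power_def
  by (auto simp: fun_eq_iff)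

lemma lie_power_iso:
  assumes iso: "lie_iso L M \<phi>" and L: "lie_closed L" and M: "lie_closed M"
  shows "lie_iso (lie_power L n) (lie_power M n) (\<lambda>f i. if i < n then \<phi> (f i) else lzero M)"
proof -
  note i = lie_isoD[OF iso]
  let ?F = "\<lambda>f i. if i < n then \<phi> (f i) else lzero M"
  have "inj_on ?F (lcarrier (lie_power L n))"
  proof (rule inj_onI)
    fix f g assume fg: "f \<in> lcarrier (lie_power L n)" "g \<in> lcarrier (lie_power L n)" "?F f = ?F g"
    show "f = g"
    proof
      fix j
      show "f j = g j"
      proof (cases "j < n")
        case True
        then have "\<phi> (f j) = \<phi> (g j)" using fun_cong[OF fg(3), of j] by simp
        then show ?thesis using i(1) fg True by (simp add: lie_power_def inj_on_eq_iff)
      qed (use fg in \<open>simp add: lie_power_def\<close>)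
    qed
  qed
  moreover have "?F ` lcarrier (lie_power L n) = lcarrier (lie_power M n)"
  proof (intro equalityI subsetI)
    fix g assume g: "g \<in> lcarrier (lie_power M n)"
    define f where "f j = (if j < n then inv_into (lcarrier L) \<phi> (g j) else lzero L)" for j
    have "f j \<in> lcarrier L \<and> \<phi> (f j) = g j" if "j < n" for j
    proof -
      have "g j \<in> \<phi> ` lcarrier L" using g that i(2) by (simp add: lie_power_def)
      then show ?thesis using that by (simp add: f_def inv_into_into f_inv_into_f)
    qed
    then have "f \<in> lcarrier (lie_power L n)" "?F f = g"
      using g by (auto simp: lie_power_def f_def fun_eq_iff)
    then show "g \<in> ?F ` lcarrier (lie_power L n)" by blast
  qed (use i(3) in \<open>auto simp: lie_power_def\<close>)
  ultimately show ?thesis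
    unfolding lie_iso_def bij_betw_def using i(4-6)
    by (auto simp: lie_power_def fun_eq_iff)
qed

context
  fixes p n :: nat and kt :: "'k::field itself"
  assumes p: "p = CHAR('k)" and p2: "p > 2"
begin

definition emb :: "nat \<Rightarrow> (nat \<Rightarrow> 'k) \<Rightarrow> nat \<Rightarrow> nat \<Rightarrow> 'k" where
  "emb j w = (\<lambda>i. if i = j then w else 0)"

text \<open>The relations of sl2 for d/dX, X d/dX and X^2 d/dX. The coefficient X^2 survives
  truncation because p > 2.\<close>

lemma wbr_single:
  "wbr p (single 0) w = trunc p (fps_deriv (Abs_fps w))"
  "wbr p (single 1) (single 0) = smul (-1) (single 0 :: nat \<Rightarrow> 'k)"
  "wbr p (single 0) (single 1) = (single 0 :: nat \<Rightarrow> 'k)"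
  "wbr p (single 0) (single 2) = smul 2 (single 1 :: nat \<Rightarrow> 'k)"
  "wbr p (single 2) (single 0) = smul (-2) (single 1 :: nat \<Rightarrow> 'k)"
  "wbr p (single 1) (single 2) = (single 2 :: nat \<Rightarrow> 'k)"
  "wbr p (single 2) (single 1) = smul (-1) (single 2 :: nat \<Rightarrow> 'k)"
  for w :: "nat \<Rightarrow> 'k"
proof -
  have X: "trunc p (1 :: 'k fps) = single 0" "trunc p (fps_X :: 'k fps) = single 1"
    "trunc p (fps_X ^ 2 :: 'k fps) = single 2"
    using trunc_X[of 0 p] trunc_X[of 1 p] trunc_X[of 2 p] p2 by simp_all
  have d: "fps_deriv (fps_X ^ 2 :: 'k fps) = fps_const 2 * fps_X"
    by (auto simp: fps_eq_iff le_Suc_eq)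
  show "wbr p (single 0) w = trunc p (fps_deriv (Abs_fps w))"
    by (simp add: wbr_def Abs_fps_single)
  have m: "trunc p (- F) = smul (-1) (trunc p F)" for F :: "'k fps"
    by (auto simp: trunc_def fun_eq_iff)
  have e: "fps_X * (fps_const 2 * fps_X) - fps_X ^ 2 = (fps_X ^ 2 :: 'k fps)" 
    by (simp add: power2_eq_square algebra_simps flip: fps_const_add numeral_fps_const)
  have n2: "smul (-1) (smul 2 (single 1)) = (smul (-2) (single 1) :: nat \<Rightarrow> 'k)" by (simp add: fun_eq_iff)
  show "wbr p (single 1) (single 0) = smul (-1) (single 0 :: nat \<Rightarrow> 'k)"
    "wbr p (single 0) (single 1) = (single 0 :: nat \<Rightarrow> 'k)"
    "wbr p (single 0) (single 2) = smul 2 (single 1 :: nat \<Rightarrow> 'k)"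
    "wbr p (single 1) (single 2) = (single 2 :: nat \<Rightarrow> 'k)"
    by (simp_all add: wbr_def Abs_fps_single X d m e trunc_linear)
  show "wbr p (single 2) (single 0) = smul (-2) (single 1 :: nat \<Rightarrow> 'k)"
    unfolding n2[symmetric] by (simp add: wbr_def Abs_fps_single X d m trunc_linear)
  have "fps_X ^ 2 - fps_X * (fps_const 2 * fps_X) = - (fps_X ^ 2 :: 'k fps)" using e by (metis minus_diff_eq)
  then have "trunc p (fps_X ^ 2 - fps_X * (fps_const 2 * fps_X)) = smul (-1) (single 2 :: nat \<Rightarrow> 'k)"
    by (simp only: m X)
  then show "wbr p (single 2) (single 1) = smul (-1) (single 2 :: nat \<Rightarrow> 'k)"
    by (simp add: wbr_def Abs_fps_single d)
qed

text \<open>Brackets with elements supported in one component stay there. Differentiating lowers a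
  nonzero element of the ideal to a constant, and from it d/dX, X d/dX, X^2 d/dX are recovered; they
  are multiples of brackets of each other, so they stay in every term of the derived series.\<close>

lemma witt_power_semisimple: "lie_semisimple (lie_power (witt_coeff p :: (nat \<Rightarrow> 'k, 'k) lie_alg) n)"
  unfolding lie_semisimple_def
proof (intro allI impI)
  let ?L = "lie_power (witt_coeff p :: (nat \<Rightarrow> 'k, 'k) lie_alg) n"
  fix I assume I: "lie_ideal ?L I \<and> lie_solvable ?L I"
  have zeroL: "lzero ?L = 0" by (simp add: lie_power_def witt_coeff_def zero_fun_def)
  have sub: "lie_subspace ?L I" and idl: "\<And>x y. x \<in> lcarrier ?L \<Longrightarrow> y \<in> I \<Longrightarrow> lbracket ?L x y \<in> I"
    using I by (auto simp: lie_ideal_def)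
  have carI: "f i \<in> fspace {..<p}" "\<not> i < n \<Longrightarrow> f i = 0" if "f \<in> I" for f i
  proof -
    have "f \<in> lcarrier ?L" using sub that by (auto simp: lie_subspace_def)
    then show z: "\<not> i < n \<Longrightarrow> f i = 0" by (simp add: lie_power_def witt_coeff_def)
    show "f i \<in> fspace {..<p}"
      using \<open>f \<in> lcarrier ?L\<close> z by (cases "i < n") (simp_all add: lie_power_def witt_coeff_def)
  qed
  have two: "(2::'k) \<noteq> 0"
  proof
    assume "(2::'k) = 0"
    then have "of_nat 2 = (0::'k)" by simp
    then have "p dvd 2" unfolding p of_nat_eq_0_iff_char_dvd .
    then show False using p2 by (auto dest: dvd_imp_le)
  qed
  show "I = {lzero ?L}"
  proof (rule ccontr)
    assume "I \<noteq> {lzero ?L}"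
    then obtain f where f: "f \<in> I" "f \<noteq> 0" using sub zeroL by (auto simp: lie_subspace_def)
    then obtain j where j: "f j \<noteq> 0" by (auto simp: fun_eq_iff)
    have jn: "j < n" using carI(2)[OF f(1)] j by blast
    have emb_car: "emb j w \<in> lcarrier ?L" if "w \<in> fspace {..<p}" for w
      using that jn by (auto simp: emb_def lie_power_def witt_coeff_def)
    have br: "lbracket ?L (emb j w) g = emb j (wbr p w (g j))" for w g
      using jn by (auto simp: emb_def lie_power_def witt_coeff_def fun_eq_iff wbr_def Abs_fps_linear trunc_linear)
    have br_emb: "lbracket ?L (emb j w) (emb j v) = emb j (wbr p w v)" for w v
      using br[of w "emb j v"] by (simp add: emb_def)
    have sc: "lscale ?L c (emb j w) = emb j (smul c w)" for c w
      using jn by (auto simp: emb_def lie_power_def witt_coeff_def fun_eq_iff)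
    have scI: "emb j (smul c w) \<in> I" if "emb j w \<in> I" for c w
      using sub that unfolding sc[symmetric] lie_subspace_def by blast
    have unscI: "emb j w \<in> I" if "emb j (smul c w) \<in> I" "c \<noteq> 0" for c w
    proof -
      have "smul (inverse c) (smul c w) = w" using that(2) by (auto simp: fun_eq_iff)
      then show ?thesis using scI[OF that(1), of "inverse c"] by simp
    qed
    have brI: "emb j (wbr p w (g j)) \<in> I" if "w \<in> fspace {..<p}" "g \<in> I" for w g
      using idl[OF emb_car[OF that(1)] that(2)] br by simp
    have brI': "emb j (wbr p w v) \<in> I" if "w \<in> fspace {..<p}" "emb j v \<in> I" for w v
      using brI[OF that] by (simp add: emb_def)
    have s: "single i \<in> fspace {..<p}" if "i \<le> 2" for i using that p2 by simp
    \<comment> \<open>Bracketing with d/dX differentiates w. The leading coefficient gets the factor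
      d + 1, nonzero in the field since d + 1 < p, so the degree drops by one and the result is not
      zero.\<close>
    have low: "emb j (single 0) \<in> I"
      if "w \<in> fspace {..<p}" "w \<noteq> 0" "emb j w \<in> I" "\<forall>i>d. w i = 0" for w d
      using that
    proof (induction d arbitrary: w)
      case 0
      have "w = smul (w 0) (single 0)"
        using 0(4) by (auto simp: fun_eq_iff single_def)
      moreover have "w 0 \<noteq> 0" using 0(2,4) by (metis ext neq0_conv zero_fun_apply)
      ultimately show ?case using 0(3) unscI by metis
    next
      case (Suc d)
      show ?case
      proof (cases "w (Suc d) = 0")
        case True
        then have "\<forall>i>d. w i = 0" using Suc.prems(4) by (metis Suc_lessI)
        then show ?thesis using Suc by blast
      next
        case False
        let ?v = "wbr p (single 0) w"
        have dp: "Suc d < p" using False Suc.prems(1) by (auto simp: fspace_def)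
        have v: "?v i = (if i < p then of_nat (Suc i) * w (Suc i) else 0)" for i
          by (simp add: wbr_single trunc_def)
        have "\<not> p dvd Suc d" using dp by (auto dest: dvd_imp_le)
        then have "of_nat (Suc d) \<noteq> (0::'k)" unfolding p of_nat_eq_0_iff_char_dvd .
        then have "?v d \<noteq> 0" using v[of d] dp False by simp
        then have "?v \<noteq> 0" by (metis zero_fun_apply)
        moreover have "\<forall>i>d. ?v i = 0" using v Suc.prems(4) by simp
        moreover have "emb j ?v \<in> I" using brI'[OF s Suc.prems(3)] by simp
        ultimately show ?thesis using Suc.IH[OF wbr_in] by blast
      qed
    qed
    have fj: "f j \<in> fspace {..<p}" using carI(1)[OF f(1)] .
    \<comment> \<open>The component f j need not lie in the ideal by itself; it gets there by one
      bracket. If d/dX kills it, it is a nonzero constant, and X d/dX serves instead.\<close>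
    have one: "emb j (single 0) \<in> I"
    proof (cases "wbr p (single 0) (f j) = 0")
      case False
      have "\<forall>i>p. wbr p (single 0) (f j) i = 0" by (simp add: wbr_def trunc_def)
      then show ?thesis using low[OF wbr_in False brI[OF s f(1)]] by simp
    next
      case True
      have "f j (Suc i) = 0" for i
      proof (cases "Suc i < p")
        case True': True
        have "wbr p (single 0) (f j) i = 0" using True by simp
        then have "of_nat (Suc i) * f j (Suc i) = 0" using True' by (simp add: wbr_single trunc_def)
        moreover have "\<not> p dvd Suc i" using True' by (auto dest: dvd_imp_le)
        then have "of_nat (Suc i) \<noteq> (0::'k)" unfolding p of_nat_eq_0_iff_char_dvd .
        ultimately show ?thesis by (metis mult_eq_0_iff)
      qed (use fj in \<open>simp add: fspace_def\<close>)
      then have z: "f j i = 0" if "i > 0" for i using that by (metis gr0_implies_Suc)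
      have e: "f j = smul (f j 0) (single 0)" using z by (auto simp: fun_eq_iff single_def)
      have nz: "f j 0 \<noteq> 0" using j z by (metis ext neq0_conv zero_fun_apply)
      have sm: "wbr p w (smul c v) = smul c (wbr p w v)" for c and w v :: "nat \<Rightarrow> 'k"
        by (simp add: wbr_def Abs_fps_linear algebra_simps flip: trunc_linear(3))
      have "emb j (wbr p (single 1) (f j)) \<in> I" using brI[OF s f(1)] by simp
      moreover have "wbr p (single 1) (f j) = smul (f j 0) (smul (-1) (single 0))"
        by (subst e) (simp only: sm wbr_single)
      ultimately have "emb j (smul (f j 0) (smul (-1) (single 0))) \<in> I" by (simp only:)
      then have "emb j (smul (-1) (single 0)) \<in> I" by (rule unscI[OF _ nz])
      then show ?thesis by (rule unscI) simp
    qed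
    have X: "emb j (single 1) \<in> I"
      using brI'[OF s one, of 2] unscI[of "-2" "single 1"] two by (simp add: wbr_single)
    have X2: "emb j (single 2) \<in> I"
      using brI'[OF s X, of 2] unscI[of "-1" "single 2"] by (simp add: wbr_single(2-)[unfolded One_nat_def])
    have der: "emb j (single 0) \<in> (lie_derived ?L ^^ m) I \<and> emb j (single 1) \<in> (lie_derived ?L ^^ m) I
        \<and> emb j (single 2) \<in> (lie_derived ?L ^^ m) I" for m
    proof (induction m)
      case (Suc m)
      let ?S = "(lie_derived ?L ^^ m) I"
      have "emb j (single 0) \<in> lie_derived ?L ?S"
        using lbracket_in_lie_derived[of "emb j (single 0)" ?S "emb j (single 1)" ?L] Suc
        by (simp add: br_emb wbr_single(2-)[unfolded One_nat_def])
      moreover have "emb j (single 2) \<in> lie_derived ?L ?S"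
        using lbracket_in_lie_derived[of "emb j (single 1)" ?S "emb j (single 2)" ?L] Suc
        by (simp add: br_emb wbr_single(2-)[unfolded One_nat_def])
      moreover have "emb j (smul 2 (single 1)) \<in> lie_derived ?L ?S"
        using lbracket_in_lie_derived[of "emb j (single 0)" ?S "emb j (single 2)" ?L] Suc
        by (simp add: br_emb wbr_single(2-)[unfolded One_nat_def])
      then have "emb j (smul (inverse 2) (smul 2 (single 1))) \<in> lie_derived ?L ?S"
        unfolding sc[symmetric, of "inverse 2"] by (rule lscale_in_lie_derived)
      moreover have "smul (inverse 2) (smul 2 (single 1)) = (single 1 :: nat \<Rightarrow> 'k)"
        using two by (auto simp: fun_eq_iff)
      ultimately show ?case by simp
    qed (use one X X2 in simp)
    obtain m where "(lie_derived ?L ^^ m) I = {lzero ?L}" using I unfolding lie_solvable_def by blast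
    then have "emb j (single 0) = 0" using der[of m] zeroL by simp
    then have "emb j (single 0) j 0 = 0" by (metis zero_fun_apply)
    then show False by (simp add: emb_def single_def)
  qed
qed

end

section \<open>Idempotents of the centre\<close>

interpretation fun_vs: vector_space "smul :: 'k::field \<Rightarrow> ('i \<Rightarrow> 'k) \<Rightarrow> 'i \<Rightarrow> 'k"
  by unfold_locales (auto simp: fun_eq_iff algebra_simps)

interpretation fun_vsp: vector_space_pair
  "smul :: 'k::field \<Rightarrow> ('i \<Rightarrow> 'k) \<Rightarrow> 'i \<Rightarrow> 'k" "smul :: 'k::field \<Rightarrow> ('i \<Rightarrow> 'k) \<Rightarrow> 'i \<Rightarrow> 'k"
  by unfold_locales

lemma fspace_span: "finite I \<Longrightarrow> fspace I \<subseteq> fun_vs.span (single ` I :: ('i \<Rightarrow> 'k::field) set)"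
proof
  fix f :: "'i \<Rightarrow> 'k" assume "finite I" "f \<in> fspace I"
  then have "f = (\<Sum>g\<in>I. smul (f g) (single g))" by (rule fspace_expand)
  moreover have "(\<Sum>g\<in>I. smul (f g) (single g)) \<in> fun_vs.span (single ` I)"
    by (intro fun_vs.span_sum fun_vs.span_scale fun_vs.span_base) blast
  ultimately show "f \<in> fun_vs.span (single ` I)" by simp
qed

lemma independent_card_le:
  fixes S :: "('i \<Rightarrow> 'k::field) set"
  assumes "finite I" "S \<subseteq> fspace I" "fun_vs.independent S" shows "card S \<le> card I"
proof -
  have "card S \<le> card (single ` I :: ('i \<Rightarrow> 'k) set)"
    using fun_vs.independent_span_bound[of "single ` I" S] assms fspace_span[OF assms(1)] by auto
  then show ?thesis using card_image_le[OF assms(1), of "single :: 'i \<Rightarrow> 'i \<Rightarrow> 'k"] by linarith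
qed

text \<open>N + 1 vectors in a space of dimension N are dependent. Dependence is a notion for sets,
  so a repetition in the sequence is treated apart, with a difference of two monomials.\<close>

lemma annihilating_poly:
  fixes b :: "nat \<Rightarrow> 'i \<Rightarrow> 'k::field"
  assumes I: "finite I" and b: "\<And>i. b i \<in> fspace I" and N: "N = card I"
  obtains q :: "'k poly" where "q \<noteq> 0" "degree q \<le> N" "(\<Sum>i\<le>N. smul (coeff q i) (b i)) = 0"
proof (cases "inj_on b {..N}")
  case True
  have "card (b ` {..N}) = Suc N" using True by (simp add: card_image)
  then have "fun_vs.dependent (b ` {..N})"
    using independent_card_le[OF I, of "b ` {..N}"] b N by auto
  then obtain c v where c: "v \<in> b ` {..N}" "c v \<noteq> 0" "(\<Sum>v\<in>b ` {..N}. smul (c v) v) = 0"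
    unfolding fun_vs.dependent_finite[OF finite_imageI[OF finite_atMost]] by blast
  define q where "q = (\<Sum>i\<le>N. monom (c (b i)) i)"
  have cq: "coeff q i = (if i \<le> N then c (b i) else 0)" for i
    by (simp add: q_def coeff_sum)
  show ?thesis
  proof (rule that[of q])
    obtain i where "i \<le> N" "v = b i" using c(1) by blast
    then show "q \<noteq> 0" using c(2) cq[of i] by auto
    show "degree q \<le> N" by (rule degree_le) (simp add: cq)
    have "(\<Sum>i\<le>N. smul (coeff q i) (b i)) = (\<Sum>i\<le>N. smul (c (b i)) (b i))"
      by (rule sum.cong) (auto simp: cq)
    also have "\<dots> = (\<Sum>v\<in>b ` {..N}. smul (c v) v)" by (simp add: sum.reindex[OF True] o_def)
    finally show "(\<Sum>i\<le>N. smul (coeff q i) (b i)) = 0" using c(3) by simp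
  qed
next
  case False
  then obtain i j where ij: "i \<le> N" "j \<le> N" "i \<noteq> j" "b i = b j" by (auto simp: inj_on_def)
  define q where "q = (monom 1 i - monom 1 j :: 'k poly)"
  have cq: "coeff q l = (if l = i then 1 else 0) - (if l = j then 1 else 0)" for l
    by (auto simp: q_def)
  show ?thesis
  proof (rule that[of q])
    show "q \<noteq> 0" using cq[of i] ij by auto
    show "degree q \<le> N" by (rule degree_le) (use ij in \<open>auto simp: cq\<close>)
    show "(\<Sum>i\<le>N. smul (coeff q i) (b i)) = 0"
    proof
      fix z
      have "(\<Sum>l\<le>N. smul (coeff q l) (b l)) z
          = (\<Sum>l\<le>N. (if l = i then b i z else 0) - (if l = j then b j z else 0))"
        unfolding sum_fun_apply by (rule sum.cong) (auto simp: cq)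
      also have "\<dots> = 0" using ij by (simp add: sum_subtractf)
      finally show "(\<Sum>l\<le>N. smul (coeff q l) (b l)) z = 0 z" by simp
    qed
  qed
qed

locale split_group = twisted_group G chi lam x P T for G (structure)
    and chi lam :: "'a \<Rightarrow> 'k::alg_closed_field" and x :: 'a and P T :: "'a set" +
  fixes p :: nat
  assumes chi1: "\<And>g. g \<in> carrier G \<Longrightarrow> chi g = 1"
    and p_char: "p = CHAR('k)" and p_gt1: "p > 1" and x_pow_p: "x [^] p = \<one>"
    and lam_nat: "\<And>g. g \<in> carrier G \<Longrightarrow> \<exists>i<p. lam g = of_nat i"
    and card_K: "of_nat (card kerlam) \<noteq> (0::'k)"
begin

abbreviation "K \<equiv> kerlam"

lemma C_eq: "C = carrier G" using chi1 by (auto simp: C_def)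

lemma K_sub: "K \<subseteq> carrier G" using C_eq by (auto simp: kerlam_def)

lemma K_closed:
  "k \<in> K \<Longrightarrow> k \<in> carrier G" "k \<in> K \<Longrightarrow> l \<in> K \<Longrightarrow> k \<otimes> l \<in> K" "k \<in> K \<Longrightarrow> inv k \<in> K" "\<one> \<in> K"
  using C_mult C_inv C_one lam_C_mult lam_C_inv by (auto simp: kerlam_def C_eq)

lemma K_fin: "finite K" using K_sub fin finite_subset by blast

lemma fspace_K: "f \<in> fspace K \<Longrightarrow> f \<in> fspace (carrier G)"
  using fspace_mono[OF K_sub] by blast

lemma single_conv_eq: "g \<in> carrier G \<Longrightarrow> single g \<star> f = f \<star> single g \<longleftrightarrow> (\<forall>u\<in>carrier G. f (inv g \<otimes> u \<otimes> g) = f u)"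
proof -
  assume g: "g \<in> carrier G"
  have "single g \<star> f = f \<star> single g \<longleftrightarrow> (\<forall>z\<in>carrier G. f (inv g \<otimes> z) = f (z \<otimes> inv g))"
  proof
    assume "single g \<star> f = f \<star> single g"
    then show "\<forall>z\<in>carrier G. f (inv g \<otimes> z) = f (z \<otimes> inv g)" using g by (metis single_conv conv_single)
  next
    assume "\<forall>z\<in>carrier G. f (inv g \<otimes> z) = f (z \<otimes> inv g)"
    then show "single g \<star> f = f \<star> single g"
      using g by (intro conv_eqI) (simp_all add: single_conv conv_single)
  qed
  also have "\<dots> \<longleftrightarrow> (\<forall>u\<in>carrier G. f (inv g \<otimes> u \<otimes> g) = f u)"
  proof
    assume A: "\<forall>z\<in>carrier G. f (inv g \<otimes> z) = f (z \<otimes> inv g)"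
    show "\<forall>u\<in>carrier G. f (inv g \<otimes> u \<otimes> g) = f u"
    proof
      fix u assume "u \<in> carrier G"
      then show "f (inv g \<otimes> u \<otimes> g) = f u" using A[rule_format, of "u \<otimes> g"] g by (simp add: m_assoc)
    qed
  next
    assume A: "\<forall>u\<in>carrier G. f (inv g \<otimes> u \<otimes> g) = f u"
    show "\<forall>z\<in>carrier G. f (inv g \<otimes> z) = f (z \<otimes> inv g)"
    proof
      fix z assume "z \<in> carrier G"
      then show "f (inv g \<otimes> z) = f (z \<otimes> inv g)" using A[rule_format, of "z \<otimes> inv g"] g by (simp add: m_assoc)
    qed
  qed
  finally show ?thesis .
qed

lemma tw_central: "f \<in> tw \<longleftrightarrow> f \<in> fspace (carrier G) \<and> (\<forall>g\<in>carrier G. single g \<star> f = f \<star> single g)"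
  by (auto simp: tw_iff C_eq chi1 single_conv_eq)

lemma tw_comm': "f \<in> tw \<Longrightarrow> h \<in> fspace (carrier G) \<Longrightarrow> h \<star> f = f \<star> h"
  using tw_comm by (simp add: C_eq)

lemma tw_conv: "f \<in> tw \<Longrightarrow> h \<in> tw \<Longrightarrow> f \<star> h \<in> tw"
  unfolding tw_central by (metis conv_in conv_assoc)

lemma tw_one: "single \<one> \<in> tw"
  unfolding tw_central by simp

lemma tw_ac:
  "f \<in> tw \<Longrightarrow> h \<in> tw \<Longrightarrow> f \<star> h = h \<star> f"
  "f \<in> tw \<Longrightarrow> h \<in> tw \<Longrightarrow> f \<star> (h \<star> g) = h \<star> (f \<star> g)"
proof -
  show *: "f \<star> h = h \<star> f" if "f \<in> tw" "h \<in> tw" using tw_comm'[OF that(2) tw_fspace[OF that(1)]] .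
  show "f \<star> (h \<star> g) = h \<star> (f \<star> g)" if "f \<in> tw" "h \<in> tw" using *[OF that] by (metis conv_assoc)
qed

lemma tw_sum: "(\<And>i. i \<in> A \<Longrightarrow> F i \<in> tw) \<Longrightarrow> (\<Sum>i\<in>A. F i) \<in> tw"
proof (induction A rule: infinite_finite_induct)
  case (insert a A)
  then show ?case using tw_closed(2)[of "F a" "sum F A"] by (simp add: plus_fun_def)
qed (use tw_closed(1) in \<open>auto simp: zero_fun_def\<close>)

lemma generated: 
  assumes "g \<in> carrier G" obtains k i where "k \<in> K" "g = k \<otimes> x [^] (i::nat)"
proof -
  obtain i where i: "lam g = of_nat i" using lam_nat[OF assms] by blast
  have l: "lam (x [^] (i::nat)) = of_nat i" for i
    by (induction i) (simp_all add: lam_mult chi1)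
  have "lam (g \<otimes> inv (x [^] i)) = 0"
    using assms i l[of i] lam_C_inv[of "x [^] i"] by (simp add: lam_mult chi1 C_eq)
  then have "g \<otimes> inv (x [^] i) \<in> K" using assms by (simp add: kerlam_def C_eq)
  then show ?thesis using that[of "g \<otimes> inv (x [^] i)" i] assms by (simp add: m_assoc)
qed

lemma x_central: "g \<in> carrier G \<Longrightarrow> g \<otimes> x = x \<otimes> g"
  using chi_comm chi1 by blast

lemma tw_x: "single x \<in> tw"
  unfolding tw_central using x_central by (simp add: single_conv_single)

text \<open>This is the centre of kK inside kG: G is generated by K and the central element x, so
  commuting with K is enough (\<open>A0I\<close>).\<close>

definition A0 :: "('a \<Rightarrow> 'k) set" where "A0 = tw \<inter> fspace K"

lemma conv_fspace_K: "f \<in> fspace K \<Longrightarrow> h \<in> fspace K \<Longrightarrow> f \<star> h \<in> fspace K"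
  by (rule conv_fspace[OF K_closed(2)])

lemma A0_closed:
  "single \<one> \<in> A0" "f \<in> A0 \<Longrightarrow> h \<in> A0 \<Longrightarrow> f \<star> h \<in> A0" "f \<in> A0 \<Longrightarrow> h \<in> A0 \<Longrightarrow> f - h \<in> A0"
  "f \<in> A0 \<Longrightarrow> smul c f \<in> A0" "f \<in> A0 \<Longrightarrow> f \<in> tw" "f \<in> A0 \<Longrightarrow> f \<in> fspace (carrier G)"
  using K_closed(4) by (auto simp: A0_def tw_one tw_conv tw_closed conv_fspace_K fspace_K)

lemma A0I:
  assumes f: "f \<in> fspace K" and c: "\<And>k. k \<in> K \<Longrightarrow> single k \<star> f = f \<star> single k" shows "f \<in> A0"
proof -
  have "single g \<star> f = f \<star> single g" if g: "g \<in> carrier G" for g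
  proof -
    obtain k i where ki: "k \<in> K" "g = k \<otimes> x [^] (i::nat)" using generated[OF g] .
    have fG: "f \<in> fspace (carrier G)" using fspace_K[OF f] .
    have xi: "single (x [^] i) \<in> tw"
      by (induction i) (simp_all add: tw_one tw_conv tw_x flip: single_conv_single)
    have e: "single g = single k \<star> single (x [^] i)" using ki K_closed(1) by (simp add: single_conv_single)
    have "single g \<star> f = single k \<star> f \<star> single (x [^] i)"
      using tw_comm'[OF xi fG] by (simp add: e conv_assoc)
    also have "\<dots> = f \<star> single g" using c[OF ki(1)] by (simp add: e conv_assoc)
    finally show ?thesis .
  qed
  then show ?thesis using f fspace_K[OF f] by (simp add: A0_def tw_central)
qed

lemma sum_K_shift: "k \<in> K \<Longrightarrow> (\<Sum>g\<in>K. F (k \<otimes> g)) = (\<Sum>g\<in>K. F g)"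
  by (rule sum.reindex_bij_witness[of _ "\<lambda>y. inv k \<otimes> y" "\<lambda>y. k \<otimes> y"])
    (use K_closed in auto)

lemma sum_const_K: "(\<Sum>g\<in>K. f) = smul (of_nat (card K)) f"
  by (auto simp: fun_eq_iff sum_fun_apply)

text \<open>Maschke: averaging a linear projection onto the ideal generated by \<open>b\<close> gives a right
  identity of that ideal.\<close>
lemma von_Neumann_regular_aux:
  assumes b: "b \<in> A0"
  obtains h where "h \<in> fspace K" "b = b \<star> (b \<star> h)"
proof -
  let ?N = "of_nat (card K) :: 'k"
  define S where "S = (\<lambda>h. b \<star> h) ` fspace K"
  have bt: "b \<in> tw" and bK: "b \<in> fspace K" using b by (auto simp: A0_def)
  have subS: "fun_vs.subspace S"
  proof (rule fun_vs.subspaceI)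
    show "0 \<in> S" unfolding S_def using conv_zero(2)[of b] by (metis fspace_closed(1) image_eqI)
    show "f + h \<in> S" if fh: "f \<in> S" "h \<in> S" for f h
    proof -
      obtain f' h' where "f' \<in> fspace K" "h' \<in> fspace K" "f = b \<star> f'" "h = b \<star> h'" using fh S_def by blast
      then show ?thesis unfolding S_def by (intro image_eqI[of _ _ "f' + h'"]) (simp_all add: conv_add_right)
    qed
    show "smul c f \<in> S" if f: "f \<in> S" for c f
    proof -
      obtain f' where "f' \<in> fspace K" "f = b \<star> f'" using f S_def by blast
      then show ?thesis unfolding S_def by (intro image_eqI[of _ _ "smul c f'"]) (simp_all add: conv_smul_right)
    qed
  qed
  have S_left: "single k \<star> s \<in> S" if k: "k \<in> K" and s: "s \<in> S" for k s
  proof -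
    obtain h where h: "h \<in> fspace K" "s = b \<star> h" using s S_def by blast
    have "single k \<star> s = b \<star> (single k \<star> h)"
      using bt k K_closed(1) h unfolding tw_central by (metis conv_assoc)
    moreover have "single k \<star> h \<in> fspace K" using k h by (simp add: conv_fspace_K)
    ultimately show ?thesis unfolding S_def by blast
  qed
  have bS: "b \<in> S" unfolding S_def
    using K_closed(4) bK tw_fspace[OF bt] by (intro image_eqI[of _ _ "single \<one>"]) simp_all
  obtain \<pi> where \<pi>: "range \<pi> \<subseteq> S" "Vector_Spaces.linear smul smul \<pi>" "\<And>s. s \<in> S \<Longrightarrow> \<pi> s = s"
    using fun_vsp.linear_exists_left_inverse_on[OF fun_vs.linear_id subS inj_on_id]
    by (auto simp: id_def)
  note lin = \<pi>(2)
  define \<rho> where "\<rho> a = smul (inverse ?N) (\<Sum>g\<in>K. single g \<star> \<pi> (single (inv g) \<star> a))" for a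
  have inS: "\<rho> a \<in> S" for a
    unfolding \<rho>_def using \<pi>(1) S_left
    by (intro fun_vs.subspace_scale[OF subS] fun_vs.subspace_sum[OF subS]) blast
  have fixS: "\<rho> s = s" if s: "s \<in> S" for s
  proof -
    have sG: "s \<in> fspace (carrier G)" using s by (auto simp: S_def)
    have "single g \<star> \<pi> (single (inv g) \<star> s) = s" if g: "g \<in> K" for g
    proof -
      have "\<pi> (single (inv g) \<star> s) = single (inv g) \<star> s" using \<pi>(3) S_left K_closed(3) g s by blast
      moreover have "single g \<star> (single (inv g) \<star> s) = s"
        using g K_closed(1) sG by (simp add: single_conv_single flip: conv_assoc)
      ultimately show ?thesis by simp
    qed
    then have "(\<Sum>g\<in>K. single g \<star> \<pi> (single (inv g) \<star> s)) = (\<Sum>g\<in>K. s)" by (intro sum.cong) auto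
    then show ?thesis unfolding \<rho>_def sum_const_K using card_K by (auto simp: fun_eq_iff)
  qed
  have equi: "\<rho> (single k) = single k \<star> \<rho> (single \<one>)" if k: "k \<in> K" for k
  proof -
    have "(\<Sum>g\<in>K. single g \<star> \<pi> (single (inv g) \<star> single k))
        = (\<Sum>g\<in>K. single (k \<otimes> g) \<star> \<pi> (single (inv (k \<otimes> g)) \<star> single k))"
      by (rule sum_K_shift[OF k, symmetric])
    also have "\<dots> = (\<Sum>g\<in>K. single k \<star> (single g \<star> \<pi> (single (inv g) \<star> single \<one>)))"
    proof (rule sum.cong[OF refl])
      fix g assume g: "g \<in> K"
      have "single (inv (k \<otimes> g)) \<star> single k = (single (inv g) \<star> single \<one> :: 'a \<Rightarrow> 'k)"
        using k g K_closed(1) by (simp add: single_conv_single inv_mult_group m_assoc)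
      moreover have "single (k \<otimes> g) = (single k \<star> single g :: 'a \<Rightarrow> 'k)"
        using k g K_closed(1) by (simp add: single_conv_single)
      ultimately show "single (k \<otimes> g) \<star> \<pi> (single (inv (k \<otimes> g)) \<star> single k)
          = single k \<star> (single g \<star> \<pi> (single (inv g) \<star> single \<one>))" by (simp add: conv_assoc)
    qed
    also have "\<dots> = single k \<star> (\<Sum>g\<in>K. single g \<star> \<pi> (single (inv g) \<star> single \<one>))"
      by (rule conv_sum_right[symmetric])
    finally show ?thesis unfolding \<rho>_def by (simp only: conv_smul_right)
  qed
  have \<rho>_sum: "\<rho> (\<Sum>k\<in>K. smul (c k) (single k)) = (\<Sum>k\<in>K. smul (c k) (\<rho> (single k)))" for c
  proof -
    have "single g \<star> \<pi> (single (inv g) \<star> (\<Sum>k\<in>K. smul (c k) (single k)))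
        = (\<Sum>k\<in>K. smul (c k) (single g \<star> \<pi> (single (inv g) \<star> single k)))" for g
      by (simp only: conv_sum_right conv_smul_right fun_vsp.linear_sum[OF lin] fun_vsp.linear_scale[OF lin])
    then have "(\<Sum>g\<in>K. single g \<star> \<pi> (single (inv g) \<star> (\<Sum>k\<in>K. smul (c k) (single k))))
        = (\<Sum>g\<in>K. \<Sum>k\<in>K. smul (c k) (single g \<star> \<pi> (single (inv g) \<star> single k)))" by (simp only:)
    also have "\<dots> = (\<Sum>k\<in>K. \<Sum>g\<in>K. smul (c k) (single g \<star> \<pi> (single (inv g) \<star> single k)))"
      by (rule sum.swap)
    finally show ?thesis unfolding \<rho>_def
      by (simp only: fun_vs.scale_sum_right fun_vs.scale_scale mult.commute[of "inverse ?N"])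
  qed
  \<comment> \<open>The averaged projection fixes b and commutes with left multiplication by K, so
    expanding b in group elements moves b out of the argument, leaving the value at 1, which lies in
    the ideal b kK.\<close>
  have "b = \<rho> b" using fixS[OF bS] by simp
  also have "\<dots> = \<rho> (\<Sum>k\<in>K. smul (b k) (single k))" using fspace_expand[OF K_fin bK] by simp
  also have "\<dots> = (\<Sum>k\<in>K. smul (b k) (single k \<star> \<rho> (single \<one>)))"
    unfolding \<rho>_sum by (rule sum.cong) (simp_all add: equi)
  also have "\<dots> = (\<Sum>k\<in>K. smul (b k) (single k)) \<star> \<rho> (single \<one>)"
    by (simp only: conv_sum_left conv_smul_left)
  also have "\<dots> = b \<star> \<rho> (single \<one>)" using fspace_expand[OF K_fin bK] by simp
  finally have "b = b \<star> \<rho> (single \<one>)" .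
  moreover obtain h where "h \<in> fspace K" "\<rho> (single \<one>) = b \<star> h" using inS unfolding S_def by blast
  ultimately show ?thesis using that by simp
qed

text \<open>The auxiliary h is averaged over conjugation by K to become central. As b is central,
  each conjugate solves the same equation.\<close>

lemma von_Neumann_regular:
  assumes b: "b \<in> A0"
  obtains h where "h \<in> A0" "b = b \<star> (b \<star> h)"
proof -
  let ?N = "of_nat (card K) :: 'k"
  obtain h0 where h0: "h0 \<in> fspace K" "b = b \<star> (b \<star> h0)" using von_Neumann_regular_aux[OF b] .
  have bt: "b \<in> tw" and bG: "b \<in> fspace (carrier G)" using A0_closed b by auto
  define s where "s = (\<Sum>g\<in>K. single g \<star> (h0 \<star> single (inv g)))"
  have sK: "s \<in> fspace K" unfolding s_def by (intro fspace_sum conv_fspace_K h0) (auto simp: K_closed)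
  have "single k \<star> s = s \<star> single k" if k: "k \<in> K" for k
  proof -
    have "s \<star> single k = (\<Sum>g\<in>K. single g \<star> (h0 \<star> single (inv g)) \<star> single k)" 
      unfolding s_def by (rule conv_sum_left)
    also have "\<dots> = (\<Sum>g\<in>K. single (k \<otimes> g) \<star> (h0 \<star> single (inv (k \<otimes> g))) \<star> single k)"
      by (rule sum_K_shift[OF k, symmetric])
    also have "\<dots> = (\<Sum>g\<in>K. single k \<star> (single g \<star> (h0 \<star> single (inv g))))"
    proof (rule sum.cong[OF refl])
      fix g assume g: "g \<in> K"
      have "single (inv (k \<otimes> g)) \<star> single k = (single (inv g) :: 'a \<Rightarrow> 'k)"
        using k g K_closed(1) by (simp add: single_conv_single inv_mult_group m_assoc)
      moreover have "single (k \<otimes> g) = (single k \<star> single g :: 'a \<Rightarrow> 'k)"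
        using k g K_closed(1) by (simp add: single_conv_single)
      ultimately show "single (k \<otimes> g) \<star> (h0 \<star> single (inv (k \<otimes> g))) \<star> single k
        = single k \<star> (single g \<star> (h0 \<star> single (inv g)))" by (simp add: conv_assoc)
    qed
    also have "\<dots> = single k \<star> s" unfolding s_def by (rule conv_sum_right[symmetric])
    finally show ?thesis by simp
  qed
  then have sA: "s \<in> A0" by (rule A0I[OF sK])
  have "b \<star> (b \<star> s) = (\<Sum>g\<in>K. b \<star> (b \<star> (single g \<star> (h0 \<star> single (inv g)))))"
    unfolding s_def by (simp only: conv_sum_right)
  also have "\<dots> = (\<Sum>g\<in>K. b)"
  proof (rule sum.cong[OF refl])
    fix g assume g: "g \<in> K"
    have c: "b \<star> (single g \<star> f) = single g \<star> (b \<star> f)" for f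
      using bt g K_closed(1) unfolding tw_central by (metis conv_assoc)
    have "b \<star> (b \<star> (single g \<star> (h0 \<star> single (inv g)))) = single g \<star> (b \<star> (b \<star> h0) \<star> single (inv g))"
      by (simp only: c conv_assoc)
    also have "\<dots> = single g \<star> (b \<star> single (inv g))" using h0(2) by simp
    also have "\<dots> = b" using g K_closed(1) bG by (simp add: single_conv_single flip: c)
    finally show "b \<star> (b \<star> (single g \<star> (h0 \<star> single (inv g)))) = b" .
  qed
  finally have e: "b \<star> (b \<star> s) = smul ?N b" by (simp only: sum_const_K)
  show ?thesis
  proof (rule that[of "smul (inverse ?N) s"])
    show "smul (inverse ?N) s \<in> A0" using A0_closed(4)[OF sA] .
    show "b = b \<star> (b \<star> smul (inverse ?N) s)"
      unfolding conv_smul_right e using card_K by (auto simp: fun_eq_iff)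
  qed
qed

definition idem_family :: "('a \<Rightarrow> 'k) set \<Rightarrow> bool" where
  "idem_family U \<longleftrightarrow> finite U \<and> U \<subseteq> A0 \<and> 0 \<notin> U \<and>
     (\<forall>u\<in>U. \<forall>v\<in>U. u \<star> v = (if u = v then u else 0)) \<and> (\<Sum>u\<in>U. u) = single \<one>"

text \<open>Multiplying a linear relation by v isolates the coefficient of v, so orthogonal
  idempotents are independent. The bound is what makes a family of maximal size exist.\<close>

lemma idem_family_card:
  assumes "idem_family U" shows "card U \<le> card (carrier G)"
proof (rule independent_card_le[OF fin])
  show "U \<subseteq> fspace (carrier G)" using assms A0_closed(6) by (auto simp: idem_family_def)
  show "fun_vs.independent U"
  proof (rule fun_vs.independent_if_scalars_zero)
    show "finite U" using assms by (simp add: idem_family_def)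
    fix c v assume c: "(\<Sum>u\<in>U. smul (c u) u) = 0" and v: "v \<in> U"
    have "0 = (\<Sum>u\<in>U. smul (c u) u) \<star> v" using c by simp
    also have "\<dots> = (\<Sum>u\<in>U. smul (c u) (u \<star> v))" by (simp only: conv_sum_left conv_smul_left)
    also have "\<dots> = (\<Sum>u\<in>U. if u = v then smul (c u) u else 0)"
      using assms v by (intro sum.cong) (auto simp: idem_family_def fun_eq_iff)
    also have "\<dots> = smul (c v) v" using v \<open>finite U\<close> by (simp only: sum.delta if_True)
    finally have "smul (c v) v = 0" by simp
    moreover have "v \<noteq> 0" using assms v by (auto simp: idem_family_def)
    ultimately show "c v = 0" by (simp add: fun_vs.scale_eq_0_iff)
  qed
qed

text \<open>An eigenvector \<open>b\<close> of multiplication by \<open>a\<close> on the block of \<open>u\<close> generates an idempotent \<open>w\<close>.\<close>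
lemma eigen_idempotent:
  assumes u: "u \<in> A0" "u \<noteq> 0" "u \<star> u = u" and a: "a \<in> A0" "u \<star> a = a"
  obtains w \<alpha> where "w \<in> A0" "w \<noteq> 0" "w \<star> w = w" "u \<star> w = w" "a \<star> w = smul \<alpha> w"
proof -
  define M where "M = card (carrier G) - 1"
  have N: "Suc M = card (carrier G)" using fin one_closed card_gt_0_iff[of "carrier G"] by (auto simp: M_def)
  \<comment> \<open>The powers of a in the block with unit u, so that \<open>ev\<close> is
    evaluation of polynomials at a and the least annihilating degree \<open>d\<close> is that of the
    minimal polynomial.\<close>
  define bb where "bb i = ((\<star>) a ^^ i) u" for i
  have bA: "bb i \<in> A0" and ub: "u \<star> bb i = bb i" for i
    using u a A0_closed(2,5) by (induction i) (auto simp: bb_def tw_ac(2))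
  define ev where "ev q = (\<Sum>i\<le>Suc M. smul (coeff q i) (bb i))" for q
  obtain q1 where "q1 \<noteq> 0" "degree q1 \<le> Suc M" "ev q1 = 0"
    using annihilating_poly[OF fin, of bb "Suc M"] bA A0_closed(6) N unfolding ev_def by metis
  then have ex: "\<exists>d. \<exists>q. q \<noteq> 0 \<and> degree q \<le> Suc M \<and> ev q = 0 \<and> degree q = d" by blast
  define d where "d = (LEAST d. \<exists>q. q \<noteq> 0 \<and> degree q \<le> Suc M \<and> ev q = 0 \<and> degree q = d)"
  obtain q where q: "q \<noteq> 0" "degree q \<le> Suc M" "ev q = 0" "degree q = d"
    using LeastI_ex[OF ex] unfolding d_def[symmetric] by blast
  have min: "ev r \<noteq> 0" if "r \<noteq> 0" "degree r < d" for r
  proof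
    assume "ev r = 0"
    then have "d \<le> degree r" unfolding d_def using that q by (intro Least_le) (metis less_imp_le order_trans)
    then show False using that by simp
  qed
  have "degree q > 0"
  proof (rule ccontr)
    assume "\<not> degree q > 0"
    then obtain c where c: "q = [:c:]" by (auto elim: degree_eq_zeroE)
    have "ev q = (\<Sum>i\<le>Suc M. if i = 0 then smul c u else 0)"
      unfolding ev_def by (rule sum.cong) (auto simp: c bb_def coeff_pCons fun_eq_iff split: nat.split)
    also have "\<dots> = smul c u" by (simp only: sum.delta finite_atMost atMost_iff if_True le0)
    finally show False using q(1,3) c u(2) by (simp add: fun_vs.scale_eq_0_iff)
  qed
  then obtain \<alpha> where "poly q \<alpha> = 0" using alg_closed_imp_poly_has_root by blast
  then obtain r where r: "q = [:-\<alpha>, 1:] * r" by (auto simp: poly_eq_0_iff_dvd)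
  have r0: "r \<noteq> 0" using q(1) r by auto
  have "degree ([:-\<alpha>, 1:] * r) = degree [:-\<alpha>, 1:] + degree r" using r0 by (intro degree_mult_eq) auto
  then have dr: "degree r < d" using q(4) r by simp
  have rM: "coeff r (Suc M) = 0" using dr q(2,4) by (intro coeff_eq_0) linarith
  \<comment> \<open>With q = (X - \<alpha>) r, the element r(a) is nonzero by minimality of the
    degree of q and is killed by a - \<alpha>.\<close>
  define b where "b = ev r"
  have b0: "b \<noteq> 0" unfolding b_def by (rule min[OF r0 dr])
  have "ev q = smul (-\<alpha>) (ev r) + (\<Sum>i\<le>Suc M. smul (coeff (pCons 0 r) i) (bb i))"
    unfolding ev_def r fun_vs.scale_sum_right sum.distrib[symmetric]
    by (rule sum.cong) (auto simp: fun_eq_iff algebra_simps)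
  also have "(\<Sum>i\<le>Suc M. smul (coeff (pCons 0 r) i) (bb i))
      = smul (coeff (pCons 0 r) 0) (bb 0) + (\<Sum>i\<le>M. smul (coeff (pCons 0 r) (Suc i)) (bb (Suc i)))"
    by (rule sum.atMost_Suc_shift)
  also have "\<dots> = (\<Sum>i\<le>M. a \<star> smul (coeff r i) (bb i))"
    by (simp add: bb_def conv_smul_right)
  also have "\<dots> = a \<star> (\<Sum>i\<le>M. smul (coeff r i) (bb i))" by (rule conv_sum_right[symmetric])
  also have "(\<Sum>i\<le>M. smul (coeff r i) (bb i)) = b"
    unfolding b_def ev_def sum.atMost_Suc rM by simp
  finally have "0 = smul (-\<alpha>) b + a \<star> b" unfolding q(3) b_def .
  then have ab: "a \<star> b = smul \<alpha> b" by (auto simp: fun_eq_iff)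
  have bA0: "b \<in> A0"
    using bA unfolding b_def ev_def A0_def by (auto intro!: tw_sum fspace_sum tw_closed)
  have "u \<star> b = (\<Sum>i\<le>Suc M. smul (coeff r i) (u \<star> bb i))"
    unfolding b_def ev_def by (simp only: conv_sum_right conv_smul_right)
  then have ubb: "u \<star> b = b" unfolding ub b_def ev_def .
  \<comment> \<open>Regularity turns the eigenvector into an idempotent: from b = b b h it follows
    that b h is idempotent, and as a multiple of b it is still an eigenvector.\<close>
  obtain h where h: "h \<in> A0" "b = b \<star> (b \<star> h)" using von_Neumann_regular[OF bA0] .
  show ?thesis
  proof (rule that[of "b \<star> h" \<alpha>])
    show "b \<star> h \<in> A0" using A0_closed(2)[OF bA0 h(1)] .
    show "b \<star> h \<noteq> 0"
    proof
      assume "b \<star> h = 0"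
      then show False using h(2) b0 by simp
    qed
    have "(b \<star> h) \<star> (b \<star> h) = (b \<star> (b \<star> h)) \<star> h"
      using A0_closed(5) bA0 h(1) by (simp add: conv_assoc tw_ac(2)[of h b])
    then show "(b \<star> h) \<star> (b \<star> h) = b \<star> h" using h(2) by simp
    show "u \<star> (b \<star> h) = b \<star> h" using ubb by (simp flip: conv_assoc)
    show "a \<star> (b \<star> h) = smul \<alpha> (b \<star> h)" using ab by (simp add: conv_smul_left flip: conv_assoc)
  qed
qed

text \<open>A family of maximal size does the job: if u a were not a multiple of u, an
  eigen-idempotent w in the block of u would differ from u, and replacing u by w and u - w would
  give a larger family.\<close>

lemma idempotent_basis:
  obtains U where "idem_family U" "\<And>u a. u \<in> U \<Longrightarrow> a \<in> A0 \<Longrightarrow> \<exists>c. u \<star> a = smul c u"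
proof -
  have "(\<Sum>u\<in>{single \<one>}. u) = (single \<one> :: 'a \<Rightarrow> 'k)" by (simp only: sum.insert sum.empty finite.emptyI empty_iff not_False_eq_True add_0_right)
  moreover have "single \<one> \<noteq> (0 :: 'a \<Rightarrow> 'k)"
  proof
    assume "single \<one> = (0 :: 'a \<Rightarrow> 'k)"
    then have "single \<one> \<one> = (0::'k)" by (metis zero_fun_apply)
    then show False by (simp add: single_def)
  qed
  ultimately have ex: "idem_family {single \<one>}" unfolding idem_family_def
    using A0_closed(1) by (auto simp: single_conv_single)
  obtain U where U: "idem_family U" "\<And>V. idem_family V \<Longrightarrow> card V \<le> card U"
  proof -
    have "\<exists>U. idem_family U \<and> (\<forall>V. idem_family V \<longrightarrow> card V \<le> card U)"
      by (rule ex_has_greatest_nat[where k = "{single \<one>}" and b = "Suc (card (carrier G))"])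
        (use ex idem_family_card in \<open>auto simp: less_Suc_eq_le\<close>)
    then show ?thesis using that by auto
  qed
  have Ufin: "finite U" and UA: "\<And>u. u \<in> U \<Longrightarrow> u \<in> A0" and U0: "\<And>u. u \<in> U \<Longrightarrow> u \<noteq> 0"
    and orth: "\<And>u v. u \<in> U \<Longrightarrow> v \<in> U \<Longrightarrow> u \<star> v = (if u = v then u else 0)" and Usum: "(\<Sum>u\<in>U. u) = single \<one>"
    using U(1) unfolding idem_family_def by auto
  have "\<exists>c. u \<star> a = smul c u" if u: "u \<in> U" and a: "a \<in> A0" for u a
  proof (rule ccontr)
    assume no: "\<nexists>c. u \<star> a = smul c u"
    have uu: "u \<star> u = u" using orth[OF u u] by simp
    have ua: "u \<star> a \<in> A0" "u \<star> (u \<star> a) = u \<star> a"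
      using A0_closed(2)[OF UA[OF u] a] uu by (simp_all flip: conv_assoc)
    obtain w \<alpha> where w: "w \<in> A0" "w \<noteq> 0" "w \<star> w = w" "u \<star> w = w" "(u \<star> a) \<star> w = smul \<alpha> w"
      using eigen_idempotent[OF UA[OF u] U0[OF u] uu ua] .
    have tw: "u \<in> tw" "w \<in> tw" "a \<in> tw" using UA u w a A0_closed(5) by auto
    have wu: "w \<star> u = w" using w(4) tw_ac(1)[OF tw(1,2)] by simp
    have "w \<noteq> u"
    proof
      assume "w = u"
      then have "(u \<star> a) \<star> u = smul \<alpha> u" using w(5) by simp
      moreover have "(u \<star> a) \<star> u = u \<star> a" using tw uu by (metis conv_assoc tw_ac(1))
      ultimately show False using no by metis
    qed
    define w' where "w' = u - w"
    have w'0: "w' \<noteq> 0" using \<open>w \<noteq> u\<close> by (simp add: w'_def)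
    have w': "w' \<in> A0" "u \<star> w' = w'" "w' \<star> u = w'" "w \<star> w' = 0" "w' \<star> w = 0" "w' \<star> w' = w'"
      using A0_closed(3)[OF UA[OF u] w(1)] uu w(3,4) wu
      by (simp_all add: w'_def conv_diff_left conv_diff_right)
    have ww': "w \<noteq> w'" using w'(4) w(2,3) by auto
    let ?R = "U - {u}"
    have offu: "v \<star> t = 0" "t \<star> v = 0" if v: "v \<in> ?R" and t: "t = w \<or> t = w'" for v t
    proof -
      have ut: "u \<star> t = t" "t \<star> u = t" using t w(4) wu w' by auto
      have vu: "v \<star> u = 0" "u \<star> v = 0" using orth v u by auto
      have "v \<star> t = v \<star> u \<star> t" using ut by (simp add: conv_assoc)
      then show "v \<star> t = 0" using vu by simp
      have "t \<star> v = t \<star> (u \<star> v)" using ut by (simp flip: conv_assoc)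
      then show "t \<star> v = 0" using vu by simp
    qed
    have wR: "w \<notin> ?R" using offu(1)[of w w] w(2,3) by auto
    have w'R: "w' \<notin> ?R" using offu(1)[of w' w'] w'0 w'(6) by auto
    let ?V = "insert w (insert w' ?R)"
    have "idem_family ?V"
      unfolding idem_family_def
    proof (intro conjI ballI)
      show "finite ?V" using Ufin by simp
      show "?V \<subseteq> A0" using UA w w' by auto
      show "0 \<notin> ?V" using U0 w w'0 by auto
      have "(\<Sum>v\<in>?V. v) = w + (w' + (\<Sum>v\<in>?R. v))" using Ufin ww' wR w'R by (simp only: sum.insert finite_insert finite_Diff insert_iff not_False_eq_True de_Morgan_disj simp_thms)
      also have "\<dots> = u + (\<Sum>v\<in>?R. v)" by (simp add: w'_def)
      also have "\<dots> = single \<one>" using sum.remove[OF Ufin u, of "\<lambda>v. v"] Usum by simp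
      finally show "(\<Sum>v\<in>?V. v) = single \<one>" .
      fix s t assume st: "s \<in> ?V" "t \<in> ?V"
      show "s \<star> t = (if s = t then s else 0)"
      proof (cases "s \<in> ?R")
        case True
        then show ?thesis using st offu[of s] orth[of s t] wR w'R by auto
      next
        case False
        then have s: "s = w \<or> s = w'" using st by blast
        then show ?thesis
        proof (cases "t \<in> ?R")
          case True then show ?thesis using offu[of t s] s wR w'R by auto
        next
          case False
          then have "t = w \<or> t = w'" using st by blast
          then show ?thesis using s w(3) w' ww' by auto
        qed
      qed
    qed
    then have "card ?V \<le> card U" by (rule U(2))
    moreover have "card ?V = Suc (card U)"
      using Ufin ww' wR w'R u card_Suc_Diff1[OF Ufin u] by simp
    ultimately show False by simp
  qed
  then show ?thesis using that U(1) by blast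
qed

end

section \<open>The direct product case\<close>

context split_group
begin

definition y :: "'a \<Rightarrow> 'k" where "y = single x - single \<one>"

text \<open>The product \<open>*\<close> of functions is pointwise; powers with respect to
  convolution are therefore iterated explicitly.\<close>

definition ypow :: "nat \<Rightarrow> 'a \<Rightarrow> 'k" where "ypow i = ((\<star>) y ^^ i) (single \<one>)"

abbreviation xi :: "'a \<Rightarrow> 'k" where "xi \<equiv> single (inv x)"

lemma ypow_simps [simp]: "ypow 0 = single \<one>" "ypow (Suc i) = y \<star> ypow i"
  by (simp_all add: ypow_def)

lemma y_tw [simp]: "y \<in> tw" unfolding y_def by (intro tw_closed tw_x tw_one)

lemma ypow_tw [simp]: "ypow i \<in> tw" by (induction i) (simp_all add: tw_one tw_conv)

lemma xi_tw [simp]: "xi \<in> tw"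
proof -
  have "g \<otimes> inv x = inv x \<otimes> g" if "g \<in> carrier G" for g
  proof -
    have "inv x \<otimes> (g \<otimes> x) \<otimes> inv x = inv x \<otimes> (x \<otimes> g) \<otimes> inv x" using x_central[OF that] by simp
    then show ?thesis using that by (simp add: m_assoc)
  qed
  then show ?thesis unfolding tw_central by (simp add: single_conv_single)
qed

lemma ypow_add: "ypow (i + j) = ypow i \<star> ypow j"
  using tw_fspace[OF ypow_tw] by (induction i) (simp_all add: conv_assoc)

lemma lam_derivation:
  assumes "h \<in> fspace (carrier G)" shows "lam * (h \<star> h') = (lam * h) \<star> h' + h \<star> (lam * h')"
proof -
  have "chi * h = h" using assms chi1 by (fastforce simp: fun_eq_iff fspace_def)
  then show ?thesis using lam_conv[of h h'] by simp
qed

lemma lam_single: "lam * single g = smul (lam g) (single g)"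
  by (auto simp: fun_eq_iff single_def)

lemma smul_1_0 [simp]: "smul 1 f = f" "smul 0 f = (0 :: 'a \<Rightarrow> 'k)"
  by (auto simp: fun_eq_iff)

lemma lam_smul: "lam * smul c f = smul c (lam * f)"
  by (auto simp: fun_eq_iff)

text \<open>Since \<open>lam\<close> maps y = x - 1 to x, it acts as x d/dy on powers of y.\<close>

lemma lam_ypow: "lam * ypow (Suc i) = smul (of_nat (Suc i)) (ypow i \<star> single x)"
proof (induction i)
  have ly: "lam * y = single x" by (simp add: y_def right_diff_distrib lam_single)
  {
    case 0
    show ?case using ly tw_fspace[OF y_tw] tw_fspace[OF tw_x] by (simp add: lam_single)
  next
    case (Suc i)
    have "lam * ypow (Suc (Suc i)) = single x \<star> ypow (Suc i) + y \<star> smul (of_nat (Suc i)) (ypow i \<star> single x)"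
      unfolding ypow_simps(2)[of "Suc i"] lam_derivation[OF tw_fspace[OF y_tw]] ly
      by (simp only: Suc.IH)
    also have "y \<star> smul (of_nat (Suc i)) (ypow i \<star> single x) = smul (of_nat (Suc i)) (ypow (Suc i) \<star> single x)"
      by (simp only: conv_smul_right ypow_simps conv_assoc)
    also have "single x \<star> ypow (Suc i) = ypow (Suc i) \<star> single x" by (rule tw_ac[OF tw_x ypow_tw])
    finally show ?case by (simp add: fun_eq_iff algebra_simps)
  }
qed

lemma x_pow_lam: "lam (x [^] (i::nat)) = of_nat i"
  by (induction i) (simp_all add: lam_mult chi1)

lemma ypow_P: "ypow i \<in> fspace P"
proof (induction i)
  case (Suc i)
  show ?case
  proof (rule fspaceI)
    fix z assume z: "z \<notin> P"
    show "ypow (Suc i) z = 0"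
    proof (cases "z \<in> carrier G")
      case True
      have "inv x \<otimes> z \<notin> P" using P_mult[OF x_in_P, of "inv x \<otimes> z"] z True by auto
      then show ?thesis
        using z True fspaceD[OF Suc] by (simp add: y_def conv_diff_left single_conv)
    qed (simp add: conv_out)
  qed
qed (simp add: P_one)

text \<open>\<open>y ^ p\<close> is killed by the derivation \<open>lam\<close>, so it is a scalar; its augmentation is zero.\<close>
lemma ypow_p: "ypow p = 0"
proof -
  obtain m where m: "p = Suc m" using p_gt1 by (cases p) auto
  have "lam * ypow p = smul (of_nat p) (ypow m \<star> single x)" unfolding m by (rule lam_ypow)
  then have l0: "lam * ypow p = 0" by (simp add: p_char)
  have off: "ypow p g = 0" if "g \<noteq> \<one>" for g
  proof (cases "g \<in> P")
    case True
    then obtain i where i: "g = x [^] (i::nat)" unfolding P_eq by blast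
    have "lam g \<noteq> 0"
    proof
      assume "lam g = 0"
      then have "p dvd i" using x_pow_lam[of i] i p_char by (simp add: of_nat_eq_0_iff_char_dvd)
      then obtain d where "i = p * d" by (rule dvdE)
      then have "g = \<one>" using i x_pow_p by (simp add: nat_pow_pow[symmetric])
      then show False using that by simp
    qed
    moreover have "lam g * ypow p g = 0" using fun_cong[OF l0, of g] by simp
    ultimately show ?thesis by simp
  qed (rule fspaceD[OF ypow_P])
  have "(\<Sum>z\<in>carrier G. ypow p z) = (\<Sum>z\<in>carrier G. ypow m (inv x \<otimes> z)) - (\<Sum>z\<in>carrier G. ypow m z)"
    unfolding m by (simp add: y_def conv_diff_left single_conv sum_subtractf)
  also have "\<dots> = 0" using sum_shift_left[of "inv x" "ypow m"] by simp
  finally have "(\<Sum>z\<in>carrier G. ypow p z) = 0" .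
  moreover have "(\<Sum>z\<in>carrier G. ypow p z) = (\<Sum>z\<in>{\<one>}. ypow p z)"
    by (rule sum.mono_neutral_right) (auto simp: off)
  ultimately have "ypow p \<one> = 0" by simp
  then show ?thesis using off by (metis ext zero_fun_apply)
qed

lemma ypow_ge: "p \<le> i \<Longrightarrow> ypow i = 0"
  using ypow_add[of p "i - p"] ypow_p by simp

definition Theta :: "'k fps \<Rightarrow> 'a \<Rightarrow> 'k" where
  "Theta F = (\<Sum>i<p. smul (fps_nth F i) (ypow i))"

lemma Theta_tw [simp]: "Theta F \<in> tw"
  unfolding Theta_def by (intro tw_sum tw_closed ypow_tw)

lemma Theta_linear:
  "Theta (F + H) = Theta F + Theta H" "Theta (F - H) = Theta F - Theta H"
  "Theta (fps_const c * F) = smul c (Theta F)" "Theta 0 = 0"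
  by (auto simp: Theta_def fun_eq_iff sum_fun_apply algebra_simps sum.distrib sum_subtractf sum_distrib_left)

lemma Theta_sum: "Theta (\<Sum>i\<in>A. F i) = (\<Sum>i\<in>A. Theta (F i))"
proof (induction A rule: infinite_finite_induct)
  case (insert a A)
  then show ?case by (simp only: sum.insert Theta_linear not_False_eq_True)
qed (simp_all only: sum.infinite sum.empty Theta_linear not_False_eq_True)

lemma Theta_trunc: "Theta (Abs_fps (trunc p F)) = Theta F"
  unfolding Theta_def by (rule sum.cong) (auto simp: trunc_def)

lemma Theta_1: "Theta 1 = single \<one>"
proof -
  have "Theta 1 = (\<Sum>i<p. if i = 0 then single \<one> else 0)"
    unfolding Theta_def by (rule sum.cong) auto
  also have "\<dots> = single \<one>" using p_gt1 by (simp only: sum.delta finite_lessThan lessThan_iff) simp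
  finally show ?thesis .
qed

lemma Theta_X: "Theta fps_X = y"
proof -
  have "Theta fps_X = (\<Sum>i<p. if i = 1 then y else 0)"
    unfolding Theta_def by (rule sum.cong) (auto simp: tw_fspace)
  also have "\<dots> = y" using p_gt1 by (simp only: sum.delta finite_lessThan lessThan_iff) simp
  finally show ?thesis .
qed

text \<open>\<open>Theta\<close> evaluates at y. The product of series sums over i + j < p, the
  product of values over all i, j < p; the extra terms vanish because y^p = 0.\<close>

lemma Theta_mult: "Theta (F * H) = Theta F \<star> Theta H"
proof
  fix z
  let ?S = "{(i, j). i + j < p}"
  let ?t = "\<lambda>i j. fps_nth F i * fps_nth H j * ypow (i + j) z"
  have "Theta (F * H) z = (\<Sum>n<p. \<Sum>i\<le>n. ?t i (n - i))"
    unfolding Theta_def sum_fun_apply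
    by (rule sum.cong) (auto simp: fps_mult_nth atLeast0AtMost sum_distrib_right)
  also have "\<dots> = (\<Sum>(i, j)\<in>?S. ?t i j)" by (rule sum.triangle_reindex[symmetric])
  also have "\<dots> = (\<Sum>(i, j)\<in>{..<p} \<times> {..<p}. ?t i j)"
  proof (rule sum.mono_neutral_left)
    show "\<forall>ij\<in>{..<p} \<times> {..<p} - ?S. (case ij of (i, j) \<Rightarrow> ?t i j) = 0"
    proof
      fix ij assume "ij \<in> {..<p} \<times> {..<p} - ?S"
      then obtain i j where "ij = (i, j)" "p \<le> i + j" by (cases ij) (auto simp: not_less)
      then show "(case ij of (i, j) \<Rightarrow> ?t i j) = 0" using ypow_ge[of "i + j"] by simp
    qed
  qed auto
  also have "\<dots> = (\<Sum>i<p. \<Sum>j<p. ?t i j)" by (rule sum.cartesian_product[symmetric])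
  also have "\<dots> = (Theta F \<star> Theta H) z"
    unfolding Theta_def conv_sum_left unfolding conv_sum_right sum_fun_apply
    by (intro sum.cong refl) (simp add: conv_smul_left conv_smul_right ypow_add mult_ac)
  finally show "Theta (F * H) z = (Theta F \<star> Theta H) z" .
qed

lemma lam_Theta: "lam * Theta F = Theta (fps_deriv F) \<star> single x"
proof -
  obtain m where m: "p = Suc m" using p_gt1 by (cases p) auto
  have p0: "of_nat (Suc m) = (0::'k)" unfolding m[symmetric] by (simp add: p_char)
  have "lam * Theta F = (\<Sum>i<Suc m. smul (fps_nth F i) (lam * ypow i))"
    unfolding Theta_def sum_distrib_left lam_smul unfolding m ..
  also have "\<dots> = smul (fps_nth F 0) (lam * ypow 0) + (\<Sum>i<m. smul (fps_nth F (Suc i)) (lam * ypow (Suc i)))"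
    by (rule sum.lessThan_Suc_shift)
  also have "\<dots> = (\<Sum>i<m. smul (fps_nth F (Suc i)) (lam * ypow (Suc i)))"
    by (simp add: lam_single del: ypow_simps(2))
  also have "\<dots> = (\<Sum>i<m. smul (fps_nth (fps_deriv F) i) (ypow i) \<star> single x)"
    unfolding lam_ypow conv_smul_left by (rule sum.cong) (auto simp: fun_eq_iff algebra_simps)
  \<comment> \<open>The derivative shifts indices, so one term is missing; its coefficient is p
    times a coefficient of F, which is zero.\<close>
  also have "\<dots> = (\<Sum>i<Suc m. smul (fps_nth (fps_deriv F) i) (ypow i) \<star> single x)"
  proof -
    have "smul (fps_nth (fps_deriv F) m) (ypow m) = 0" using p0 by (simp add: fun_eq_iff del: of_nat_Suc)
    then show ?thesis by (simp only: sum.lessThan_Suc conv_zero add_0_right)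
  qed
  also have "\<dots> = Theta (fps_deriv F) \<star> single x" unfolding Theta_def unfolding m by (rule conv_sum_left[symmetric])
  finally show ?thesis .
qed

lemma x_xi: "single x \<star> xi = single \<one>" by (simp add: single_conv_single)

text \<open>The inverse of x cancels the x in x d/dy. It contributes a second term, as
  \<open>lam\<close> is -1 on it, but that term will be symmetric in the two arguments of the
  bracket and cancel.\<close>

lemma lam_Theta_xi: "lam * (Theta F \<star> xi) = Theta (fps_deriv F) - Theta F \<star> xi"
proof -
  have l: "lam (inv x) = - 1" using lam_C_inv[of x] by (simp add: C_eq)
  have "lam * (Theta F \<star> xi) = Theta (fps_deriv F) \<star> (single x \<star> xi) + Theta F \<star> smul (-1) xi"
    using lam_derivation[OF tw_fspace[OF Theta_tw], of F xi] by (simp add: lam_Theta lam_single l conv_assoc)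
  also have "\<dots> = Theta (fps_deriv F) + smul (-1) (Theta F \<star> xi)"
    using conv_one(2)[OF tw_fspace[OF Theta_tw]] by (simp only: x_xi conv_smul_right)
  finally show ?thesis by (simp add: fun_eq_iff)
qed

lemma lam_A0: "u \<in> A0 \<Longrightarrow> lam * u = 0"
  by (auto simp: fun_eq_iff A0_def kerlam_def fspace_def C_eq)

lemma lam_A0_conv: "u \<in> A0 \<Longrightarrow> lam * (u \<star> h) = u \<star> (lam * h)"
  using lam_derivation[of u h] lam_A0[of u] A0_closed(6) by simp

lemma conv_x_eq_0: "(f :: 'a \<Rightarrow> 'k) \<in> fspace (carrier G) \<Longrightarrow> f \<star> single x = 0 \<Longrightarrow> f = 0"
  using x_xi conv_assoc[of f "single x" xi] by simp

text \<open>\<open>lam\<close> kills u, so applying it to u y^(i+1) = 0 gives (i+1) u y^i x = 0, and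
  i + 1 is invertible below p.\<close>

lemma A0_ypow_nonzero:
  assumes u: "u \<in> A0" "u \<noteq> 0" shows "i < p \<Longrightarrow> u \<star> ypow i \<noteq> 0"
proof (induction i)
  case 0
  have "u \<star> ypow 0 = u" using u A0_closed(6) by simp
  then show ?case using u(2) by metis
next
  case (Suc i)
  show ?case
  proof
    assume "u \<star> ypow (Suc i) = 0"
    then have "u \<star> (lam * ypow (Suc i)) = 0" using lam_A0_conv[OF u(1), of "ypow (Suc i)"] by simp
    then have "smul (of_nat (Suc i)) (u \<star> ypow i \<star> single x) = 0"
      unfolding lam_ypow by (simp only: conv_smul_right conv_assoc)
    moreover have "\<not> p dvd Suc i" using Suc.prems by (auto dest: dvd_imp_le)
    then have "of_nat (Suc i) \<noteq> (0::'k)" unfolding p_char of_nat_eq_0_iff_char_dvd .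
    ultimately have "u \<star> ypow i \<star> single x = 0" by (simp add: fun_vs.scale_eq_0_iff)
    then have "u \<star> ypow i = 0" by (rule conv_x_eq_0[OF conv_in])
    then show False using Suc.IH Suc.prems by (metis Suc_lessD)
  qed
qed

text \<open>Multiplication by y^(p-1-i) kills the terms above i, induction those below, and u
  y^(p-1) is not zero.\<close>

lemma Theta_inj:
  assumes u: "u \<in> A0" "u \<noteq> 0" and z: "u \<star> Theta F = 0" shows "i < p \<Longrightarrow> fps_nth F i = 0"
proof (induction i rule: less_induct)
  case (less i)
  have "0 = u \<star> Theta F \<star> ypow (p - 1 - i)" using z by simp
  also have "\<dots> = (\<Sum>l<p. smul (fps_nth F l) (u \<star> ypow (l + (p - 1 - i))))"
    unfolding Theta_def by (simp only: conv_sum_left conv_sum_right conv_smul_left conv_smul_right conv_assoc ypow_add)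
  also have "\<dots> = (\<Sum>l<p. if l = i then smul (fps_nth F i) (u \<star> ypow (p - 1)) else 0)"
  proof (rule sum.cong[OF refl])
    fix l assume "l \<in> {..<p}"
    consider "l < i" | "l = i" | "l > i" by linarith
    then show "smul (fps_nth F l) (u \<star> ypow (l + (p - 1 - i)))
        = (if l = i then smul (fps_nth F i) (u \<star> ypow (p - 1)) else 0)"
    proof cases
      case 1 then show ?thesis using less by simp
    next
      case 2 then show ?thesis using less.prems by simp
    next
      case 3
      then have "ypow (l + (p - 1 - i)) = 0" using less.prems by (intro ypow_ge) linarith
      then show ?thesis using 3 by simp
    qed
  qed
  also have "\<dots> = smul (fps_nth F i) (u \<star> ypow (p - 1))"
    using less.prems by (simp only: sum.delta finite_lessThan lessThan_iff if_True)
  finally have "smul (fps_nth F i) (u \<star> ypow (p - 1)) = 0" by simp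
  then show ?case using A0_ypow_nonzero[OF u, of "p - 1"] p_gt1 by (simp add: fun_vs.scale_eq_0_iff)
qed

lemma single_x_pow: "single (x [^] (i::nat)) = Theta ((1 + fps_X) ^ i)"
proof (induction i)
  case (Suc i)
  have "Theta (1 + fps_X) = single x" by (simp add: Theta_linear Theta_1 Theta_X y_def)
  then have "Theta ((1 + fps_X) ^ Suc i) = single (x [^] i) \<star> single x"
    by (simp only: power_Suc2 Theta_mult Suc.IH)
  then show ?case by (simp add: single_conv_single)
qed (simp add: Theta_1)

text \<open>Cutting f along the values of \<open>lam\<close> gives pieces supported on the cosets of
  K; dividing the i-th piece by the central element x^i moves it into the centre of kK.\<close>

lemma tw_decompose:
  assumes f: "f \<in> tw"
  obtains a where "\<And>i. a i \<in> A0" "f = (\<Sum>i<p. a i \<star> single (x [^] i))"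
proof -
  define r where "r i = (\<lambda>g. if lam g = of_nat i then f g else 0)" for i :: nat
  have rtw: "r i \<in> tw" for i
    using f lam_conj chi1 unfolding tw_iff by (auto simp: r_def C_eq fspace_def)
  have itw: "single (inv (x [^] i)) \<in> tw" for i :: nat
  proof (induction i)
    case 0 then show ?case using tw_one by simp
  next
    case (Suc i)
    have "single (inv (x [^] Suc i)) = xi \<star> single (inv (x [^] i))"
      by (simp add: single_conv_single inv_mult_group)
    then show ?case using Suc tw_conv[OF xi_tw] by simp
  qed
  define a where "a i = r i \<star> single (inv (x [^] i))" for i :: nat
  have aA: "a i \<in> A0" for i
  proof -
    have "a i z = 0" if z: "z \<notin> K" for z
    proof (cases "z \<in> carrier G")
      case True
      have "a i z = r i (z \<otimes> x [^] i)" using True by (simp add: a_def conv_single)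
      moreover have "lam (z \<otimes> x [^] i) \<noteq> of_nat i"
        using z True by (simp add: lam_mult chi1 x_pow_lam kerlam_def C_eq)
      ultimately show ?thesis by (simp add: r_def)
    qed (simp add: a_def conv_out)
    then show ?thesis using tw_conv[OF rtw itw, of i i] by (auto simp: A0_def a_def fspace_def)
  qed
  have ar: "a i \<star> single (x [^] i) = r i" for i
    using tw_fspace[OF rtw, of i] by (simp add: a_def conv_assoc single_conv_single)
  have "f = (\<Sum>i<p. r i)"
  proof
    fix g
    show "f g = (\<Sum>i<p. r i) g"
    proof (cases "g \<in> carrier G")
      case True
      obtain i where i: "i < p" "lam g = of_nat i" using lam_nat[OF True] by blast
      have "(of_nat j :: 'k) = of_nat i \<longleftrightarrow> j = i" if "j < p" for j
      proof (cases j i rule: linorder_cases)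
        case less
        have "\<not> p dvd i - j" using less i(1) by (auto dest: dvd_imp_le)
        then show ?thesis using of_nat_eq_iff_char_dvd[OF less, where 'a = 'k] p_char less by simp
      next
        case greater
        have "\<not> p dvd j - i" using greater that by (auto dest: dvd_imp_le)
        then show ?thesis using of_nat_eq_iff_char_dvd[OF greater, where 'a = 'k] p_char greater by simp
      qed simp
      then have "(\<Sum>j<p. r j) g = (\<Sum>j<p. if j = i then f g else 0)"
        unfolding sum_fun_apply r_def i(2) by (intro sum.cong refl) (metis lessThan_iff)
      also have "\<dots> = f g" using i(1) by simp
      finally show ?thesis by simp
    next
      case False
      then have "f g = 0" using fspaceD[OF tw_fspace[OF f]] by blast
      then have "r i g = 0" for i by (simp add: r_def)
      then show ?thesis using \<open>f g = 0\<close> unfolding sum_fun_apply by simp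
    qed
  qed
  then have "f = (\<Sum>i<p. a i \<star> single (x [^] i))" unfolding ar .
  then show ?thesis using that aA by blast
qed

lemma lie_iso_witt_tw: "\<exists>n \<psi>. lie_iso (lie_power (witt_coeff p) n) tw_lie \<psi>"
proof -
  obtain U where U: "idem_family U" "\<And>u a. u \<in> U \<Longrightarrow> a \<in> A0 \<Longrightarrow> \<exists>c. u \<star> a = smul c u"
    using idempotent_basis by blast
  have Ufin: "finite U" and UA: "\<And>u. u \<in> U \<Longrightarrow> u \<in> A0" and U0: "\<And>u. u \<in> U \<Longrightarrow> u \<noteq> 0"
    and orth: "\<And>u v. u \<in> U \<Longrightarrow> v \<in> U \<Longrightarrow> u \<star> v = (if u = v then u else 0)" and Usum: "(\<Sum>u\<in>U. u) = single \<one>"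
    using U(1) unfolding idem_family_def by auto
  define n where "n = card U"
  obtain e where e: "bij_betw e {..<n} U" using ex_bij_betw_nat_finite[OF Ufin] unfolding n_def atLeast0LessThan by blast
  have eU: "e j \<in> U" if "j < n" for j using e that by (auto simp: bij_betw_def)
  have eA: "e j \<in> A0" and et: "e j \<in> tw" and e0: "e j \<noteq> 0" if "j < n" for j
    using UA U0 eU[OF that] A0_closed(5) by auto
  have eorth: "e j \<star> e l = (if j = l then e j else 0)" if "j < n" "l < n" for j l
  proof -
    have "e j = e l \<longleftrightarrow> j = l" using e that by (auto simp: bij_betw_def inj_on_eq_iff)
    then show ?thesis using orth[OF eU[OF that(1)] eU[OF that(2)]] by simp
  qed
  have esum: "(\<Sum>j<n. e j) = single \<one>" using sum.reindex_bij_betw[OF e, of "\<lambda>u. u"] Usum by simp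
  \<comment> \<open>The element that represents F d/dy in the block of the j-th idempotent.\<close>
  define Q where "Q j F = e j \<star> (Theta F \<star> xi)" for j F
  have Qtw: "Q j F \<in> tw" if "j < n" for j F unfolding Q_def using et[OF that] by (simp add: tw_conv)
  have Qlin: "Q j (F + H) = Q j F + Q j H" "Q j (F - H) = Q j F - Q j H" "Q j (fps_const c * F) = smul c (Q j F)"
    "Q j 0 = 0" for j F H c
    by (simp_all add: Q_def Theta_linear conv_add_left conv_add_right conv_diff_left conv_diff_right
        conv_smul_left conv_smul_right)
  \<comment> \<open>The term with F H and the square of \<open>xi\<close> is symmetric in F and H,
    so the bracket keeps F H' - H F' only. Different blocks are orthogonal.\<close>
  have Qlam: "Q j F \<star> (lam * Q l H) = (if j = l then e j \<star> (Theta (F * fps_deriv H) \<star> xi - Theta (F * H) \<star> (xi \<star> xi)) else 0)"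
    if j: "j < n" and l: "l < n" for j l F H
  proof -
    have "lam * Q l H = e l \<star> (Theta (fps_deriv H) - Theta H \<star> xi)"
      unfolding Q_def using lam_A0_conv[OF eA[OF l]] lam_Theta_xi by simp
    then have "Q j F \<star> (lam * Q l H) = e j \<star> ((Theta F \<star> xi) \<star> (e l \<star> (Theta (fps_deriv H) - Theta H \<star> xi)))"
      by (simp only: Q_def conv_assoc)
    also have "\<dots> = e j \<star> (e l \<star> ((Theta F \<star> xi) \<star> (Theta (fps_deriv H) - Theta H \<star> xi)))"
      using tw_ac(2)[OF tw_conv[OF Theta_tw xi_tw] et[OF l]] by simp
    also have "\<dots> = (e j \<star> e l) \<star> ((Theta F \<star> xi) \<star> (Theta (fps_deriv H) - Theta H \<star> xi))"
      by (simp only: conv_assoc)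
    also have "(Theta F \<star> xi) \<star> (Theta (fps_deriv H) - Theta H \<star> xi)
        = Theta (F * fps_deriv H) \<star> xi - Theta (F * H) \<star> (xi \<star> xi)"
      by (simp add: Theta_mult conv_diff_right conv_assoc tw_ac(1)[OF xi_tw Theta_tw] tw_ac(2)[OF xi_tw Theta_tw])
    finally have eq: "Q j F \<star> (lam * Q l H)
        = (e j \<star> e l) \<star> (Theta (F * fps_deriv H) \<star> xi - Theta (F * H) \<star> (xi \<star> xi))" .
    show ?thesis unfolding eq eorth[OF j l] by simp
  qed
  have Qbr: "tbr (Q j F) (Q l H) = (if j = l then Q j (F * fps_deriv H - H * fps_deriv F) else 0)"
    if "j < n" "l < n" for j l F H
    unfolding tbr_def Qlam[OF that] Qlam[OF that(2,1)]
    by (auto simp: Qlin) (simp add: Q_def conv_diff_right mult.commute)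
  let ?L = "lie_power (witt_coeff p :: (nat \<Rightarrow> 'k, 'k) lie_alg) n"
  define \<psi> where "\<psi> v = (\<Sum>j<n. Q j (Abs_fps (v j)))" for v :: "nat \<Rightarrow> nat \<Rightarrow> 'k"
  have \<psi>tw: "\<psi> v \<in> tw" for v unfolding \<psi>_def by (rule tw_sum) (simp add: Qtw)
  have eQ: "e l \<star> \<psi> v = Q l (Abs_fps (v l))" if l: "l < n" for l v
  proof -
    have "e l \<star> \<psi> v = (\<Sum>j<n. (e l \<star> e j) \<star> (Theta (Abs_fps (v j)) \<star> xi))"
      unfolding \<psi>_def Q_def by (simp only: conv_sum_right conv_assoc)
    also have "\<dots> = (\<Sum>j<n. if j = l then Q l (Abs_fps (v l)) else 0)"
      by (rule sum.cong) (auto simp: eorth[OF l] Q_def)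
    also have "\<dots> = Q l (Abs_fps (v l))" using l by (simp only: sum.delta finite_lessThan lessThan_iff if_True)
    finally show ?thesis .
  qed
  have inj: "inj_on \<psi> (lcarrier ?L)"
  proof (rule inj_onI)
    fix v w assume vw: "v \<in> lcarrier ?L" "w \<in> lcarrier ?L" "\<psi> v = \<psi> w"
    show "v = w"
    proof
      fix j
      show "v j = w j"
      proof (cases "j < n")
        case j: True
        have "Q j (Abs_fps (v j) - Abs_fps (w j)) = 0"
          using eQ[OF j, of v] eQ[OF j, of w] vw(3) by (simp add: Qlin)
        then have "e j \<star> Theta (Abs_fps (v j) - Abs_fps (w j)) \<star> (xi \<star> single x) = 0"
          unfolding Q_def by (metis conv_assoc conv_zero(1))
        then have "e j \<star> Theta (Abs_fps (v j) - Abs_fps (w j)) = 0" by (simp add: single_conv_single)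
        then have "v j i = w j i" if "i < p" for i
          using Theta_inj[OF eA[OF j] e0[OF j] _ that] by fastforce
        moreover have "v j \<in> fspace {..<p}" "w j \<in> fspace {..<p}"
          using vw j by (simp_all add: lie_power_def witt_coeff_def)
        then have "v j i = w j i" if "\<not> i < p" for i using that by (simp add: fspace_def)
        ultimately show ?thesis by blast
      qed (use vw in \<open>simp add: lie_power_def\<close>)
    qed
  qed
  have surj: "\<exists>v\<in>lcarrier ?L. \<psi> v = f" if f: "f \<in> tw" for f
  proof -
    \<comment> \<open>The images under \<open>Q\<close> carry the factor \<open>xi\<close>, so f is
      first multiplied by x. In block j each coefficient a i is a scalar c j i, and x^i is (1 +
      y)^i, which gives the series F j.\<close>
    obtain a where a: "\<And>i. a i \<in> A0" "f \<star> single x = (\<Sum>i<p. a i \<star> single (x [^] i))"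
      using tw_decompose[OF tw_conv[OF f tw_x]] by blast
    obtain c where c: "\<And>j i. j < n \<Longrightarrow> e j \<star> a i = smul (c j i) (e j)" using U(2)[OF eU a(1)] by metis
    define F where "F j = (\<Sum>i<p. fps_const (c j i) * (1 + fps_X) ^ i)" for j
    define v where "v j = (if j < n then trunc p (F j) else 0)" for j
    have "v \<in> lcarrier ?L" by (auto simp: v_def lie_power_def witt_coeff_def)
    moreover have "\<psi> v = f"
    proof -
      have "e j \<star> (f \<star> single x) = e j \<star> Theta (F j)" if j: "j < n" for j
      proof -
        have "e j \<star> (f \<star> single x) = (\<Sum>i<p. e j \<star> a i \<star> single (x [^] i))"
          unfolding a(2) by (simp only: conv_sum_right conv_assoc)
        also have "\<dots> = (\<Sum>i<p. e j \<star> Theta (fps_const (c j i) * (1 + fps_X) ^ i))"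
          unfolding c[OF j] Theta_linear single_x_pow by (simp only: conv_smul_left conv_smul_right)
        finally show ?thesis unfolding F_def Theta_sum conv_sum_right .
      qed
      note ef = this
      have "Q j (Abs_fps (v j)) = e j \<star> f" if j: "j < n" for j
      proof -
        have "Q j (Abs_fps (v j)) = (e j \<star> Theta (F j)) \<star> xi"
          using j by (simp add: Q_def v_def Theta_trunc conv_assoc)
        also have "\<dots> = e j \<star> (f \<star> (single x \<star> xi))" unfolding ef[OF j, symmetric] by (simp only: conv_assoc)
        finally show ?thesis using tw_fspace[OF f] by (simp add: x_xi)
      qed
      then have "\<psi> v = (\<Sum>j<n. e j \<star> f)" unfolding \<psi>_def by (intro sum.cong) auto
      also have "\<dots> = f" unfolding conv_sum_left[symmetric] esum using tw_fspace[OF f] by simp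
      finally show ?thesis .
    qed
    ultimately show ?thesis by blast
  qed
  have bracket: "\<psi> (lbracket ?L v w) = tbr (\<psi> v) (\<psi> w)" for v w
  proof -
    have Qt: "Q j (Abs_fps (trunc p F)) = Q j F" for j F by (simp add: Q_def Theta_trunc)
    have "tbr (\<psi> v) (\<psi> w) = (\<Sum>j<n. \<Sum>l<n. tbr (Q j (Abs_fps (v j))) (Q l (Abs_fps (w l))))"
    proof -
      have "(\<Sum>l<n. \<Sum>j<n. Q j (Abs_fps (v j)) \<star> (lam * Q l (Abs_fps (w l))))
          = (\<Sum>j<n. \<Sum>l<n. Q j (Abs_fps (v j)) \<star> (lam * Q l (Abs_fps (w l))))" by (rule sum.swap)
      then show ?thesis
        unfolding tbr_def \<psi>_def sum_distrib_left conv_sum_left conv_sum_right sum_subtractf by simp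
    qed
    also have "\<dots> = (\<Sum>j<n. \<Sum>l<n. if j = l then Q j (Abs_fps (wbr p (v j) (w j))) else 0)"
      by (intro sum.cong refl) (auto simp: Qbr Qt wbr_def)
    also have "\<dots> = (\<Sum>j<n. Q j (Abs_fps (wbr p (v j) (w j))))"
    proof (rule sum.cong[OF refl])
      fix j assume "j \<in> {..<n}"
      then show "(\<Sum>l<n. if j = l then Q j (Abs_fps (wbr p (v j) (w j))) else 0) = Q j (Abs_fps (wbr p (v j) (w j)))"
        by (simp only: sum.delta' finite_lessThan if_True)
    qed
    also have "\<dots> = \<psi> (lbracket ?L v w)"
      unfolding \<psi>_def by (rule sum.cong) (auto simp: lie_power_def witt_coeff_def)
    finally show ?thesis ..
  qed
  have plus: "\<psi> (lplus ?L v w) = \<psi> v + \<psi> w" for v w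
  proof -
    have "\<psi> (lplus ?L v w) = (\<Sum>j<n. Q j (Abs_fps (v j)) + Q j (Abs_fps (w j)))"
      unfolding \<psi>_def by (rule sum.cong) (auto simp: lie_power_def witt_coeff_def Abs_fps_linear Qlin)
    then show ?thesis unfolding \<psi>_def sum.distrib .
  qed
  have scale: "\<psi> (lscale ?L c v) = smul c (\<psi> v)" for c v
  proof -
    have "\<psi> (lscale ?L c v) = (\<Sum>j<n. smul c (Q j (Abs_fps (v j))))"
      unfolding \<psi>_def by (rule sum.cong) (auto simp: lie_power_def witt_coeff_def Abs_fps_linear Qlin)
    then show ?thesis unfolding \<psi>_def fun_vs.scale_sum_right .
  qed
  have "\<psi> ` lcarrier ?L = tw"
  proof (intro equalityI subsetI)
    fix f assume "f \<in> tw" then show "f \<in> \<psi> ` lcarrier ?L" using surj by blast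
  qed (use \<psi>tw in blast)
  then have "lie_iso ?L tw_lie \<psi>"
    unfolding lie_iso_def bij_betw_def using inj plus scale bracket by (simp add: tw_lie_def)
  then show ?thesis by blast
qed

end

section \<open>The theorem\<close>

lemma (in finite_group) conjugate_subgroup:
  assumes H: "subgroup H G" and g: "g \<in> carrier G"
  shows "subgroup ((\<lambda>h. g \<otimes> h \<otimes> inv g) ` H) G" "card ((\<lambda>h. g \<otimes> h \<otimes> inv g) ` H) = card H"
proof -
  have HG: "h \<in> carrier G" if "h \<in> H" for h using that H subgroup.subset by blast
  show "subgroup ((\<lambda>h. g \<otimes> h \<otimes> inv g) ` H) G"
  proof (rule subgroupI)
    show "(\<lambda>h. g \<otimes> h \<otimes> inv g) ` H \<noteq> {}" using subgroup.one_closed[OF H] by blast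
    fix a assume "a \<in> (\<lambda>h. g \<otimes> h \<otimes> inv g) ` H"
    then obtain h where h: "h \<in> H" "a = g \<otimes> h \<otimes> inv g" by blast
    have "inv a = g \<otimes> inv h \<otimes> inv g" using h g HG by (simp add: inv_mult_group m_assoc)
    then show "inv a \<in> (\<lambda>h. g \<otimes> h \<otimes> inv g) ` H" using subgroup.m_inv_closed[OF H h(1)] by blast
    fix b assume "b \<in> (\<lambda>h. g \<otimes> h \<otimes> inv g) ` H"
    then obtain l where l: "l \<in> H" "b = g \<otimes> l \<otimes> inv g" by blast
    have "a \<otimes> b = g \<otimes> (h \<otimes> l) \<otimes> inv g" using h l g HG by (simp add: m_assoc)
    then show "a \<otimes> b \<in> (\<lambda>h. g \<otimes> h \<otimes> inv g) ` H" using subgroup.m_closed[OF H h(1) l(1)] by blast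
  qed (use g HG in auto)
  have "inj_on (\<lambda>h. g \<otimes> h \<otimes> inv g) H" using g HG by (intro inj_onI) simp
  then show "card ((\<lambda>h. g \<otimes> h \<otimes> inv g) ` H) = card H" by (rule card_image)
qed

lemma (in finite_group) cyclic_subgroup_generator:
  assumes H: "subgroup H G" and c: "cyclic_group (subgroup_generated G H)"
  obtains x where "x \<in> carrier G" "H = {x [^] (i::nat) |i. True}"
proof -
  have car: "carrier (subgroup_generated G H) = H" by (rule subgroup.carrier_subgroup_generated_subgroup[OF H])
  obtain x where x: "x \<in> H" "H = range (\<lambda>n::int. x [^]\<^bsub>subgroup_generated G H\<^esub> n)"
    using c group.cyclic_group[OF group_subgroup_generated, of H] car by auto
  have xG: "x \<in> carrier G" using x(1) H subgroup.subset by blast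
  have "H = {x [^] (k::int) |k. k \<in> UNIV}" using x by (auto simp: int_pow_subgroup_generated car)
  also have "\<dots> = generate G {x}" by (rule generate_pow[OF xG, symmetric])
  also have "\<dots> = {x [^] (i::nat) |i. True}" using generate_pow_on_finite_carrier[OF fin xG] by simp
  finally show ?thesis using that xG by blast
qed

text \<open>Conjugates of \<open>P\<close> are subgroups of the same order, so uniqueness makes
  \<open>P\<close> normal. Its index is prime to p, as otherwise a higher power of p would divide
  the order of G.\<close>

lemma (in finite_group) cyclic_sylow_locale:
  assumes p: "CHAR('k::field) > 0" "CHAR('k) dvd Coset.order G"
    and uniq: "\<exists>!P. sylow_subgroup G CHAR('k) P"
    and P: "sylow_subgroup G CHAR('k) P" and cyc: "cyclic_group (subgroup_generated G P)"
  obtains x where "cyclic_sylow TYPE('k) G P x CHAR('k) (multiplicity CHAR('k) (Coset.order G))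
      (Coset.order G div CHAR('k) ^ multiplicity CHAR('k) (Coset.order G))"
proof -
  let ?p = "CHAR('k)"
  let ?a = "multiplicity ?p (Coset.order G)"
  have pr: "Factorial_Ring.prime ?p" using p(1) by (rule prime_CHAR_semidom)
  have o0: "Coset.order G \<noteq> 0" using fin one_closed card_gt_0_iff[of "carrier G"] by (auto simp: Coset.order_def)
  have sP: "subgroup P G" and cP: "card P = ?p ^ ?a" using P by (auto simp: sylow_subgroup_def)
  obtain x where x: "x \<in> carrier G" "P = {x [^] (i::nat) |i. True}"
    using cyclic_subgroup_generator[OF sP cyc] .
  have nP: "P \<lhd> G"
    unfolding normal_inv_iff
  proof (intro conjI ballI sP)
    fix g h assume gh: "g \<in> carrier G" "h \<in> P"
    have "sylow_subgroup G ?p ((\<lambda>h. g \<otimes> h \<otimes> inv g) ` P)"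
      using conjugate_subgroup[OF sP gh(1)] cP by (simp add: sylow_subgroup_def)
    then have "(\<lambda>h. g \<otimes> h \<otimes> inv g) ` P = P" using uniq P by blast
    then show "g \<otimes> h \<otimes> inv g \<in> P" using gh(2) by blast
  qed
  have q: "card (rcosets P) * ?p ^ ?a = Coset.order G" using lagrange[OF sP] cP by simp
  then have qe: "card (rcosets P) = Coset.order G div ?p ^ ?a" using p(1) by (metis nonzero_mult_div_cancel_right power_not_zero less_numeral_extra(3))
  have nq: "\<not> ?p dvd card (rcosets P)"
  proof
    assume "?p dvd card (rcosets P)"
    then have "?p ^ Suc ?a dvd Coset.order G" using q by (metis mult_dvd_mono dvd_refl power_Suc)
    then have "Suc ?a \<le> ?a" using o0 pr by (subst (asm) power_dvd_iff_le_multiplicity) auto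
    then show False by simp
  qed
  have a0: "?a > 0" using p(2) o0 pr by (simp add: multiplicity_gt_zero_iff)
  have "cyclic_sylow TYPE('k) G P x ?p ?a (Coset.order G div ?p ^ ?a)"
    using pr nP x(2,1) cP a0 qe nq[unfolded qe]
    by (intro cyclic_sylow.intro cyclic_sylow_axioms.intro finite_group_axioms refl)
  then show ?thesis using that by blast
qed

theorem theorem4p1:
  fixes G :: "'g monoid"
    and k_type :: "'k::alg_closed_field itself"
  assumes "group G"
    and "finite (carrier G)"
    and "CHAR('k) > 0"
    and "CHAR('k) dvd Coset.order G"
    and "\<exists>!P. sylow_subgroup G CHAR('k) P"
    and "\<forall>P. sylow_subgroup G CHAR('k) P \<longrightarrow> cyclic_group (subgroup_generated G P)"
  shows "(lie_semisimple (HH1 (carrier G) (group_alg_mult G :: ('g \<Rightarrow> 'k) \<Rightarrow> _ \<Rightarrow> _))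
          \<longleftrightarrow> (\<exists>K C. internal_direct_product G K C
                   \<and> card K = Coset.order G div CHAR('k) ^ multiplicity CHAR('k) (Coset.order G)
                   \<and> cyclic_group (subgroup_generated G C) \<and> card C = CHAR('k))
               \<and> CHAR('k) \<noteq> 2)
       \<and> (lie_semisimple (HH1 (carrier G) (group_alg_mult G :: ('g \<Rightarrow> 'k) \<Rightarrow> _ \<Rightarrow> _))
          \<longleftrightarrow> (\<exists>n \<phi>. lie_iso (HH1 (carrier G) (group_alg_mult G :: ('g \<Rightarrow> 'k) \<Rightarrow> _ \<Rightarrow> _))
                               (lie_power (witt_W11 CHAR('k) :: ((nat \<Rightarrow> 'k) \<Rightarrow> _, 'k) lie_alg) n) \<phi>)
               \<and> CHAR('k) \<noteq> 2)"
    (is "(?ss \<longleftrightarrow> ?dp \<and> ?p \<noteq> 2) \<and> (?ss \<longleftrightarrow> ?witt \<and> _)")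
proof -
  let ?H = "HH1 (carrier G) (group_alg_mult G :: ('g \<Rightarrow> 'k) \<Rightarrow> _ \<Rightarrow> _)"
  let ?a = "multiplicity ?p (Coset.order G)" and ?q = "Coset.order G div ?p ^ multiplicity ?p (Coset.order G)"
  interpret finite_group G using assms(1,2) by (simp add: finite_group_def finite_group_axioms_def)
  obtain P where P: "sylow_subgroup G ?p P" using assms(5) by blast
  obtain x where cs: "cyclic_sylow TYPE('k) G P x ?p ?a ?q"
    using cyclic_sylow_locale[OF assms(3-5) P] assms(6) P by blast
  interpret cs: cyclic_sylow G P x ?p ?a ?q "TYPE('k)" by (rule cs)
  have p1: "?p > 1" using cs.p_prime by (rule prime_gt_1_nat)
  have p2: "?p > 2" if "?p \<noteq> 2" using that p1 by linarith
  have ss_iff: "?ss \<longleftrightarrow> lie_semisimple cs.tw.tw_lie" by (rule cs.tw.HH1_semisimple_iff)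
  have witt_closed: "lie_closed (witt_W11 ?p :: ((nat \<Rightarrow> 'k) \<Rightarrow> _, 'k) lie_alg)"
  proof (rule lie_closed_iso[OF lie_iso_witt[OF refl p1] witt_coeff_closed])
    show "wder ?p (lzero (witt_coeff ?p)) = lzero (witt_W11 ?p :: ((nat \<Rightarrow> 'k) \<Rightarrow> _, 'k) lie_alg)"
      by (auto simp: wder_def witt_coeff_def witt_W11_def der_lie_def fun_eq_iff Abs_fps_linear trunc_linear)
  qed
  note pow_iso = lie_power_iso[OF lie_iso_witt[OF refl p1] witt_coeff_closed witt_closed]
  have 1: "?dp \<and> ?p \<noteq> 2" if ?ss
  proof -
    have ss: "lie_semisimple cs.tw.tw_lie" using that ss_iff by blast
    show ?thesis using cs.direct_product_of_semisimple[OF ss] assms(6) P by blast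
  qed
  have 2: "?witt" if dp: ?dp
  proof -
    obtain K C where KC: "internal_direct_product G K C" "card K = ?q"
      "cyclic_group (subgroup_generated G C)" "card C = ?p" using dp by blast
    have q0: "?q > 0" using cs.q_coprime by (metis dvd_0_right gr0I)
    \<comment> \<open>Both sides count G, by the direct product and by Lagrange. Thus p^a = p, the
      cyclic factor C has the order of a Sylow subgroup, and uniqueness identifies it with
      \<open>P\<close>.\<close>
    have "?q * ?p = ?q * ?p ^ ?a"
      using order_internal_direct_product[OF KC(1)] KC(2,4) lagrange[OF cs.P_subgroup] cs.q_eq cs.P_card by simp
    then have pa: "?p ^ ?a = ?p" using q0 by simp
    have "subgroup C G" using KC(1) normal_imp_subgroup by (auto simp: internal_direct_product_def)
    then have "sylow_subgroup G ?p C" using KC(4) pa by (simp add: sylow_subgroup_def)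
    then have CP: "C = P" using assms(5) P by blast
    note data = cs.direct_product_data[OF KC(1)[unfolded CP]]
    have cP: "card P = ?p" using KC(4) CP by simp
    have nK: "\<not> ?p dvd card K" using cs.q_coprime KC(2) by simp
    note chi1 = data(1)[OF nK cP] and ker = data(2)[OF nK cP]
    interpret sg: split_group G cs.chi cs.lam x P cs.T ?p
    proof
      show "x [^]\<^bsub>G\<^esub> ?p = \<one>\<^bsub>G\<^esub>" using pow_eq_id[OF cs.x_in] cs.ord_x pa by simp
      show "\<exists>i<?p. cs.lam g = of_nat i" if "g \<in> carrier G" for g
        using cs.lam_in_prime_field[of g] that chi1 by (simp add: cs.tw.C_def)
      show "of_nat (card cs.tw.kerlam) \<noteq> (0::'k)" using ker nK cs.of_nat_eq_0 by simp
    qed (use chi1 p1 in auto)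
    obtain n \<psi> where iso: "lie_iso (lie_power (witt_coeff ?p) n) cs.tw.tw_lie \<psi>" using sg.lie_iso_witt_tw by blast
    have "lie_iso ?H cs.tw.tw_lie (inv_into (lcarrier cs.tw.tw_lie) (\<lambda>f. lcoset DL inner (cs.tw.twD f)))"
      by (rule lie_iso_sym[OF cs.tw.lie_iso_tw_HH1 cs.tw.tw_lie_closed])
    from lie_iso_trans[OF lie_iso_trans[OF this lie_iso_sym[OF iso lie_power_closed[OF witt_coeff_closed]]] pow_iso]
    show ?thesis by blast
  qed
  have 3: "?ss" if "?witt" "?p \<noteq> 2"
  proof -
    obtain n \<phi> where iso: "lie_iso ?H (lie_power (witt_W11 ?p :: ((nat \<Rightarrow> 'k) \<Rightarrow> _, 'k) lie_alg) n) \<phi>"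
      using \<open>?witt\<close> by blast
    have pc: "lie_closed (lie_power (witt_coeff ?p :: (nat \<Rightarrow> 'k, 'k) lie_alg) n)"
      by (rule lie_power_closed[OF witt_coeff_closed])
    have pw: "lie_closed (lie_power (witt_W11 ?p :: ((nat \<Rightarrow> 'k) \<Rightarrow> _, 'k) lie_alg) n)"
      by (rule lie_power_closed[OF witt_closed])
    have "lie_semisimple (lie_power (witt_W11 ?p :: ((nat \<Rightarrow> 'k) \<Rightarrow> _, 'k) lie_alg) n)"
      by (rule lie_semisimple_iso[OF lie_iso_sym[OF pow_iso pc] pw pc witt_power_semisimple[OF refl p2[OF that(2)]]])
    then show ?thesis by (rule lie_semisimple_iso[OF iso cs.tw.HH1_closed pw])
  qed
  show ?thesis using 1 2 3 by blast
qed

end
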